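(* Let $\mathcal{K}$ be a category enriched over $\mathbf{Pos}$ which has reflexive coinserters. Then $\mathcal{K}$ is equivalent (as an enriched category) to a variety of ordered algebras if and only if $\mathcal{K}$ has a subregular generator which is an abstractly finite subeffective projective.
   Context: Everything is enriched over the cartesian closed category $\mathbf{Pos}$ of posets and monotone maps: a category has partially ordered hom-sets with monotone composition, and "functor" means a functor that is monotone on hom-sets. Sets are regarded as discrete posets. Variety: for a finitary signature $\Sigma=(\Sigma_n)_{n\in\mathbb{N}}$, an ordered $\Sigma$-algebra is a poset with a $\Sigma$-algebra structure whose operations are monotone; $\Sigma\text{-}\mathbf{Alg}$ is the category of ordered $\Sigma$-algebras and monotone homomorphisms (ordered pointwise). A variety of ordered algebras is a full subcategory of some $\Sigma\text{-}\mathbf{Alg}$ consisting of all algebras satisfying a given set of inequations $s\le t$ between terms. Coinserter: a coinserter of a parallel pair $u_0,u_1\colon U\to X$ is a morphism $f\colon X\to Y$ with $fu_0\le fu_1$ such that (a) every $f'\colon X\to Y'$ with $f'u_0\le f'u_1$ factorizes as $f'=gf$ for some $g\colon Y\to Y'$, and (b) for parallel $g,\bar g\colon Y\to Y'$, $gf\le\bar gf$ implies $g\le\bar g$. A pair $u_0,u_1\colon U\to X$ is reflexive if there is $d\colon X\to U$ with $u_0d=u_1d=\mathrm{id}_X$; a reflexive coinserter is a coinserter of a reflexive pair, and "having reflexive coinserters" means every reflexive pair has a coinserter. A subregular epimorphism is a morphism that is a coinserter of some parallel pair. Tensors and copowers: a tensor $P\otimes K$ of an object $K$ with a poset $P$ is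 an object with isomorphisms $\mathbf{Pos}(P,\mathcal{K}(K,X))\cong\mathcal{K}(P\otimes K,X)$ of posets natural in $X$, written $f\mapsto\hat f$. For a set (discrete poset) $M$ this is the copower $M.K=\coprod_M K$. The canonical morphism $c_X\colon\mathcal{K}(G,X)\otimes G\to X$ is $c_X=\widehat{\mathrm{id}_{\mathcal{K}(G,X)}}$. An object $G$ is a subregular generator if it has tensors with all posets and, for every object $X$, the canonical morphism $c_X$ is a subregular epimorphism. An object $G$ is abstractly finite if all copowers $M.G$ ($M$ a set) exist and every morphism $G\to M.G$ factorizes through the morphism $M'.G\to M.G$ induced by the inclusion of some finite subset $M'\subseteq M$. An object $G$ is a subeffective projective if its hom-functor $\mathcal{K}(G,-)\colon\mathcal{K}\to\mathbf{Pos}$ preserves coinserters of reflexive pairs. *)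

theory Defs
  imports "HOL-Library.Countable_Set" "HOL-Library.FuncSet"
begin

unbundle cardinal_syntax

section \<open>Size\<close>

text \<open>
  HOL has no set of all sets, so "set" is read relative to a universe given by a type \<open>'u\<close>: a set
  (of elements of any type) is small if its cardinality is strictly below that of \<open>'u\<close>.  Of \<open>'u\<close>
  we only require that its cardinality is uncountable and regular.  A Grothendieck universe is the
  special case in which this cardinality is moreover a strong limit, i.e. inaccessible; HOL cannot
  prove that such types exist, so a strong limit is not demanded here.
\<close>

definition universe :: "'u itself \<Rightarrow> bool" where
  "universe U \<longleftrightarrow> uncountable (UNIV :: 'u set) \<and> regularCard |UNIV :: 'u set|"

definition small :: "'u itself \<Rightarrow> 'x set \<Rightarrow> bool" where
  "small U A \<longleftrightarrow> |A| <o |UNIV :: 'u set|"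


section \<open>Posets and monotone maps\<close>

text \<open>
  A poset is a relation \<open>P\<close> with \<open>Partial_order P\<close>; its underlying set is \<open>Field P\<close>, and the discrete
  poset on a set \<open>M\<close> is \<open>Id_on M\<close>.
\<close>

definition mono_maps :: "'p rel \<Rightarrow> 'q rel \<Rightarrow> ('p \<Rightarrow> 'q) set" where
  "mono_maps P Q = {f \<in> Field P \<rightarrow>\<^sub>E Field Q. \<forall>x y. (x, y) \<in> P \<longrightarrow> (f x, f y) \<in> Q}"

definition pointwise_le :: "'p rel \<Rightarrow> 'q rel \<Rightarrow> ('p \<Rightarrow> 'q) \<Rightarrow> ('p \<Rightarrow> 'q) \<Rightarrow> bool" where
  "pointwise_le P Q f g \<longleftrightarrow> (\<forall>x\<in>Field P. (f x, g x) \<in> Q)"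


section \<open>Categories enriched over posets\<close>

record ('o, 'a) poscat =
  Obj :: "'o set"
  Arr :: "'a set"
  Dom :: "'a \<Rightarrow> 'o"
  Cod :: "'a \<Rightarrow> 'o"
  Idt :: "'o \<Rightarrow> 'a"
  Comp :: "'a \<Rightarrow> 'a \<Rightarrow> 'a"  (infixr \<open>\<cdot>\<index>\<close> 70)
  Le :: "'a rel"

definition hom :: "('o, 'a) poscat \<Rightarrow> 'o \<Rightarrow> 'o \<Rightarrow> 'a set" where
  "hom C X Y = {f \<in> Arr C. Dom C f = X \<and> Cod C f = Y}"

definition hom_poset :: "('o, 'a) poscat \<Rightarrow> 'o \<Rightarrow> 'o \<Rightarrow> 'a rel" where
  "hom_poset C X Y = Restr (Le C) (hom C X Y)"

locale pos_category =
  fixes C :: "('o, 'a) poscat" (structure)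
  assumes dom_obj: "f \<in> Arr C \<Longrightarrow> Dom C f \<in> Obj C"
    and cod_obj: "f \<in> Arr C \<Longrightarrow> Cod C f \<in> Obj C"
    and id_hom: "X \<in> Obj C \<Longrightarrow> Idt C X \<in> hom C X X"
    and comp_hom: "f \<in> hom C X Y \<Longrightarrow> g \<in> hom C Y Z \<Longrightarrow> g \<cdot> f \<in> hom C X Z"
    and comp_id_right: "f \<in> hom C X Y \<Longrightarrow> f \<cdot> Idt C X = f"
    and comp_id_left: "f \<in> hom C X Y \<Longrightarrow> Idt C Y \<cdot> f = f"
    and comp_assoc: "f \<in> hom C W X \<Longrightarrow> g \<in> hom C X Y \<Longrightarrow> h \<in> hom C Y Z \<Longrightarrow>
                       (h \<cdot> g) \<cdot> f = h \<cdot> (g \<cdot> f)"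
    and hom_order: "X \<in> Obj C \<Longrightarrow> Y \<in> Obj C \<Longrightarrow> partial_order_on (hom C X Y) (hom_poset C X Y)"
    and comp_mono: "(f, f') \<in> hom_poset C X Y \<Longrightarrow> (g, g') \<in> hom_poset C Y Z \<Longrightarrow>
                      (g \<cdot> f, g' \<cdot> f') \<in> hom_poset C X Z"

definition full_subcategory :: "('o, 'a) poscat \<Rightarrow> 'o set \<Rightarrow> ('o, 'a) poscat" where
  "full_subcategory C S =
     C\<lparr>Obj := Obj C \<inter> S, Arr := {f \<in> Arr C. Dom C f \<in> S \<and> Cod C f \<in> S}\<rparr>"

definition pos_functor ::
    "('o, 'a) poscat \<Rightarrow> ('p, 'b) poscat \<Rightarrow> ('o \<Rightarrow> 'p) \<Rightarrow> ('a \<Rightarrow> 'b) \<Rightarrow> bool" where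
  "pos_functor C D Fo Fa \<longleftrightarrow>
     (\<forall>X\<in>Obj C. Fo X \<in> Obj D \<and> Fa (Idt C X) = Idt D (Fo X)) \<and>
     (\<forall>X Y f. f \<in> hom C X Y \<longrightarrow> Fa f \<in> hom D (Fo X) (Fo Y)) \<and>
     (\<forall>X Y Z f g. f \<in> hom C X Y \<and> g \<in> hom C Y Z \<longrightarrow> Fa (g \<cdot>\<^bsub>C\<^esub> f) = Fa g \<cdot>\<^bsub>D\<^esub> Fa f) \<and>
     (\<forall>X Y f g. (f, g) \<in> hom_poset C X Y \<longrightarrow> (Fa f, Fa g) \<in> hom_poset D (Fo X) (Fo Y))"

definition iso :: "('o, 'a) poscat \<Rightarrow> 'o \<Rightarrow> 'o \<Rightarrow> 'a \<Rightarrow> bool" where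
  "iso C X Y f \<longleftrightarrow> f \<in> hom C X Y \<and> (\<exists>g\<in>hom C Y X. g \<cdot>\<^bsub>C\<^esub> f = Idt C X \<and> f \<cdot>\<^bsub>C\<^esub> g = Idt C Y)"

definition natural_iso ::
    "('o, 'a) poscat \<Rightarrow> ('p, 'b) poscat \<Rightarrow> ('o \<Rightarrow> 'p) \<Rightarrow> ('a \<Rightarrow> 'b) \<Rightarrow> ('o \<Rightarrow> 'p) \<Rightarrow> ('a \<Rightarrow> 'b)
      \<Rightarrow> ('o \<Rightarrow> 'b) \<Rightarrow> bool" where
  "natural_iso C D Fo Fa Ho Ha \<eta> \<longleftrightarrow>
     (\<forall>X\<in>Obj C. iso D (Fo X) (Ho X) (\<eta> X)) \<and>
     (\<forall>X Y f. f \<in> hom C X Y \<longrightarrow> \<eta> Y \<cdot>\<^bsub>D\<^esub> Fa f = Ha f \<cdot>\<^bsub>D\<^esub> \<eta> X)"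

definition equivalent :: "('o, 'a) poscat \<Rightarrow> ('p, 'b) poscat \<Rightarrow> bool" where
  "equivalent C D \<longleftrightarrow>
     (\<exists>Fo Fa Ho Ha \<eta> \<epsilon>. pos_functor C D Fo Fa \<and> pos_functor D C Ho Ha \<and>
        natural_iso C C id id (Ho \<circ> Fo) (Ha \<circ> Fa) \<eta> \<and>
        natural_iso D D (Fo \<circ> Ho) (Fa \<circ> Ha) id id \<epsilon>)"


section \<open>Coinserters\<close>

definition parallel_pair :: "('o, 'a) poscat \<Rightarrow> 'a \<Rightarrow> 'a \<Rightarrow> bool" where
  "parallel_pair C u0 u1 \<longleftrightarrow>
     u0 \<in> Arr C \<and> u1 \<in> Arr C \<and> Dom C u0 = Dom C u1 \<and> Cod C u0 = Cod C u1"

definition reflexive_pair :: "('o, 'a) poscat \<Rightarrow> 'a \<Rightarrow> 'a \<Rightarrow> bool" where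
  "reflexive_pair C u0 u1 \<longleftrightarrow> parallel_pair C u0 u1 \<and>
     (\<exists>d\<in>hom C (Cod C u0) (Dom C u0).
        u0 \<cdot>\<^bsub>C\<^esub> d = Idt C (Cod C u0) \<and> u1 \<cdot>\<^bsub>C\<^esub> d = Idt C (Cod C u0))"

definition coinserter :: "('o, 'a) poscat \<Rightarrow> 'a \<Rightarrow> 'a \<Rightarrow> 'a \<Rightarrow> bool" where
  "coinserter C u0 u1 f \<longleftrightarrow>
     parallel_pair C u0 u1 \<and>
     f \<in> Arr C \<and> Dom C f = Cod C u0 \<and> (f \<cdot>\<^bsub>C\<^esub> u0, f \<cdot>\<^bsub>C\<^esub> u1) \<in> Le C \<and>
     (\<forall>f'\<in>Arr C. Dom C f' = Cod C u0 \<and> (f' \<cdot>\<^bsub>C\<^esub> u0, f' \<cdot>\<^bsub>C\<^esub> u1) \<in> Le C \<longrightarrow>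
        (\<exists>g\<in>hom C (Cod C f) (Cod C f'). f' = g \<cdot>\<^bsub>C\<^esub> f)) \<and>
     (\<forall>g g'. parallel_pair C g g' \<and> Dom C g = Cod C f \<and> (g \<cdot>\<^bsub>C\<^esub> f, g' \<cdot>\<^bsub>C\<^esub> f) \<in> Le C \<longrightarrow>
        (g, g') \<in> Le C)"

definition has_reflexive_coinserters :: "('o, 'a) poscat \<Rightarrow> bool" where
  "has_reflexive_coinserters C \<longleftrightarrow>
     (\<forall>u0 u1. reflexive_pair C u0 u1 \<longrightarrow> (\<exists>f. coinserter C u0 u1 f))"

definition subregular_epi :: "('o, 'a) poscat \<Rightarrow> 'a \<Rightarrow> bool" where
  "subregular_epi C f \<longleftrightarrow> (\<exists>u0 u1. coinserter C u0 u1 f)"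

definition preserves_reflexive_coinserters ::
    "('o, 'a) poscat \<Rightarrow> ('p, 'b) poscat \<Rightarrow> ('a \<Rightarrow> 'b) \<Rightarrow> bool" where
  "preserves_reflexive_coinserters C D Fa \<longleftrightarrow>
     (\<forall>u0 u1 f. reflexive_pair C u0 u1 \<and> coinserter C u0 u1 f \<longrightarrow>
        coinserter D (Fa u0) (Fa u1) (Fa f))"


section \<open>Concrete categories over posets\<close>

text \<open>
  Objects are structures with an underlying poset; an arrow is a triple of domain, codomain and
  underlying map.  Underlying maps are ordered pointwise.
\<close>

definition concrete_cat ::
    "'o set \<Rightarrow> ('o \<Rightarrow> 'p rel) \<Rightarrow> ('o \<Rightarrow> 'o \<Rightarrow> ('p \<Rightarrow> 'p) set) \<Rightarrow> ('o, 'o \<times> 'o \<times> ('p \<Rightarrow> 'p)) poscat" where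
  "concrete_cat S r H =
    \<lparr>Obj = S,
     Arr = {(A, B, f) | A B f. A \<in> S \<and> B \<in> S \<and> f \<in> H A B},
     Dom = (\<lambda>(A, B, f). A),
     Cod = (\<lambda>(A, B, f). B),
     Idt = (\<lambda>A. (A, A, \<lambda>x\<in>Field (r A). x)),
     Comp = (\<lambda>(B', D, g) (A, B, f). (A, D, compose (Field (r A)) g f)),
     Le = {((A, B, f), (A, B, g)) | A B f g. pointwise_le (r A) (r B) f g}\<rparr>"

text \<open>The category of small posets whose elements are drawn from a type \<open>'p\<close>.\<close>

definition Pos :: "'u itself \<Rightarrow> ('p rel, 'p rel \<times> 'p rel \<times> ('p \<Rightarrow> 'p)) poscat" where
  "Pos U = concrete_cat {P. Partial_order P \<and> small U (Field P)} (\<lambda>P. P) mono_maps"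


section \<open>Varieties of ordered algebras\<close>

type_synonym 's signature = "nat \<Rightarrow> 's set"

definition small_signature :: "'u itself \<Rightarrow> 's signature \<Rightarrow> bool" where
  "small_signature U \<Sigma> \<longleftrightarrow> (\<forall>n. small U (\<Sigma> n))"

text \<open>
  \<open>opn A n \<sigma>\<close> is the operation of the symbol \<open>\<sigma> \<in> \<Sigma> n\<close>, applied to lists of length \<open>n\<close> over the
  carrier.  Its values elsewhere are irrelevant: algebras that differ only there are isomorphic.
\<close>

record ('s, 'u) oalg =
  ord :: "'u rel"
  opn :: "nat \<Rightarrow> 's \<Rightarrow> 'u list \<Rightarrow> 'u"

abbreviation carr :: "('s, 'u) oalg \<Rightarrow> 'u set" where
  "carr A \<equiv> Field (ord A)"

definition ordered_algebra :: "'s signature \<Rightarrow> ('s, 'u) oalg \<Rightarrow> bool" where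
  "ordered_algebra \<Sigma> A \<longleftrightarrow> Partial_order (ord A) \<and>
     (\<forall>n. \<forall>\<sigma>\<in>\<Sigma> n. \<forall>xs\<in>lists (carr A). length xs = n \<longrightarrow> opn A n \<sigma> xs \<in> carr A) \<and>
     (\<forall>n. \<forall>\<sigma>\<in>\<Sigma> n. \<forall>xs ys. length xs = n \<and> list_all2 (\<lambda>x y. (x, y) \<in> ord A) xs ys \<longrightarrow>
        (opn A n \<sigma> xs, opn A n \<sigma> ys) \<in> ord A)"

definition alg_homs :: "'s signature \<Rightarrow> ('s, 'u) oalg \<Rightarrow> ('s, 'u) oalg \<Rightarrow> ('u \<Rightarrow> 'u) set" where
  "alg_homs \<Sigma> A B = {f \<in> mono_maps (ord A) (ord B).
     \<forall>n. \<forall>\<sigma>\<in>\<Sigma> n. \<forall>xs\<in>lists (carr A). length xs = n \<longrightarrow>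
       f (opn A n \<sigma> xs) = opn B n \<sigma> (map f xs)}"

definition Alg :: "'s signature \<Rightarrow>
    (('s, 'u) oalg, ('s, 'u) oalg \<times> ('s, 'u) oalg \<times> ('u \<Rightarrow> 'u)) poscat" where
  "Alg \<Sigma> = concrete_cat {A. ordered_algebra \<Sigma> A \<and> small TYPE('u) (carr A)} ord (alg_homs \<Sigma>)"

text \<open>
  Terms over countably many variables.  In \<open>Op \<sigma> ts\<close> the symbol \<open>\<sigma>\<close> is used with arity \<open>length ts\<close>.
\<close>

datatype 's trm = Var nat | Op 's "'s trm list"

fun is_term :: "'s signature \<Rightarrow> 's trm \<Rightarrow> bool" where
  "is_term \<Sigma> (Var i) \<longleftrightarrow> True"
| "is_term \<Sigma> (Op \<sigma> ts) \<longleftrightarrow> \<sigma> \<in> \<Sigma> (length ts) \<and> (\<forall>t\<in>set ts. is_term \<Sigma> t)"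

fun eval_trm :: "('s, 'u) oalg \<Rightarrow> (nat \<Rightarrow> 'u) \<Rightarrow> 's trm \<Rightarrow> 'u" where
  "eval_trm A v (Var i) = v i"
| "eval_trm A v (Op \<sigma> ts) = opn A (length ts) \<sigma> (map (eval_trm A v) ts)"

definition satisfies :: "('s, 'u) oalg \<Rightarrow> 's trm \<Rightarrow> 's trm \<Rightarrow> bool" where
  "satisfies A s t \<longleftrightarrow> (\<forall>v. range v \<subseteq> carr A \<longrightarrow> (eval_trm A v s, eval_trm A v t) \<in> ord A)"

text \<open>
  Carriers and signatures live in the universe type itself; every small set is in bijection with a
  subset of \<open>'u\<close>, so up to isomorphism this is no restriction.
\<close>

definition variety ::
    "(('u, 'u) oalg, ('u, 'u) oalg \<times> ('u, 'u) oalg \<times> ('u \<Rightarrow> 'u)) poscat \<Rightarrow> bool" where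
  "variety V \<longleftrightarrow>
     (\<exists>\<Sigma> E. small_signature TYPE('u) \<Sigma> \<and> (\<forall>(s, t)\<in>E. is_term \<Sigma> s \<and> is_term \<Sigma> t) \<and>
        V = full_subcategory (Alg \<Sigma>) {A. \<forall>(s, t)\<in>E. satisfies A s t})"


section \<open>Tensors and copowers\<close>

text \<open>
  \<open>tensor C P G T \<phi>\<close>: the object \<open>T\<close> is a tensor of \<open>G\<close> with the poset \<open>P\<close>, where
  \<open>\<phi> X\<close> is the isomorphism of posets from \<open>Pos(P, C(G, X))\<close> to \<open>C(T, X)\<close>, natural in \<open>X\<close>.
\<close>

definition tensor ::
    "('o, 'a) poscat \<Rightarrow> 'p rel \<Rightarrow> 'o \<Rightarrow> 'o \<Rightarrow> ('o \<Rightarrow> ('p \<Rightarrow> 'a) \<Rightarrow> 'a) \<Rightarrow> bool" where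
  "tensor C P G T \<phi> \<longleftrightarrow> T \<in> Obj C \<and>
     (\<forall>X\<in>Obj C. bij_betw (\<phi> X) (mono_maps P (hom_poset C G X)) (hom C T X) \<and>
        (\<forall>f\<in>mono_maps P (hom_poset C G X). \<forall>g\<in>mono_maps P (hom_poset C G X).
           pointwise_le P (hom_poset C G X) f g \<longleftrightarrow> (\<phi> X f, \<phi> X g) \<in> hom_poset C T X)) \<and>
     (\<forall>X Y h. h \<in> hom C X Y \<longrightarrow> (\<forall>f\<in>mono_maps P (hom_poset C G X).
        \<phi> Y (\<lambda>p\<in>Field P. h \<cdot>\<^bsub>C\<^esub> f p) = h \<cdot>\<^bsub>C\<^esub> \<phi> X f))"

definition canonical :: "('o, 'a) poscat \<Rightarrow> 'o \<Rightarrow> 'o \<Rightarrow> ('o \<Rightarrow> ('a \<Rightarrow> 'a) \<Rightarrow> 'a) \<Rightarrow> 'a" where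
  "canonical C G X \<phi> = \<phi> X (\<lambda>f\<in>hom C G X. f)"

abbreviation copower ::
    "('o, 'a) poscat \<Rightarrow> 'm set \<Rightarrow> 'o \<Rightarrow> 'o \<Rightarrow> ('o \<Rightarrow> ('m \<Rightarrow> 'a) \<Rightarrow> 'a) \<Rightarrow> bool" where
  "copower C M G T \<phi> \<equiv> tensor C (Id_on M) G T \<phi>"

text \<open>The coproduct injections \<open>G \<rightarrow> M.G\<close>, i.e. the family that corresponds to the identity.\<close>

definition injections ::
    "('o, 'a) poscat \<Rightarrow> 'm set \<Rightarrow> 'o \<Rightarrow> 'o \<Rightarrow> ('o \<Rightarrow> ('m \<Rightarrow> 'a) \<Rightarrow> 'a) \<Rightarrow> 'm \<Rightarrow> 'a" where
  "injections C M G T \<phi> =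
     the_inv_into (mono_maps (Id_on M) (hom_poset C G T)) (\<phi> T) (Idt C T)"

text \<open>
  The morphism \<open>M'.G \<rightarrow> M.G\<close> induced by an inclusion \<open>M' \<subseteq> M\<close>, for copowers
  \<open>(T', \<phi>')\<close> of \<open>M'\<close> and \<open>(T, \<phi>)\<close> of \<open>M\<close>.
\<close>

definition copower_inclusion ::
    "('o, 'a) poscat \<Rightarrow> 'o \<Rightarrow> 'm set \<Rightarrow> ('o \<Rightarrow> ('m \<Rightarrow> 'a) \<Rightarrow> 'a)
      \<Rightarrow> 'm set \<Rightarrow> 'o \<Rightarrow> ('o \<Rightarrow> ('m \<Rightarrow> 'a) \<Rightarrow> 'a) \<Rightarrow> 'a" where
  "copower_inclusion C G M' \<phi>' M T \<phi> = \<phi>' T (restrict (injections C M G T \<phi>) M')"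


section \<open>Subregular generators, abstract finiteness, subeffective projectives\<close>

text \<open>
  The posets with which tensors are formed are represented on subsets of \<open>'u\<close>, and additionally
  the hom-posets \<open>C(G, X)\<close> on the arrow type; tensors are unique up to isomorphism, so the choice
  of the tensor in the second clause does not matter.
\<close>

definition subregular_generator :: "'u itself \<Rightarrow> ('o, 'a) poscat \<Rightarrow> 'o \<Rightarrow> bool" where
  "subregular_generator U C G \<longleftrightarrow> G \<in> Obj C \<and>
     (\<forall>P :: 'u rel. Partial_order P \<and> small U (Field P) \<longrightarrow> (\<exists>T \<phi>. tensor C P G T \<phi>)) \<and>
     (\<forall>X\<in>Obj C. \<exists>T \<phi>. tensor C (hom_poset C G X) G T \<phi> \<and> subregular_epi C (canonical C G X \<phi>))"

definition abstractly_finite :: "'u itself \<Rightarrow> ('o, 'a) poscat \<Rightarrow> 'o \<Rightarrow> bool" where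
  "abstractly_finite U C G \<longleftrightarrow> G \<in> Obj C \<and>
     (\<forall>M :: 'u set. small U M \<longrightarrow>
        (\<exists>T \<phi>. copower C M G T \<phi>) \<and>
        (\<forall>T \<phi> f. copower C M G T \<phi> \<and> f \<in> hom C G T \<longrightarrow>
           (\<exists>M' T' \<phi>'. finite M' \<and> M' \<subseteq> M \<and> copower C M' G T' \<phi>' \<and>
              (\<exists>g\<in>hom C G T'. f = copower_inclusion C G M' \<phi>' M T \<phi> \<cdot>\<^bsub>C\<^esub> g))))"

definition hom_functor_map ::
    "('o, 'a) poscat \<Rightarrow> 'o \<Rightarrow> 'a \<Rightarrow> 'a rel \<times> 'a rel \<times> ('a \<Rightarrow> 'a)" where
  "hom_functor_map C G h =
     (hom_poset C G (Dom C h), hom_poset C G (Cod C h), \<lambda>f\<in>hom C G (Dom C h). h \<cdot>\<^bsub>C\<^esub> f)"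

text \<open>
  The first conjunct says that the hom-functor of \<open>G\<close> takes values in the category of small
  posets.  It holds automatically if all hom-sets of \<open>C\<close> are small; but homs between small
  algebras need not be small unless the cardinality of \<open>'u\<close> is a strong limit, so local
  smallness is required only at \<open>G\<close>, where it is used, and not of \<open>C\<close> as a whole.
\<close>

definition subeffective_projective :: "'u itself \<Rightarrow> ('o, 'a) poscat \<Rightarrow> 'o \<Rightarrow> bool" where
  "subeffective_projective U C G \<longleftrightarrow> G \<in> Obj C \<and>
     pos_functor C (Pos U) (hom_poset C G) (hom_functor_map C G) \<and>
     preserves_reflexive_coinserters C (Pos U) (hom_functor_map C G)"

end

theory Submission
  imports Defs
begin

text \<open>
  Let \<open>G\<close> be an abstractly finite subeffective projective that is a subregular generator of \<open>K\<close>.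
  The idea is to read the poset \<open>K(G, X)\<close> as the underlying poset of an algebra.  An \<open>n\<close>-ary
  operation symbol is a morphism \<open>\<sigma> : G \<rightarrow> n.G\<close>, and it acts on \<open>x\<^sub>1, \<dots>, x\<^sub>n : G \<rightarrow> X\<close> by
  \<open>[x\<^sub>1, \<dots>, x\<^sub>n] \<cdot> \<sigma>\<close>.  The inequations are all those that hold in these algebras.  Three facts show
  that \<open>X \<mapsto> K(G, X)\<close> is an equivalence onto the resulting variety.

  It reflects the order, because the canonical morphism \<open>K(G, X) \<otimes> G \<rightarrow> X\<close> is a subregular
  epimorphism, so that morphisms out of \<open>X\<close> are compared on the points \<open>G \<rightarrow> X\<close>
  (\<open>hom_le_if_points_le\<close>).

  It is full, because every point of a tensor \<open>P \<otimes> G\<close> is an operation applied to finitely many of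
  the universal points \<open>\<eta> p\<close> (\<open>tensor_generated\<close>): abstract finiteness says this for copowers, and
  \<open>P \<otimes> G\<close> is the coinserter of a reflexive pair \<open>N.G \<rightrightarrows> |P|.G\<close>, where \<open>N\<close> is the set of
  related pairs of \<open>P\<close>, so that projectivity makes \<open>|P|.G \<rightarrow> P \<otimes> G\<close> surjective on points.  Hence the
  morphism \<open>K(G, X) \<otimes> G \<rightarrow> Y\<close> that is induced by a homomorphism \<open>K(G, X) \<rightarrow> K(G, Y)\<close> puts in order
  all points that the canonical morphism puts in order, and factors through \<open>X\<close> (\<open>full\<close>).

  It is essentially surjective, because a model \<open>A\<close> is a quotient of the algebra of points of \<open>|A|.G\<close>
  by the evaluation of terms.  The pairs \<open>(s, t)\<close> of points for which \<open>s\<close> evaluates below \<open>t\<close> are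
  the components of a reflexive pair \<open>N.G \<rightrightarrows> |A|.G\<close>; its coinserter exists, and by projectivity its
  points form the algebra \<open>A\<close> (\<open>essentially_surjective\<close>).

  Conversely, in a variety let \<open>G\<close> be the free algebra on one generator, so that the points
  \<open>G \<rightarrow> X\<close> are the elements of \<open>X\<close>.  The tensor \<open>P \<otimes> G\<close> is the free algebra on the poset \<open>P\<close>; its
  elements are values of terms, and each term contains finitely many variables, which gives abstract
  finiteness.  A surjective homomorphism \<open>c\<close> is the coinserter of the projections of the algebra of
  all \<open>(s, t)\<close> with \<open>c s \<le> c t\<close> (\<open>surjective_subregular_epi\<close>).  The preorder on \<open>X\<close> generated
  by its order and a reflexive pair is compatible with the operations, so that the quotient of \<open>X\<close> by
  it is the coinserter both of algebras and of posets (\<open>reflexive_coinserter_underlying\<close>).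

  Two devices carry these arguments.  Algebras are built as preordered algebras on whatever type is
  convenient (terms, pairs, morphisms) and then replaced by their quotient in the universe
  (\<open>preordered_algebra_quotient\<close>).  And an equivalence of \<open>K\<close> with a variety is unfolded into an
  assignment of algebras to objects and of homomorphisms to morphisms (the locale \<open>represented\<close>),
  where the carriers may again live in any type.
\<close>

section \<open>Small sets\<close>

lemma small_subset: "small U B \<Longrightarrow> A \<subseteq> B \<Longrightarrow> small U A"
  unfolding small_def by (rule ordLeq_ordLess_trans[OF card_of_mono1])

lemma small_image: "small U A \<Longrightarrow> small U (f ` A)"
  unfolding small_def by (rule ordLeq_ordLess_trans[OF card_of_image])

lemma small_bij:
  assumes "small U B" "inj_on f A" "f ` A \<subseteq> B"
  shows "small U A"
proof -
  have "|A| \<le>o |B|"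
    using assms(2,3) unfolding card_of_ordLeq[symmetric] by blast
  then show ?thesis
    using assms(1) unfolding small_def by (rule ordLeq_ordLess_trans)
qed

lemma small_inj:
  assumes "small (U :: 'u itself) A"
  obtains j :: "'x \<Rightarrow> 'u" where "inj_on j A"
proof -
  have "|A| \<le>o |UNIV :: 'u set|"
    using assms unfolding small_def by (rule ordLess_imp_ordLeq)
  then show ?thesis
    using that unfolding card_of_ordLeq[symmetric] by blast
qed

lemma universe_infinite: "universe (U :: 'u itself) \<Longrightarrow> infinite (UNIV :: 'u set)"
  unfolding universe_def using countable_finite by blast

lemma small_countable:
  assumes "universe (U :: 'u itself)" "countable (A :: 'x set)"
  shows "small U A"
proof -
  have "\<not> |UNIV :: 'u set| \<le>o |A|"
  proof
    assume "|UNIV :: 'u set| \<le>o |A|"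
    then obtain f :: "'u \<Rightarrow> 'x" where "inj f" "range f \<subseteq> A"
      unfolding card_of_ordLeq[symmetric] by blast
    then have "countable (UNIV :: 'u set)"
      using countable_image_inj_on[OF countable_subset[OF _ assms(2)]] by blast
    then show False using assms(1) unfolding universe_def by blast
  qed
  then show ?thesis
    unfolding small_def using not_ordLeq_iff_ordLess[OF card_of_Well_order card_of_Well_order]
      by blast
qed

lemma small_UNION:
  assumes "universe (U :: 'u itself)" "small U I" "\<And>i. i \<in> I \<Longrightarrow> small U (A i)"
  shows "small U (\<Union>i\<in>I. A i)"
proof -
  have "Cinfinite |UNIV :: 'u set|"
    using universe_infinite[OF assms(1)] card_of_Card_order
    unfolding cinfinite_def Field_card_of by blast
  moreover have "regularCard |UNIV :: 'u set|"
    using assms(1) unfolding universe_def by blast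
  ultimately show ?thesis
    using card_of_UNION_ordLess_infinite_Field_regularCard[of "|UNIV :: 'u set|" I A] assms(2,3)
    unfolding small_def by blast
qed

lemma small_Times:
  assumes "universe U" "small U A" "small U B"
  shows "small U (A \<times> B)"
proof -
  have "A \<times> B = (\<Union>a\<in>A. Pair a ` B)" by auto
  then show ?thesis
    using small_UNION[OF assms(1,2) small_image[OF assms(3)], of "\<lambda>a. Pair a"] by simp
qed

lemma small_Un:
  assumes "universe U" "small U A" "small U B"
  shows "small U (A \<union> B)"
proof -
  have "A \<union> B = (\<Union>b\<in>UNIV. if b then A else B)" by (auto split: if_splits)
  then show ?thesis
    using small_UNION[OF assms(1) small_countable[OF assms(1)], of UNIV "\<lambda>b. if b then A else B"]
      assms(2,3) by simp
qed

lemma small_lists: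
  assumes "universe U" "small U A"
  shows "small U (lists A)"
proof -
  have n: "small U {xs \<in> lists A. length xs = n}" for n
  proof (induction n)
    case 0
    have "{xs \<in> lists A. length xs = 0} = {[]}" by auto
    then show ?case using small_countable[OF assms(1), of "{[]}"] by (simp del: lists_eq_set)
  next
    case (Suc n)
    have "{xs \<in> lists A. length xs = Suc n} \<subseteq>
        (\<lambda>(x, xs). x # xs) ` (A \<times> {xs \<in> lists A. length xs = n})"
    proof
      fix xs assume "xs \<in> {xs \<in> lists A. length xs = Suc n}"
      then show "xs \<in> (\<lambda>(x, xs). x # xs) ` (A \<times> {xs \<in> lists A. length xs = n})"
        by (cases xs) (auto simp: image_iff)
    qed
    then show ?case
      by (rule small_subset[OF small_image[OF small_Times[OF assms(1,2) Suc]]])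
  qed
  have "lists A = (\<Union>n. {xs \<in> lists A. length xs = n})" by auto
  then show ?thesis
    using small_UNION[OF assms(1) small_countable[OF assms(1)],
        of UNIV "\<lambda>n. {xs \<in> lists A. length xs = n}"] n by simp
qed

section \<open>Preordered algebras and their quotients\<close>

definition mono_rel :: "'p rel \<Rightarrow> 'q rel \<Rightarrow> ('p \<Rightarrow> 'q) \<Rightarrow> bool" where
  "mono_rel P Q f \<longleftrightarrow> (\<forall>x y. (x, y) \<in> P \<longrightarrow> (f x, f y) \<in> Q)"

lemma preorder_refl: "Preorder R \<Longrightarrow> x \<in> Field R \<Longrightarrow> (x, x) \<in> R"
  unfolding preorder_on_def refl_on_def by blast

lemma preorder_trans: "Preorder R \<Longrightarrow> (x, y) \<in> R \<Longrightarrow> (y, z) \<in> R \<Longrightarrow> (x, z) \<in> R"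
  unfolding preorder_on_def by (meson transD)

lemma Preorder_iff: "Preorder R \<longleftrightarrow> (\<forall>x\<in>Field R. (x, x) \<in> R) \<and> trans R"
  unfolding preorder_on_def refl_on_def by (auto intro: FieldI1 FieldI2)

lemma Field_Id_on [simp]: "Field (Id_on M) = M"
  unfolding Field_def by auto

lemma Preorder_Id_on: "Preorder (Id_on M)"
  unfolding preorder_on_def refl_on_def trans_def by auto

lemma list_all2_Field:
  "list_all2 (\<lambda>x y. (x, y) \<in> R) xs ys \<Longrightarrow> set xs \<subseteq> Field R \<and> set ys \<subseteq> Field R"
  by (induction rule: list_all2_induct) (auto intro: FieldI1 FieldI2)

lemma mono_rel_Field: "mono_rel P Q f \<Longrightarrow> x \<in> Field P \<Longrightarrow> f x \<in> Field Q"
  unfolding mono_rel_def Field_def by auto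

lemma mono_maps_iff:
  shows "f \<in> mono_maps P Q \<longleftrightarrow> f \<in> extensional (Field P) \<and> mono_rel P Q f"
  using mono_rel_Field[of P Q f] unfolding mono_maps_def PiE_def mono_rel_def[symmetric] by auto

text \<open>
  Choosing one element from each equivalence class keeps the quotient inside the original type,
  and the injection \<open>j\<close> then moves it to any other type that is large enough.
\<close>

lemma poset_quotient:
  fixes j :: "'x \<Rightarrow> 'y"
  assumes R: "Preorder R" and j: "inj_on j (Field R)"
  obtains q :: "'x \<Rightarrow> 'y" and Q where "Partial_order Q" "Field Q = q ` Field R"
    "\<forall>x\<in>Field R. \<forall>y\<in>Field R. (q x, q y) \<in> Q \<longleftrightarrow> (x, y) \<in> R"
proof -
  define rep where "rep x = (SOME y. (x, y) \<in> R \<and> (y, x) \<in> R)" for x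
  define q where "q = j \<circ> rep"
  define Q where "Q = {(q x, q y) | x y. (x, y) \<in> R}"
  have rep: "(x, rep x) \<in> R" "(rep x, x) \<in> R" if "x \<in> Field R" for x
    using someI[of "\<lambda>y. (x, y) \<in> R \<and> (y, x) \<in> R" x] preorder_refl[OF R that]
    unfolding rep_def by auto
  have eq: "(x, y) \<in> R \<and> (y, x) \<in> R" if "x \<in> Field R" "y \<in> Field R" "q x = q y" for x y
  proof -
    have "rep x = rep y"
      using that rep[OF that(1)] rep[OF that(2)] j
      unfolding q_def inj_on_def by (metis FieldI1 comp_apply)
    then show ?thesis
      using rep[OF that(1)] rep[OF that(2)] preorder_trans[OF R] by metis
  qed
  have le: "(q x, q y) \<in> Q \<longleftrightarrow> (x, y) \<in> R" if "x \<in> Field R" "y \<in> Field R" for x y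
  proof
    assume "(q x, q y) \<in> Q"
    then obtain x' y' where "q x = q x'" "q y = q y'" "(x', y') \<in> R"
      unfolding Q_def by blast
    then show "(x, y) \<in> R"
      using eq that preorder_trans[OF R] by (metis FieldI1 FieldI2)
  qed (auto simp: Q_def)
  have eq': "q x = q y" if "(x, y) \<in> R" "(y, x) \<in> R" for x y
  proof -
    have "(x, z) \<in> R \<and> (z, x) \<in> R \<longleftrightarrow> (y, z) \<in> R \<and> (z, y) \<in> R" for z
      using that preorder_trans[OF R] by blast
    then show ?thesis unfolding q_def rep_def by simp
  qed
  have F: "Field Q = q ` Field R"
    unfolding Q_def Field_def Domain_iff Range_iff by blast
  have "Partial_order Q"
    unfolding partial_order_on_def Preorder_iff
  proof (intro conjI)
    show "\<forall>x\<in>Field Q. (x, x) \<in> Q" using F le preorder_refl[OF R] by auto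
    show "trans Q"
    proof (rule transI)
      fix a b c assume "(a, b) \<in> Q" "(b, c) \<in> Q"
      moreover then obtain x y z where "a = q x" "b = q y" "c = q z"
        "x \<in> Field R" "y \<in> Field R" "z \<in> Field R"
        unfolding Q_def by (auto intro: FieldI1 FieldI2)
      ultimately show "(a, c) \<in> Q" using le preorder_trans[OF R] by metis
    qed
    show "antisym Q"
    proof (rule antisymI)
      fix a b assume "(a, b) \<in> Q" "(b, a) \<in> Q"
      moreover then obtain x y where "a = q x" "b = q y" "x \<in> Field R" "y \<in> Field R"
        unfolding Q_def by (auto intro: FieldI1 FieldI2)
      ultimately show "a = b" using le eq' by metis
    qed
  qed
  moreover have "\<forall>x\<in>Field R. \<forall>y\<in>Field R. (q x, q y) \<in> Q \<longleftrightarrow> (x, y) \<in> R"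
    by (intro ballI le)
  ultimately show ?thesis using F by (intro that)
qed

text \<open>
  Antisymmetry is dropped from the ordered algebras so that the constructions below need not
  choose representatives; the quotient that restores it is taken once, in
  \<open>preordered_algebra_quotient\<close>.
\<close>

definition preordered_algebra :: "'s signature \<Rightarrow> ('s, 'x) oalg \<Rightarrow> bool" where
  "preordered_algebra \<Sigma> A \<longleftrightarrow> Preorder (ord A) \<and>
     (\<forall>n. \<forall>\<sigma>\<in>\<Sigma> n. \<forall>xs\<in>lists (carr A). length xs = n \<longrightarrow> opn A n \<sigma> xs \<in> carr A) \<and>
     (\<forall>n. \<forall>\<sigma>\<in>\<Sigma> n. \<forall>xs ys. length xs = n \<and> list_all2 (\<lambda>x y. (x, y) \<in> ord A) xs ys \<longrightarrow>
        (opn A n \<sigma> xs, opn A n \<sigma> ys) \<in> ord A)"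

lemma ordered_algebra_iff:
  "ordered_algebra \<Sigma> A \<longleftrightarrow> preordered_algebra \<Sigma> A \<and> antisym (ord A)"
  unfolding ordered_algebra_def preordered_algebra_def partial_order_on_def by blast

lemma ordered_is_preordered: "ordered_algebra \<Sigma> A \<Longrightarrow> preordered_algebra \<Sigma> A"
  by (simp add: ordered_algebra_iff)

lemma alg_preorder: "preordered_algebra \<Sigma> A \<Longrightarrow> Preorder (ord A)"
  unfolding preordered_algebra_def by blast

lemma opn_closed:
  "preordered_algebra \<Sigma> A \<Longrightarrow> \<sigma> \<in> \<Sigma> (length xs) \<Longrightarrow> set xs \<subseteq> carr A \<Longrightarrow>
    opn A (length xs) \<sigma> xs \<in> carr A"
  unfolding preordered_algebra_def by (auto simp: lists_eq_set)

lemma opn_mono: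
  "preordered_algebra \<Sigma> A \<Longrightarrow> \<sigma> \<in> \<Sigma> (length xs) \<Longrightarrow>
    list_all2 (\<lambda>x y. (x, y) \<in> ord A) xs ys \<Longrightarrow>
    (opn A (length xs) \<sigma> xs, opn A (length xs) \<sigma> ys) \<in> ord A"
  unfolding preordered_algebra_def by auto

text \<open>
  Unlike in \<open>alg_homs\<close>, the carriers may have different types, and the map need not be
  extensional, so that homomorphisms compose as plain functions.
\<close>

definition oalg_hom :: "'s signature \<Rightarrow> ('s, 'x) oalg \<Rightarrow> ('s, 'y) oalg \<Rightarrow> ('x \<Rightarrow> 'y) \<Rightarrow> bool" where
  "oalg_hom \<Sigma> A B f \<longleftrightarrow> mono_rel (ord A) (ord B) f \<and>
     (\<forall>\<sigma> xs. \<sigma> \<in> \<Sigma> (length xs) \<and> set xs \<subseteq> carr A \<longrightarrow>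
        f (opn A (length xs) \<sigma> xs) = opn B (length xs) \<sigma> (map f xs))"

lemma oalg_hom_mono: "oalg_hom \<Sigma> A B f \<Longrightarrow> (x, y) \<in> ord A \<Longrightarrow> (f x, f y) \<in> ord B"
  unfolding oalg_hom_def mono_rel_def by blast

lemma oalg_hom_carr: "oalg_hom \<Sigma> A B f \<Longrightarrow> x \<in> carr A \<Longrightarrow> f x \<in> carr B"
  unfolding oalg_hom_def using mono_rel_Field by metis

lemma oalg_hom_opn:
  "oalg_hom \<Sigma> A B f \<Longrightarrow> \<sigma> \<in> \<Sigma> (length xs) \<Longrightarrow> set xs \<subseteq> carr A \<Longrightarrow>
    f (opn A (length xs) \<sigma> xs) = opn B (length xs) \<sigma> (map f xs)"
  unfolding oalg_hom_def by blast

lemma alg_homs_iff: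
  assumes "Preorder (ord A)"
  shows "f \<in> alg_homs \<Sigma> A B \<longleftrightarrow> f \<in> extensional (carr A) \<and> oalg_hom \<Sigma> A B f"
  unfolding alg_homs_def oalg_hom_def mem_Collect_eq mono_maps_iff
  by (auto simp: lists_eq_set)

lemma oalg_hom_comp:
  assumes "oalg_hom \<Sigma> A B f" "oalg_hom \<Sigma> B C g"
  shows "oalg_hom \<Sigma> A C (g \<circ> f)"
proof -
  have "g (f (opn A (length xs) \<sigma> xs)) = opn C (length xs) \<sigma> (map (g \<circ> f) xs)"
    if "\<sigma> \<in> \<Sigma> (length xs)" "set xs \<subseteq> carr A" for \<sigma> xs
    using that oalg_hom_opn[OF assms(1) that] oalg_hom_opn[OF assms(2), of \<sigma> "map f xs"]
      oalg_hom_carr[OF assms(1)] by force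
  then show ?thesis
    using assms unfolding oalg_hom_def mono_rel_def by auto
qed

lemma oalg_hom_cong:
  assumes A: "preordered_algebra \<Sigma> A" and "\<And>x. x \<in> carr A \<Longrightarrow> f x = g x"
    and f: "oalg_hom \<Sigma> A B f"
  shows "oalg_hom \<Sigma> A B g"
  unfolding oalg_hom_def
proof (intro conjI allI impI)
  show "mono_rel (ord A) (ord B) g"
    using assms(2) f unfolding oalg_hom_def mono_rel_def by (metis FieldI1 FieldI2)
  fix \<sigma> xs assume *: "\<sigma> \<in> \<Sigma> (length xs) \<and> set xs \<subseteq> carr A"
  then have "map g xs = map f xs" using assms(2) by auto
  then show "g (opn A (length xs) \<sigma> xs) = opn B (length xs) \<sigma> (map g xs)"
    using oalg_hom_opn[OF f] opn_closed[OF A] assms(2) * by metis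
qed

lemma oalg_hom_id: "oalg_hom \<Sigma> A A (\<lambda>x. x)"
  unfolding oalg_hom_def mono_rel_def by auto

text \<open>
  Monotonicity of the factor on \<open>Q\<close> makes it well defined, since \<open>B\<close> is antisymmetric; it
  preserves the operations because \<open>q\<close> does and is onto.
\<close>

lemma oalg_hom_factor:
  assumes A: "preordered_algebra \<Sigma> A" and q: "oalg_hom \<Sigma> A Q q" and f: "oalg_hom \<Sigma> A B f"
    and Q: "carr Q = q ` carr A" and B: "antisym (ord B)"
    and le: "\<And>x y. x \<in> carr A \<Longrightarrow> y \<in> carr A \<Longrightarrow> (q x, q y) \<in> ord Q \<Longrightarrow> (f x, f y) \<in> ord B"
    and Q': "Preorder (ord Q)"
  obtains g where "oalg_hom \<Sigma> Q B g" "\<forall>x\<in>carr A. g (q x) = f x"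
proof -
  define r where "r = inv_into (carr A) q"
  have r: "r y \<in> carr A" "q (r y) = y" if "y \<in> carr Q" for y
    using that unfolding r_def Q by (auto simp: inv_into_into f_inv_into_f)
  have gq: "f (r (q x)) = f x" if "x \<in> carr A" for x
  proof -
    have "q x \<in> carr Q" using that Q by blast
    then show ?thesis
      using le[OF _ that] le[OF that] r preorder_refl[OF Q'] B that by (metis antisymD)
  qed
  have "oalg_hom \<Sigma> Q B (f \<circ> r)"
    unfolding oalg_hom_def
  proof (intro conjI allI impI)
    show "mono_rel (ord Q) (ord B) (f \<circ> r)"
      using le r unfolding mono_rel_def by (metis FieldI1 FieldI2 comp_apply)
    fix \<sigma> ys assume *: "\<sigma> \<in> \<Sigma> (length ys) \<and> set ys \<subseteq> carr Q"
    define xs where "xs = map r ys"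
    have xs: "set xs \<subseteq> carr A" "map q xs = ys" "length xs = length ys"
      unfolding xs_def using * r by (auto simp: map_idI subset_iff)
    have "(f \<circ> r) (opn Q (length ys) \<sigma> ys) = f (r (q (opn A (length ys) \<sigma> xs)))"
      using oalg_hom_opn[OF q, of \<sigma> xs] xs * by simp
    also have "\<dots> = f (opn A (length ys) \<sigma> xs)"
      using gq opn_closed[OF A, of \<sigma> xs] xs * by simp
    also have "\<dots> = opn B (length ys) \<sigma> (map (f \<circ> r) ys)"
      using oalg_hom_opn[OF f, of \<sigma> xs] xs * unfolding xs_def by simp
    finally show "(f \<circ> r) (opn Q (length ys) \<sigma> ys) = opn B (length ys) \<sigma> (map (f \<circ> r) ys)" .
  qed
  then show ?thesis using gq by (intro that[of "f \<circ> r"]) auto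
qed

text \<open>
  The equivalence that is induced by the preorder is a congruence, because the operations are
  monotone in both directions. The quotient is a set of representatives, hence small, and is
  placed in the universe by an injection.
\<close>

lemma preordered_algebra_quotient:
  fixes A :: "('s, 'x) oalg" and U :: "'u itself"
  assumes A: "preordered_algebra \<Sigma> A" and "small U (carr A)"
  obtains B :: "('s, 'u) oalg" and q where "ordered_algebra \<Sigma> B" "small U (carr B)"
    "carr B = q ` carr A" "oalg_hom \<Sigma> A B q"
    "\<forall>x\<in>carr A. \<forall>y\<in>carr A. (q x, q y) \<in> ord B \<longleftrightarrow> (x, y) \<in> ord A"
proof -
  obtain j :: "'x \<Rightarrow> 'u" where j: "inj_on j (carr A)" using small_inj assms(2) by blast
  obtain q :: "'x \<Rightarrow> 'u" and Q where Q: "Partial_order Q" "Field Q = q ` carr A"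
    and "\<forall>x\<in>carr A. \<forall>y\<in>carr A. (q x, q y) \<in> Q \<longleftrightarrow> (x, y) \<in> ord A"
    by (rule poset_quotient[OF alg_preorder[OF A] j]) (rule that)
  then have le: "x \<in> carr A \<Longrightarrow> y \<in> carr A \<Longrightarrow> (q x, q y) \<in> Q \<longleftrightarrow> (x, y) \<in> ord A" for x y
    by blast
  define r where "r = inv_into (carr A) q"
  have r: "r y \<in> carr A" "q (r y) = y" if "y \<in> Field Q" for y
    using that unfolding r_def Q by (auto simp: inv_into_into f_inv_into_f)
  define B :: "('s, 'u) oalg" where
    "B = \<lparr>ord = Q, opn = \<lambda>n \<sigma> ys. q (opn A n \<sigma> (map r ys))\<rparr>"
  have [simp]: "ord B = Q" "opn B n \<sigma> ys = q (opn A n \<sigma> (map r ys))" for n \<sigma> ys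
    by (auto simp: B_def)
  have mono: "(q (opn A (length xs) \<sigma> xs), q (opn A (length xs) \<sigma> ys)) \<in> Q"
    if "\<sigma> \<in> \<Sigma> (length xs)" "list_all2 (\<lambda>x y. (x, y) \<in> ord A) xs ys" for \<sigma> xs ys
    using opn_mono[OF A that] le by (meson FieldI1 FieldI2)
  have "ordered_algebra \<Sigma> B"
    unfolding ordered_algebra_def
  proof (intro conjI allI ballI impI)
    show "Partial_order (ord B)" using Q by simp
    fix n \<sigma> assume s: "\<sigma> \<in> \<Sigma> n"
    { fix ys assume "ys \<in> lists (carr B)" "length ys = n"
      then show "opn B n \<sigma> ys \<in> carr B"
        using opn_closed[OF A, of \<sigma> "map r ys"] r(1) s Q(2) by (auto simp: lists_eq_set) }
    fix ys zs assume *: "length ys = n \<and> list_all2 (\<lambda>x y. (x, y) \<in> ord B) ys zs"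
    have "list_all2 (\<lambda>x y. (x, y) \<in> ord A) (map r ys) (map r zs)"
      unfolding list.rel_map
    proof (rule list_all2_mono)
      show "list_all2 (\<lambda>x y. (x, y) \<in> Q) ys zs" using * by simp
      show "(r x, r y) \<in> ord A" if "(x, y) \<in> Q" for x y
        using that le r FieldI1 FieldI2 by metis
    qed
    from mono[OF _ this, of \<sigma>] show "(opn B n \<sigma> ys, opn B n \<sigma> zs) \<in> ord B"
      using * s by simp
  qed
  moreover have "oalg_hom \<Sigma> A B q"
    unfolding oalg_hom_def
  proof (intro conjI allI impI)
    show "mono_rel (ord A) (ord B) q"
      using le unfolding mono_rel_def by (simp add: FieldI1 FieldI2)
    fix \<sigma> xs assume *: "\<sigma> \<in> \<Sigma> (length xs) \<and> set xs \<subseteq> carr A"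
    have 1: "(x, r (q x)) \<in> ord A" "(r (q x), x) \<in> ord A" if "x \<in> carr A" for x
    proof -
      have "q x \<in> Field Q" using that Q by blast
      then have "r (q x) \<in> carr A" "(q x, q (r (q x))) \<in> Q" "(q (r (q x)), q x) \<in> Q"
        using r[of "q x"] Q(1) unfolding partial_order_on_def by (auto intro: preorder_refl)
      then show "(x, r (q x)) \<in> ord A" "(r (q x), x) \<in> ord A"
        using le that by blast+
    qed
    have "list_all2 (\<lambda>x y. (x, y) \<in> ord A) xs (map (r \<circ> q) xs)"
      "list_all2 (\<lambda>x y. (x, y) \<in> ord A) (map (r \<circ> q) xs) xs"
      using * 1 by (auto simp: list_all2_conv_all_nth subset_iff)
    then have "(q (opn A (length xs) \<sigma> xs), q (opn A (length xs) \<sigma> (map (r \<circ> q) xs))) \<in> Q"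
      "(q (opn A (length xs) \<sigma> (map (r \<circ> q) xs)), q (opn A (length xs) \<sigma> xs)) \<in> Q"
      using mono[of \<sigma> xs] mono[of \<sigma> "map (r \<circ> q) xs"] * by auto
    then show "q (opn A (length xs) \<sigma> xs) = opn B (length xs) \<sigma> (map q xs)"
      using Q(1) unfolding partial_order_on_def antisym_def by simp
  qed
  moreover have "\<forall>x\<in>carr A. \<forall>y\<in>carr A. (q x, q y) \<in> ord B \<longleftrightarrow> (x, y) \<in> ord A"
    by (simp add: le)
  moreover have "small U (carr B)" "carr B = q ` carr A"
    using Q(2) small_image[OF assms(2), of q] by simp_all
  ultimately show ?thesis by (intro that)
qed

text \<open>
  Compatibility of a preorder with an operation may be checked in one coordinate at a time:
  changing the coordinates from left to right gives a chain of related values.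
\<close>

lemma opn_mono_if_coordinatewise:
  assumes "\<And>ps x y zs. Suc (length ps + length zs) = n \<Longrightarrow>
      set ps \<union> set zs \<subseteq> Field R \<Longrightarrow> (x, y) \<in> R \<Longrightarrow> (f (ps @ x # zs), f (ps @ y # zs)) \<in> R"
    and R: "Preorder R" and cl: "\<And>xs. length xs = n \<Longrightarrow> set xs \<subseteq> Field R \<Longrightarrow> f xs \<in> Field R"
    and "list_all2 (\<lambda>x y. (x, y) \<in> R) xs ys" "length xs = n"
  shows "(f xs, f ys) \<in> R"
proof -
  have "set ps \<subseteq> Field R \<Longrightarrow> length ps + length xs = n \<Longrightarrow> (f (ps @ xs), f (ps @ ys)) \<in> R" for ps
    using assms(4)
  proof (induction arbitrary: ps rule: list_all2_induct)
    case Nil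
    then show ?case using cl preorder_refl[OF R] by simp
  next
    case (Cons x xs y ys)
    have "set xs \<subseteq> Field R"
      using Cons(2) unfolding list_all2_conv_all_nth set_conv_nth by (auto intro: FieldI1)
    then have "(f (ps @ x # xs), f (ps @ y # xs)) \<in> R"
      using assms(1)[of ps xs x y] Cons by simp
    moreover have "(f ((ps @ [y]) @ xs), f ((ps @ [y]) @ ys)) \<in> R"
      using Cons by (intro Cons.IH) (auto intro: FieldI2)
    ultimately show ?case using preorder_trans[OF R] by fastforce
  qed
  from this[of "[]"] show ?thesis using assms(5) by simp
qed

section \<open>Terms over an arbitrary set of variables\<close>

text \<open>
  A free algebra may have uncountably many generators, so its terms need more variables than the
  countably many that inequations use.
\<close>

datatype ('s, vars: 'v) tm = TVar 'v | TOp 's "('s, 'v) tm list"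

fun wf_tm :: "'s signature \<Rightarrow> ('s, 'v) tm \<Rightarrow> bool" where
  "wf_tm \<Sigma> (TVar x) \<longleftrightarrow> True"
| "wf_tm \<Sigma> (TOp \<sigma> ts) \<longleftrightarrow> \<sigma> \<in> \<Sigma> (length ts) \<and> (\<forall>t\<in>set ts. wf_tm \<Sigma> t)"

fun eval_tm :: "('s, 'x) oalg \<Rightarrow> ('v \<Rightarrow> 'x) \<Rightarrow> ('s, 'v) tm \<Rightarrow> 'x" where
  "eval_tm A v (TVar x) = v x"
| "eval_tm A v (TOp \<sigma> ts) = opn A (length ts) \<sigma> (map (eval_tm A v) ts)"

definition tms :: "'s signature \<Rightarrow> 'v set \<Rightarrow> ('s, 'v) tm set" where
  "tms \<Sigma> M = {t. wf_tm \<Sigma> t \<and> vars t \<subseteq> M}"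

lemma TVar_tms [simp]: "TVar x \<in> tms \<Sigma> M \<longleftrightarrow> x \<in> M"
  unfolding tms_def by simp

lemma TOp_tms [simp]: "TOp \<sigma> ts \<in> tms \<Sigma> M \<longleftrightarrow> \<sigma> \<in> \<Sigma> (length ts) \<and> set ts \<subseteq> tms \<Sigma> M"
  unfolding tms_def by auto

lemma finite_vars: "finite (vars t)"
  by (induction t) auto

lemma eval_tm_cong:
  assumes "t \<in> tms \<Sigma> M" "\<And>x. x \<in> M \<Longrightarrow> v x = w x"
  shows "eval_tm A v t = eval_tm A w t"
  using assms(1)
proof (induction t)
  case (TOp \<sigma> ts)
  then have "map (eval_tm A v) ts = map (eval_tm A w) ts" by auto
  then show ?case by (simp del: map_eq_conv)
qed (simp add: assms(2))

lemma eval_tm_closed: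
  assumes A: "preordered_algebra \<Sigma> A" and t: "t \<in> tms \<Sigma> M" and v: "v ` M \<subseteq> carr A"
  shows "eval_tm A v t \<in> carr A"
  using t
proof (induction t)
  case (TOp \<sigma> ts)
  then have "set (map (eval_tm A v) ts) \<subseteq> carr A" by auto
  then show ?case using opn_closed[OF A, of \<sigma> "map (eval_tm A v) ts"] TOp by simp
qed (use v in auto)

lemma eval_tm_mono:
  assumes A: "preordered_algebra \<Sigma> A" and t: "t \<in> tms \<Sigma> M"
    and vw: "\<And>x. x \<in> M \<Longrightarrow> (v x, w x) \<in> ord A"
  shows "(eval_tm A v t, eval_tm A w t) \<in> ord A"
  using t
proof (induction t)
  case (TOp \<sigma> ts)
  then have "list_all2 (\<lambda>x y. (x, y) \<in> ord A) (map (eval_tm A v) ts) (map (eval_tm A w) ts)"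
    by (auto simp: list_all2_conv_all_nth subset_iff)
  then show ?case using opn_mono[OF A, of \<sigma> "map (eval_tm A v) ts"] TOp by simp
qed (use vw in auto)

lemma hom_eval_tm:
  assumes A: "preordered_algebra \<Sigma> A" and f: "oalg_hom \<Sigma> A B f"
    and t: "t \<in> tms \<Sigma> M" and v: "v ` M \<subseteq> carr A"
  shows "f (eval_tm A v t) = eval_tm B (\<lambda>x. f (v x)) t"
  using t
proof (induction t)
  case (TOp \<sigma> ts)
  then have "set (map (eval_tm A v) ts) \<subseteq> carr A" using eval_tm_closed[OF A _ v] by auto
  moreover have "map (\<lambda>t. f (eval_tm A v t)) ts = map (eval_tm B (\<lambda>x. f (v x))) ts"
    using TOp by auto
  ultimately show ?case
    using oalg_hom_opn[OF f, of \<sigma> "map (eval_tm A v) ts"] TOp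
      by (simp add: comp_def del: map_eq_conv)
qed simp

text \<open>
  The terms of depth at most \<open>n\<close> form a small set by induction on \<open>n\<close>, and there are countably
  many depths, so that the union is small because the universe is uncountable and regular.
\<close>

lemma small_tms:
  assumes U: "universe U" and S: "small_signature U \<Sigma>" and M: "small U M"
  shows "small U (tms \<Sigma> M)"
proof -
  define step where
    "step T = TVar ` M \<union> (\<lambda>(\<sigma>, ts). TOp \<sigma> ts) ` ((\<Union>n. \<Sigma> n) \<times> lists T)" for T
  have "small U (\<Union>n. \<Sigma> n)"
    using S unfolding small_signature_def
    by (intro small_UNION[OF U small_countable[OF U]]) auto
  then have small_step: "small U (step T)" if "small U T" for T
    unfolding step_def
    by (intro small_Un[OF U] small_image M small_Times[OF U] small_lists[OF U that])
  define L where "L n = (step ^^ n) {}" for n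
  have L: "small U (L n)" for n
    unfolding L_def by (induction n) (auto simp: small_countable[OF U] small_step)
  have mono_step: "step T \<subseteq> step T'" if "T \<subseteq> T'" for T T'
    unfolding step_def using that lists_mono[OF that] by blast
  have LS: "L n \<subseteq> L (Suc n)" for n
    unfolding L_def by (induction n) (auto dest: mono_step)
  have Lm: "L m \<subseteq> L n" if "m \<le> n" for m n
    using that LS by (rule lift_Suc_mono_le[rotated])
  have "\<exists>n. t \<in> L n" if "t \<in> tms \<Sigma> M" for t
    using that
  proof (induction t)
    case (TVar x)
    then have "TVar x \<in> L (Suc 0)" unfolding L_def step_def by auto
    then show ?case by blast
  next
    case (TOp \<sigma> ts)
    then have "\<forall>t\<in>set ts. \<exists>n. t \<in> L n" by auto
    then obtain k where k: "\<forall>t\<in>set ts. t \<in> L (k t)" by metis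
    have "finite (k ` set ts)" by simp
    then obtain m where "\<forall>i\<in>k ` set ts. i \<le> m" using finite_nat_set_iff_bounded_le by metis
    then have "set ts \<subseteq> L m" using k Lm by blast
    then have "TOp \<sigma> ts \<in> step (L m)"
      unfolding step_def using TOp(2) by (auto simp: lists_eq_set image_iff)
    then have "TOp \<sigma> ts \<in> L (Suc m)" unfolding L_def by simp
    then show ?case by blast
  qed
  then have "tms \<Sigma> M \<subseteq> (\<Union>n. L n)" by blast
  then show ?thesis
    using small_subset small_UNION[OF U small_countable[OF U], of UNIV L] L by simp
qed

fun tm_of_trm :: "'s trm \<Rightarrow> ('s, nat) tm" where
  "tm_of_trm (Var i) = TVar i"
| "tm_of_trm (Op \<sigma> ts) = TOp \<sigma> (map tm_of_trm ts)"

lemma tm_of_trm_tms: "is_term \<Sigma> t \<Longrightarrow> tm_of_trm t \<in> tms \<Sigma> UNIV"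
  by (induction t) auto

lemma eval_tm_of_trm: "eval_tm A v (tm_of_trm t) = eval_trm A v t"
proof (induction t)
  case (Op \<sigma> ts)
  then have "map (\<lambda>t. eval_tm A v (tm_of_trm t)) ts = map (eval_trm A v) ts" by simp
  then show ?case by (simp add: comp_def del: map_eq_conv)
qed simp

fun rename :: "('v \<Rightarrow> nat) \<Rightarrow> ('s, 'v) tm \<Rightarrow> 's trm" where
  "rename f (TVar x) = Var (f x)"
| "rename f (TOp \<sigma> ts) = Op \<sigma> (map (rename f) ts)"

lemma is_term_rename: "t \<in> tms \<Sigma> M \<Longrightarrow> is_term \<Sigma> (rename f t)"
  by (induction t) auto

lemma eval_rename: "eval_trm A w (rename f t) = eval_tm A (\<lambda>x. w (f x)) t"
proof (induction t)
  case (TOp \<sigma> ts)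
  then have "map (\<lambda>t. eval_trm A w (rename f t)) ts = map (eval_tm A (\<lambda>x. w (f x))) ts" by simp
  then show ?case by (simp add: comp_def del: map_eq_conv)
qed simp

text \<open>
  Inequations are inherited along families of homomorphisms that jointly reflect the order. The
  families used are the two projections of an algebra of pairs, and all evaluations of terms in
  models.
\<close>

lemma satisfies_if_jointly_reflecting:
  fixes A :: "('s, 'x) oalg"
  assumes A: "preordered_algebra \<Sigma> A" and st: "is_term \<Sigma> s" "is_term \<Sigma> t"
    and "\<And>x y. x \<in> carr A \<Longrightarrow> y \<in> carr A \<Longrightarrow>
       (\<And>(B :: ('s, 'y) oalg) f. oalg_hom \<Sigma> A B f \<Longrightarrow> satisfies B s t \<Longrightarrow> (f x, f y) \<in> ord B) \<Longrightarrow>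
       (x, y) \<in> ord A"
  shows "satisfies A s t"
  unfolding satisfies_def
proof (intro allI impI)
  fix v :: "nat \<Rightarrow> 'x" assume v: "range v \<subseteq> carr A"
  note tm = tm_of_trm_tms[OF st(1)] tm_of_trm_tms[OF st(2)]
  show "(eval_trm A v s, eval_trm A v t) \<in> ord A"
  proof (rule assms(4))
    show "eval_trm A v s \<in> carr A" "eval_trm A v t \<in> carr A"
      using eval_tm_closed[OF A tm(1) v] eval_tm_closed[OF A tm(2) v]
      by (auto simp: eval_tm_of_trm)
    fix B :: "('s, 'y) oalg" and f assume f: "oalg_hom \<Sigma> A B f" "satisfies B s t"
    have "range (\<lambda>i. f (v i)) \<subseteq> carr B" using v oalg_hom_carr[OF f(1)] by auto
    then show "(f (eval_trm A v s), f (eval_trm A v t)) \<in> ord B"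
      using f(2) hom_eval_tm[OF A f(1) tm(1) v] hom_eval_tm[OF A f(1) tm(2) v]
      unfolding satisfies_def eval_tm_of_trm by metis
  qed
qed

text \<open>
  Inequations pass to images, since every valuation in the image lifts.
\<close>

lemma satisfies_image:
  fixes B :: "('s, 'y) oalg"
  assumes A: "preordered_algebra \<Sigma> A" and st: "is_term \<Sigma> s" "is_term \<Sigma> t"
    and q: "oalg_hom \<Sigma> A B q" "carr B = q ` carr A" and "satisfies A s t"
  shows "satisfies B s t"
  unfolding satisfies_def
proof (intro allI impI)
  fix v :: "nat \<Rightarrow> 'y" assume v: "range v \<subseteq> carr B"
  define w where "w i = inv_into (carr A) q (v i)" for i
  have "v i \<in> q ` carr A" for i using v q(2) by blast
  then have w: "range w \<subseteq> carr A" "(\<lambda>i. q (w i)) = v"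
    unfolding w_def by (auto simp: inv_into_into f_inv_into_f)
  have "(eval_trm A w s, eval_trm A w t) \<in> ord A"
    using assms(6) w unfolding satisfies_def by blast
  then show "(eval_trm B v s, eval_trm B v t) \<in> ord B"
    using oalg_hom_mono[OF q(1)] w(2) hom_eval_tm[OF A q(1) tm_of_trm_tms[OF st(1)] w(1)]
      hom_eval_tm[OF A q(1) tm_of_trm_tms[OF st(2)] w(1)] unfolding eval_tm_of_trm by metis
qed

section \<open>Categories enriched over posets\<close>

lemma hom_poset_iff: "(f, g) \<in> hom_poset C X Y \<longleftrightarrow> f \<in> hom C X Y \<and> g \<in> hom C X Y \<and> (f, g) \<in> Le C"
  unfolding hom_poset_def by auto

context pos_category
begin

lemma hom_objs: "f \<in> hom C X Y \<Longrightarrow> X \<in> Obj C \<and> Y \<in> Obj C"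
  unfolding hom_def using dom_obj cod_obj by auto

lemma hom_order': "partial_order_on (hom C X Y) (hom_poset C X Y)"
proof (cases "X \<in> Obj C \<and> Y \<in> Obj C")
  case False
  then have "hom C X Y = {}" using hom_objs by blast
  then show ?thesis unfolding hom_poset_def by simp
qed (use hom_order in blast)

lemma Field_hom_poset [simp]: "Field (hom_poset C X Y) = hom C X Y"
  using hom_order'[of X Y] unfolding partial_order_on_def preorder_on_def refl_on_def Field_def
  by blast

lemma Partial_order_hom_poset: "Partial_order (hom_poset C X Y)"
  using hom_order' by simp

lemma le_refl: "f \<in> hom C X Y \<Longrightarrow> (f, f) \<in> Le C"
  using hom_order'[of X Y] hom_poset_iff unfolding partial_order_on_def preorder_on_def refl_on_def
  by metis

lemma le_antisym:
  "\<lbrakk>(f, g) \<in> Le C; (g, f) \<in> Le C; f \<in> hom C X Y; g \<in> hom C X Y\<rbrakk> \<Longrightarrow> f = g"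
  using hom_order'[of X Y] hom_poset_iff[of _ _ C X Y]
  unfolding partial_order_on_def antisym_def by meson

lemma comp_le:
  "\<lbrakk>(f, f') \<in> Le C; (g, g') \<in> Le C; f \<in> hom C X Y; f' \<in> hom C X Y; g \<in> hom C Y Z; g' \<in> hom C Y Z\<rbrakk>
    \<Longrightarrow> (g \<cdot> f, g' \<cdot> f') \<in> Le C"
  using comp_mono hom_poset_iff by metis

lemma comp_le_right:
  "\<lbrakk>(f, f') \<in> Le C; f \<in> hom C X Y; f' \<in> hom C X Y; g \<in> hom C Y Z\<rbrakk> \<Longrightarrow> (g \<cdot> f, g \<cdot> f') \<in> Le C"
  using comp_le le_refl by metis

lemma comp_le_left:
  "\<lbrakk>(g, g') \<in> Le C; f \<in> hom C X Y; g \<in> hom C Y Z; g' \<in> hom C Y Z\<rbrakk> \<Longrightarrow> (g \<cdot> f, g' \<cdot> f) \<in> Le C"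
  using comp_le le_refl by metis

lemma coinserterI:
  assumes "u0 \<in> hom C U X" "u1 \<in> hom C U X" "f \<in> hom C X Y" "(f \<cdot> u0, f \<cdot> u1) \<in> Le C"
    and "\<And>Z f'. f' \<in> hom C X Z \<Longrightarrow> (f' \<cdot> u0, f' \<cdot> u1) \<in> Le C \<Longrightarrow> \<exists>g\<in>hom C Y Z. f' = g \<cdot> f"
    and "\<And>Z g g'. g \<in> hom C Y Z \<Longrightarrow> g' \<in> hom C Y Z \<Longrightarrow> (g \<cdot> f, g' \<cdot> f) \<in> Le C \<Longrightarrow> (g, g') \<in> Le C"
  shows "coinserter C u0 u1 f"
  using assms unfolding coinserter_def parallel_pair_def hom_def by auto

lemma coinserterE:
  assumes "coinserter C u0 u1 f"
  obtains U X Y where "u0 \<in> hom C U X" "u1 \<in> hom C U X" "f \<in> hom C X Y"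
  using assms unfolding coinserter_def parallel_pair_def hom_def by auto

lemma coinserter_le: "coinserter C u0 u1 f \<Longrightarrow> (f \<cdot> u0, f \<cdot> u1) \<in> Le C"
  unfolding coinserter_def by blast

lemma coinserter_factor:
  assumes "coinserter C u0 u1 f" "f \<in> hom C X Y" "f' \<in> hom C X Z" "(f' \<cdot> u0, f' \<cdot> u1) \<in> Le C"
  obtains g where "g \<in> hom C Y Z" "f' = g \<cdot> f"
  using assms unfolding coinserter_def hom_def by auto

lemma coinserter_cancel:
  "\<lbrakk>coinserter C u0 u1 f; f \<in> hom C X Y; g \<in> hom C Y Z; g' \<in> hom C Y Z; (g \<cdot> f, g' \<cdot> f) \<in> Le C\<rbrakk>
    \<Longrightarrow> (g, g') \<in> Le C"
  unfolding coinserter_def hom_def parallel_pair_def by auto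

lemma coinserter_cancel_eq:
  assumes "coinserter C u0 u1 f" "f \<in> hom C X Y" "g \<in> hom C Y Z" "g' \<in> hom C Y Z" "g \<cdot> f = g' \<cdot> f"
  shows "g = g'"
  using coinserter_cancel[OF assms(1-4)] coinserter_cancel[OF assms(1,2,4,3)] assms(3-5)
    le_refl[OF comp_hom[OF assms(2,3)]] le_antisym by metis

text \<open>
  Two coinserters of the same pair factor through each other, and \<open>f\<close> can be cancelled from
  \<open>g \<cdot> g' \<cdot> f = f\<close>.
\<close>

lemma coinserter_unique:
  assumes f: "coinserter C u0 u1 f" "f \<in> hom C X Y" and q: "coinserter C u0 u1 q" "q \<in> hom C X Q"
  obtains g g' where "g \<in> hom C Q Y" "g' \<in> hom C Y Q" "f = g \<cdot> q" "q = g' \<cdot> f" "g \<cdot> g' = Idt C Y"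
proof -
  obtain g where g: "g \<in> hom C Q Y" "f = g \<cdot> q"
    using coinserter_factor[OF q f(2) coinserter_le[OF f(1)]] .
  obtain g' where g': "g' \<in> hom C Y Q" "q = g' \<cdot> f"
    using coinserter_factor[OF f q(2) coinserter_le[OF q(1)]] .
  have "(g \<cdot> g') \<cdot> f = Idt C Y \<cdot> f"
    using g g' comp_assoc[OF f(2) g'(1) g(1)] comp_id_left[OF f(2)] by simp
  then have "g \<cdot> g' = Idt C Y"
    using coinserter_cancel_eq[OF f comp_hom[OF g'(1) g(1)]] id_hom hom_objs[OF f(2)] by blast
  then show ?thesis using that g g' by blast
qed

end

lemma full_subcategory_concrete:
  "full_subcategory (concrete_cat S r H) T = concrete_cat (S \<inter> T) r H"
  unfolding full_subcategory_def concrete_cat_def by auto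

lemma concrete_simps [simp]:
  "Obj (concrete_cat S r H) = S" "Dom (concrete_cat S r H) (A, B, f) = A"
  "Cod (concrete_cat S r H) (A, B, f) = B"
  "Idt (concrete_cat S r H) A = (A, A, \<lambda>x\<in>Field (r A). x)"
  "(B', D, g) \<cdot>\<^bsub>concrete_cat S r H\<^esub> (A, B, f) = (A, D, compose (Field (r A)) g f)"
  "((A, B, f), (A', B', g)) \<in> Le (concrete_cat S r H) \<longleftrightarrow>
     A' = A \<and> B' = B \<and> pointwise_le (r A) (r B) f g"
  unfolding concrete_cat_def by auto

lemma concrete_hom_iff:
  "a \<in> hom (concrete_cat S r H) A B \<longleftrightarrow> A \<in> S \<and> B \<in> S \<and> (\<exists>f\<in>H A B. a = (A, B, f))"
  unfolding hom_def concrete_cat_def by auto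

lemma pos_category_concrete:
  assumes P: "\<And>A. A \<in> S \<Longrightarrow> Partial_order (r A)"
    and H: "\<And>A B. A \<in> S \<Longrightarrow> B \<in> S \<Longrightarrow> H A B \<subseteq> mono_maps (r A) (r B)"
    and i: "\<And>A. A \<in> S \<Longrightarrow> (\<lambda>x\<in>Field (r A). x) \<in> H A A"
    and c: "\<And>A B D f g. A \<in> S \<Longrightarrow> B \<in> S \<Longrightarrow> D \<in> S \<Longrightarrow> f \<in> H A B \<Longrightarrow> g \<in> H B D \<Longrightarrow>
       compose (Field (r A)) g f \<in> H A D"
  shows "pos_category (concrete_cat S r H)"
proof -
  let ?C = "concrete_cat S r H"
  have mm: "f x \<in> Field (r B)"
    if "A \<in> S" "B \<in> S" "f \<in> H A B" "x \<in> Field (r A)" for A B f x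
    using H[OF that(1,2)] that(3,4) unfolding mono_maps_def by auto
  have ext: "f \<in> extensional (Field (r A))" if "A \<in> S" "B \<in> S" "f \<in> H A B" for A B f
    using H[OF that(1,2)] that(3) unfolding mono_maps_def PiE_def by auto
  have mono: "(f x, f y) \<in> r B"
    if "A \<in> S" "B \<in> S" "f \<in> H A B" "(x, y) \<in> r A" for A B f x y
    using H[OF that(1,2)] that(3,4) unfolding mono_maps_def by auto
  show ?thesis
  proof
    fix f assume "f \<in> Arr ?C"
    then show "Dom ?C f \<in> Obj ?C" "Cod ?C f \<in> Obj ?C"
      unfolding concrete_cat_def by auto
  next
    fix X assume "X \<in> Obj ?C"
    then show "Idt ?C X \<in> hom ?C X X" using i by (simp add: concrete_hom_iff)
  next
    fix f g X Y Z assume "f \<in> hom ?C X Y" "g \<in> hom ?C Y Z"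
    then show "g \<cdot>\<^bsub>?C\<^esub> f \<in> hom ?C X Z" using c by (auto simp: concrete_hom_iff)
  next
    fix f X Y assume "f \<in> hom ?C X Y"
    then obtain h where h: "X \<in> S" "Y \<in> S" "h \<in> H X Y" "f = (X, Y, h)"
      unfolding concrete_hom_iff by blast
    have "compose (Field (r X)) h (\<lambda>x\<in>Field (r X). x) = h"
      "compose (Field (r X)) (\<lambda>x\<in>Field (r Y). x) h = h"
      using mm[OF h(1-3)] ext[OF h(1-3)] by (auto simp: compose_def extensional_def fun_eq_iff)
    then show "f \<cdot>\<^bsub>?C\<^esub> Idt ?C X = f" "Idt ?C Y \<cdot>\<^bsub>?C\<^esub> f = f"
      using h(4) by simp_all
  next
    fix f g h W X Y Z assume "f \<in> hom ?C W X" "g \<in> hom ?C X Y" "h \<in> hom ?C Y Z"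
    then obtain f' g' h' where *: "f = (W, X, f')" "g = (X, Y, g')" "h = (Y, Z, h')"
      "W \<in> S" "X \<in> S" "f' \<in> H W X"
      unfolding concrete_hom_iff by blast
    show "(h \<cdot>\<^bsub>?C\<^esub> g) \<cdot>\<^bsub>?C\<^esub> f = h \<cdot>\<^bsub>?C\<^esub> (g \<cdot>\<^bsub>?C\<^esub> f)"
      using mm[OF *(4-6)] by (auto simp: *(1-3) compose_def fun_eq_iff)
  next
    fix X Y assume S: "X \<in> Obj ?C" "Y \<in> Obj ?C"
    have "antisym (r Y)" "Preorder (r Y)" using P S unfolding partial_order_on_def by auto
    note r = this preorder_refl[OF this(2)] preorder_trans[OF this(2)]
    show "partial_order_on (hom ?C X Y) (hom_poset ?C X Y)"
      unfolding partial_order_on_def preorder_on_def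
    proof (intro conjI)
      show "hom_poset ?C X Y \<subseteq> hom ?C X Y \<times> hom ?C X Y" unfolding hom_poset_def by blast
      show "refl_on (hom ?C X Y) (hom_poset ?C X Y)"
        unfolding refl_on_def using S mm r
        by (auto simp: hom_poset_iff concrete_hom_iff pointwise_le_def)
      show "trans (hom_poset ?C X Y)"
        by (rule transI) (auto simp: hom_poset_iff concrete_hom_iff pointwise_le_def, meson r(4))
      show "antisym (hom_poset ?C X Y)"
      proof (rule antisymI)
        fix a b assume "(a, b) \<in> hom_poset ?C X Y" "(b, a) \<in> hom_poset ?C X Y"
        then obtain f g where fg: "a = (X, Y, f)" "b = (X, Y, g)" "f \<in> H X Y" "g \<in> H X Y"
          "\<forall>x\<in>Field (r X). (f x, g x) \<in> r Y \<and> (g x, f x) \<in> r Y"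
          by (auto simp: hom_poset_iff concrete_hom_iff pointwise_le_def)
        have "f = g"
          using ext[OF _ _ fg(3)] ext[OF _ _ fg(4)] S r(1) fg(5)
          by (auto intro!: extensionalityI[of f "Field (r X)" g] simp: antisym_def)
        then show "a = b" using fg by simp
      qed
    qed
  next
    fix f f' g g' X Y Z assume "(f, f') \<in> hom_poset ?C X Y" "(g, g') \<in> hom_poset ?C Y Z"
    then obtain a a' b b' where *: "f = (X, Y, a)" "f' = (X, Y, a')" "g = (Y, Z, b)"
      "g' = (Y, Z, b')"
      "a \<in> H X Y" "a' \<in> H X Y" "b \<in> H Y Z" "b' \<in> H Y Z" "X \<in> S" "Y \<in> S" "Z \<in> S"
      "\<forall>x\<in>Field (r X). (a x, a' x) \<in> r Y" "\<forall>x\<in>Field (r Y). (b x, b' x) \<in> r Z"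
      by (auto simp: hom_poset_iff concrete_hom_iff pointwise_le_def)
    have "(b (a x), b' (a' x)) \<in> r Z" if "x \<in> Field (r X)" for x
    proof -
      have "(b (a x), b (a' x)) \<in> r Z" using mono[OF *(10,11,7)] *(12) that by blast
      moreover have "(b (a' x), b' (a' x)) \<in> r Z" using *(13) mm[OF *(9,10,6) that] by blast
      ultimately show ?thesis
        using P[OF *(11)] preorder_trans unfolding partial_order_on_def by metis
    qed
    then show "(g \<cdot>\<^bsub>?C\<^esub> f, g' \<cdot>\<^bsub>?C\<^esub> f') \<in> hom_poset ?C X Z"
      using * c by (auto simp: hom_poset_iff concrete_hom_iff pointwise_le_def compose_def)
  qed
qed

section \<open>Equivalences\<close>

lemma iso_inverse:
  assumes "iso C X Y f"
  obtains g where "f \<in> hom C X Y" "g \<in> hom C Y X" "g \<cdot>\<^bsub>C\<^esub> f = Idt C X" "f \<cdot>\<^bsub>C\<^esub> g = Idt C Y"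
  using assms unfolding iso_def by blast

lemma functor_hom: "pos_functor C D Fo Fa \<Longrightarrow> f \<in> hom C X Y \<Longrightarrow> Fa f \<in> hom D (Fo X) (Fo Y)"
  unfolding pos_functor_def by blast

lemma functor_comp:
  "pos_functor C D Fo Fa \<Longrightarrow> f \<in> hom C X Y \<Longrightarrow> g \<in> hom C Y Z \<Longrightarrow>
    Fa (g \<cdot>\<^bsub>C\<^esub> f) = Fa g \<cdot>\<^bsub>D\<^esub> Fa f"
  unfolding pos_functor_def by blast

lemma functor_id: "pos_functor C D Fo Fa \<Longrightarrow> X \<in> Obj C \<Longrightarrow> Fa (Idt C X) = Idt D (Fo X)"
  unfolding pos_functor_def by blast

lemma functor_obj: "pos_functor C D Fo Fa \<Longrightarrow> X \<in> Obj C \<Longrightarrow> Fo X \<in> Obj D"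
  unfolding pos_functor_def by blast

lemma functor_le:
  "pos_functor C D Fo Fa \<Longrightarrow> f \<in> hom C X Y \<Longrightarrow> g \<in> hom C X Y \<Longrightarrow> (f, g) \<in> Le C \<Longrightarrow> (Fa f, Fa g) \<in> Le D"
  unfolding pos_functor_def hom_poset_iff by blast

text \<open>
  The enriched form of a full and faithful functor.
\<close>

definition full_order_embedding ::
    "('o, 'a) poscat \<Rightarrow> ('p, 'b) poscat \<Rightarrow> ('o \<Rightarrow> 'p) \<Rightarrow> ('a \<Rightarrow> 'b) \<Rightarrow> bool" where
  "full_order_embedding C D Fo Fa \<longleftrightarrow> pos_functor C D Fo Fa \<and>
     (\<forall>X\<in>Obj C. \<forall>Y\<in>Obj C. \<forall>b\<in>hom D (Fo X) (Fo Y). \<exists>f\<in>hom C X Y. Fa f = b) \<and>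
     (\<forall>X Y. \<forall>f\<in>hom C X Y. \<forall>g\<in>hom C X Y. (Fa f, Fa g) \<in> Le D \<longrightarrow> (f, g) \<in> Le C)"

text \<open>
  A morphism \<open>k\<close> that can be recovered from its image \<open>Ha (Fa k)\<close> by composing with fixed
  morphisms can be compared there.
\<close>

lemma reflecting_if_retraction:
  assumes C: "pos_category C" and F: "pos_functor C D Fo Fa" and H: "pos_functor D C Ho Ha"
    and pq: "p \<in> hom C (Ho (Fo Y)) Y" "q \<in> hom C X (Ho (Fo X))"
    and retract: "\<And>k. k \<in> hom C X Y \<Longrightarrow> p \<cdot>\<^bsub>C\<^esub> (Ha (Fa k) \<cdot>\<^bsub>C\<^esub> q) = k"
    and fg: "f \<in> hom C X Y" "g \<in> hom C X Y" and le: "(Fa f, Fa g) \<in> Le D"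
  shows "(f, g) \<in> Le C"
proof -
  interpret pos_category C by (rule C)
  have hom: "Ha (Fa k) \<in> hom C (Ho (Fo X)) (Ho (Fo Y))" if "k \<in> hom C X Y" for k
    using functor_hom[OF H functor_hom[OF F that]] .
  have "(Ha (Fa f), Ha (Fa g)) \<in> Le C"
    using functor_le[OF H functor_hom[OF F fg(1)] functor_hom[OF F fg(2)] le] .
  then have "(Ha (Fa f) \<cdot>\<^bsub>C\<^esub> q, Ha (Fa g) \<cdot>\<^bsub>C\<^esub> q) \<in> Le C"
    using comp_le_left pq(2) hom fg by blast
  then have "(p \<cdot>\<^bsub>C\<^esub> (Ha (Fa f) \<cdot>\<^bsub>C\<^esub> q), p \<cdot>\<^bsub>C\<^esub> (Ha (Fa g) \<cdot>\<^bsub>C\<^esub> q)) \<in> Le C"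
    using comp_le_right pq(1) comp_hom[OF pq(2) hom] fg by blast
  then show ?thesis using retract fg by simp
qed

text \<open>
  Both functors of an equivalence reflect the order, as the natural isomorphisms recover a
  morphism from its double image. Hence \<open>Fa\<close> is full: the conjugate of \<open>Ha b\<close> by \<open>\<eta>\<close> has the same
  image under \<open>Ha \<circ> Fa\<close> as \<open>b\<close> has under \<open>Ha\<close>, and \<open>Ha\<close> is injective.
\<close>

lemma full_order_embedding_if_equivalent:
  assumes C: "pos_category C" and D: "pos_category D" and "equivalent C D"
  obtains Fo Fa where "full_order_embedding C D Fo Fa" "\<forall>Z\<in>Obj D. \<exists>X\<in>Obj C. \<exists>i. iso D (Fo X) Z i"
proof -
  interpret C: pos_category C by (rule C)
  interpret D: pos_category D by (rule D)
  obtain Fo Fa Ho Ha \<eta> \<epsilon> where F: "pos_functor C D Fo Fa" and H: "pos_functor D C Ho Ha"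
    and n: "natural_iso C C id id (Ho \<circ> Fo) (Ha \<circ> Fa) \<eta>"
    and e: "natural_iso D D (Fo \<circ> Ho) (Fa \<circ> Ha) id id \<epsilon>"
    using assms(3) unfolding equivalent_def by auto
  have reflF: "(f, g) \<in> Le C"
    if fg: "f \<in> hom C X Y" "g \<in> hom C X Y" and le: "(Fa f, Fa g) \<in> Le D" for f g X Y
  proof -
    have "iso C X (Ho (Fo X)) (\<eta> X)" "iso C Y (Ho (Fo Y)) (\<eta> Y)"
      using n C.hom_objs[OF fg(1)] unfolding natural_iso_def by auto
    then obtain e where hX: "\<eta> X \<in> hom C X (Ho (Fo X))" and hY: "\<eta> Y \<in> hom C Y (Ho (Fo Y))"
      and e: "e \<in> hom C (Ho (Fo Y)) Y" "e \<cdot>\<^bsub>C\<^esub> \<eta> Y = Idt C Y"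
      by (metis iso_inverse)
    show ?thesis
    proof (rule reflecting_if_retraction[OF C F H e(1) hX _ fg le])
      fix k assume k: "k \<in> hom C X Y"
      have "Ha (Fa k) \<cdot>\<^bsub>C\<^esub> \<eta> X = \<eta> Y \<cdot>\<^bsub>C\<^esub> k" using n k unfolding natural_iso_def by simp
      then show "e \<cdot>\<^bsub>C\<^esub> (Ha (Fa k) \<cdot>\<^bsub>C\<^esub> \<eta> X) = k"
        using C.comp_assoc[OF k hY e(1)] e(2) C.comp_id_left[OF k] by simp
    qed
  qed
  have reflH: "(f, g) \<in> Le D"
    if fg: "f \<in> hom D X Y" "g \<in> hom D X Y" and le: "(Ha f, Ha g) \<in> Le C" for f g X Y
  proof -
    have "iso D (Fo (Ho X)) X (\<epsilon> X)" "iso D (Fo (Ho Y)) Y (\<epsilon> Y)"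
      using e D.hom_objs[OF fg(1)] unfolding natural_iso_def by auto
    then obtain d where hX: "\<epsilon> X \<in> hom D (Fo (Ho X)) X" and hY: "\<epsilon> Y \<in> hom D (Fo (Ho Y)) Y"
      and d: "d \<in> hom D X (Fo (Ho X))" "\<epsilon> X \<cdot>\<^bsub>D\<^esub> d = Idt D X"
      by (metis iso_inverse)
    show ?thesis
    proof (rule reflecting_if_retraction[OF D H F hY d(1) _ fg le])
      fix k assume k: "k \<in> hom D X Y"
      have "\<epsilon> Y \<cdot>\<^bsub>D\<^esub> Fa (Ha k) = k \<cdot>\<^bsub>D\<^esub> \<epsilon> X" using e k unfolding natural_iso_def by simp
      then show "\<epsilon> Y \<cdot>\<^bsub>D\<^esub> (Fa (Ha k) \<cdot>\<^bsub>D\<^esub> d) = k"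
        using D.comp_assoc[OF d(1) functor_hom[OF F functor_hom[OF H k]] hY]
          D.comp_assoc[OF d(1) hX k] d(2) D.comp_id_right[OF k] by simp
    qed
  qed
  have "\<exists>f\<in>hom C X Y. Fa f = b" if X: "X \<in> Obj C" "Y \<in> Obj C" and b: "b \<in> hom D (Fo X) (Fo Y)"
    for X Y b
  proof -
    have "iso C X (Ho (Fo X)) (\<eta> X)" "iso C Y (Ho (Fo Y)) (\<eta> Y)"
      using n X unfolding natural_iso_def by auto
    then obtain e' e'' where hX: "\<eta> X \<in> hom C X (Ho (Fo X))" and hY: "\<eta> Y \<in> hom C Y (Ho (Fo Y))"
      and e': "e' \<in> hom C (Ho (Fo X)) X" "\<eta> X \<cdot>\<^bsub>C\<^esub> e' = Idt C (Ho (Fo X))"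
      and e'': "e'' \<in> hom C (Ho (Fo Y)) Y" "\<eta> Y \<cdot>\<^bsub>C\<^esub> e'' = Idt C (Ho (Fo Y))"
      by (metis iso_inverse)
    have Hb: "Ha b \<in> hom C (Ho (Fo X)) (Ho (Fo Y))" using functor_hom[OF H b] .
    define f where "f = e'' \<cdot>\<^bsub>C\<^esub> (Ha b \<cdot>\<^bsub>C\<^esub> \<eta> X)"
    have f: "f \<in> hom C X Y" unfolding f_def using C.comp_hom hX Hb e''(1) by blast
    have HF: "Ha (Fa f) \<in> hom C (Ho (Fo X)) (Ho (Fo Y))"
      using functor_hom[OF H functor_hom[OF F f]] .
    have "Ha (Fa f) \<cdot>\<^bsub>C\<^esub> \<eta> X = \<eta> Y \<cdot>\<^bsub>C\<^esub> f"
      using n f unfolding natural_iso_def by simp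
    also have "\<dots> = (\<eta> Y \<cdot>\<^bsub>C\<^esub> e'') \<cdot>\<^bsub>C\<^esub> (Ha b \<cdot>\<^bsub>C\<^esub> \<eta> X)"
      unfolding f_def using C.comp_assoc[OF C.comp_hom[OF hX Hb] e''(1) hY] by simp
    also have "\<dots> = Ha b \<cdot>\<^bsub>C\<^esub> \<eta> X"
      using e''(2) C.comp_id_left[OF C.comp_hom[OF hX Hb]] by simp
    finally have "(Ha (Fa f) \<cdot>\<^bsub>C\<^esub> \<eta> X) \<cdot>\<^bsub>C\<^esub> e' = (Ha b \<cdot>\<^bsub>C\<^esub> \<eta> X) \<cdot>\<^bsub>C\<^esub> e'" by simp
    then have "Ha (Fa f) = Ha b"
      using C.comp_assoc[OF e'(1) hX HF] C.comp_assoc[OF e'(1) hX Hb] e'(2)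
        C.comp_id_right[OF HF] C.comp_id_right[OF Hb] by simp
    then have "(Fa f, b) \<in> Le D \<and> (b, Fa f) \<in> Le D"
      using reflH[OF functor_hom[OF F f] b] reflH[OF b functor_hom[OF F f]] C.le_refl[OF Hb] by simp
    then show ?thesis using D.le_antisym functor_hom[OF F f] b f by blast
  qed
  then have "full_order_embedding C D Fo Fa"
    unfolding full_order_embedding_def using F reflF by blast
  moreover have "\<forall>Z\<in>Obj D. \<exists>X\<in>Obj C. \<exists>i. iso D (Fo X) Z i"
    using e functor_obj[OF H] unfolding natural_iso_def by fastforce
  ultimately show ?thesis by (rule that)
qed

text \<open>
  The inverse functor sends \<open>b : Z \<rightarrow> W\<close> to the unique morphism whose image is the conjugate
  \<open>conj b\<close> of \<open>b\<close> by the chosen isomorphisms \<open>e Z : Fo (Ho Z) \<rightarrow> Z\<close>.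
\<close>

lemma equivalent_if_full_order_embedding:
  assumes C: "pos_category C" and D: "pos_category D" and ff: "full_order_embedding C D Fo Fa"
    and es: "\<forall>Z\<in>Obj D. \<exists>X\<in>Obj C. \<exists>i. iso D (Fo X) Z i"
  shows "equivalent C D"
proof -
  interpret C: pos_category C by (rule C)
  interpret D: pos_category D by (rule D)
  have F: "pos_functor C D Fo Fa" using ff unfolding full_order_embedding_def by blast
  have full: "\<exists>f\<in>hom C X Y. Fa f = b" if "X \<in> Obj C" "Y \<in> Obj C" "b \<in> hom D (Fo X) (Fo Y)" for X Y b
    using ff that unfolding full_order_embedding_def by blast
  have refl: "(f, g) \<in> Le C" if "f \<in> hom C X Y" "g \<in> hom C X Y" "(Fa f, Fa g) \<in> Le D" for f g X Y
    using ff that unfolding full_order_embedding_def by blast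
  have inj: "f = g" if "f \<in> hom C X Y" "g \<in> hom C X Y" "Fa f = Fa g" for f g X Y
    using refl[OF that(1,2)] refl[OF that(2,1)] that D.le_refl[OF functor_hom[OF F that(1)]]
      C.le_antisym by metis
  have "\<forall>Z\<in>Obj D. \<exists>X i j. X \<in> Obj C \<and> i \<in> hom D (Fo X) Z \<and> j \<in> hom D Z (Fo X) \<and>
      j \<cdot>\<^bsub>D\<^esub> i = Idt D (Fo X) \<and> i \<cdot>\<^bsub>D\<^esub> j = Idt D Z"
    using es unfolding iso_def by blast
  then obtain Ho e d where ed: "\<forall>Z\<in>Obj D. Ho Z \<in> Obj C \<and> e Z \<in> hom D (Fo (Ho Z)) Z \<and>
      d Z \<in> hom D Z (Fo (Ho Z)) \<and> d Z \<cdot>\<^bsub>D\<^esub> e Z = Idt D (Fo (Ho Z)) \<and> e Z \<cdot>\<^bsub>D\<^esub> d Z = Idt D Z"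
    by metis
  have Ho: "Ho Z \<in> Obj C" and e: "e Z \<in> hom D (Fo (Ho Z)) Z" and d: "d Z \<in> hom D Z (Fo (Ho Z))"
    and de: "d Z \<cdot>\<^bsub>D\<^esub> e Z = Idt D (Fo (Ho Z))" and ed: "e Z \<cdot>\<^bsub>D\<^esub> d Z = Idt D Z"
    if "Z \<in> Obj D" for Z
    using ed that by blast+
  define conj where "conj b = d (Cod D b) \<cdot>\<^bsub>D\<^esub> (b \<cdot>\<^bsub>D\<^esub> e (Dom D b))" for b
  have DC: "Dom D b = Z" "Cod D b = W" if "b \<in> hom D Z W" for b Z W
    using that unfolding hom_def by auto
  have conj: "conj b \<in> hom D (Fo (Ho Z)) (Fo (Ho W))" if "b \<in> hom D Z W" for b Z W
    unfolding conj_def DC[OF that] using that e d D.comp_hom D.hom_objs by metis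
  define Ha where "Ha b = (SOME f. f \<in> hom C (Ho (Dom D b)) (Ho (Cod D b)) \<and> Fa f = conj b)" for b
  have Ha: "Ha b \<in> hom C (Ho Z) (Ho W)" "Fa (Ha b) = conj b" if "b \<in> hom D Z W" for b Z W
  proof -
    have "\<exists>f. f \<in> hom C (Ho Z) (Ho W) \<and> Fa f = conj b"
      using full[OF _ _ conj[OF that]] Ho D.hom_objs[OF that] by blast
    from someI_ex[OF this] show "Ha b \<in> hom C (Ho Z) (Ho W)" "Fa (Ha b) = conj b"
      unfolding Ha_def DC[OF that] by auto
  qed
  have econj: "e W \<cdot>\<^bsub>D\<^esub> conj b = b \<cdot>\<^bsub>D\<^esub> e Z" if b: "b \<in> hom D Z W" for b Z W
  proof -
    have o: "Z \<in> Obj D" "W \<in> Obj D" using D.hom_objs[OF b] by auto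
    have be: "b \<cdot>\<^bsub>D\<^esub> e Z \<in> hom D (Fo (Ho Z)) W" using D.comp_hom[OF e[OF o(1)] b] .
    show ?thesis
      unfolding conj_def DC[OF b]
      using D.comp_assoc[OF be d[OF o(2)] e[OF o(2)]] ed[OF o(2)] D.comp_id_left[OF be] by simp
  qed
  have cancel: "x = y" if "x \<in> hom D V (Fo (Ho Z))" "y \<in> hom D V (Fo (Ho Z))"
    "e Z \<cdot>\<^bsub>D\<^esub> x = e Z \<cdot>\<^bsub>D\<^esub> y" "Z \<in> Obj D" for x y V Z
    using that D.comp_assoc[OF _ e[OF that(4)] d[OF that(4)]] de[OF that(4)] D.comp_id_left by metis
  have H: "pos_functor D C Ho Ha"
    unfolding pos_functor_def
  proof (intro conjI ballI allI impI)
    fix X assume X: "X \<in> Obj D"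
    show "Ho X \<in> Obj C" using Ho[OF X] .
    have "conj (Idt D X) = Idt D (Fo (Ho X))"
      unfolding conj_def DC[OF D.id_hom[OF X]]
      using D.comp_id_left[OF e[OF X]] de[OF X] by simp
    then show "Ha (Idt D X) = Idt C (Ho X)"
      using inj[OF Ha(1)[OF D.id_hom[OF X]] C.id_hom[OF Ho[OF X]]]
        Ha(2)[OF D.id_hom[OF X]] functor_id[OF F Ho[OF X]] by simp
  next
    fix X Y f assume "f \<in> hom D X Y"
    then show "Ha f \<in> hom C (Ho X) (Ho Y)" by (rule Ha)
  next
    fix X Y Z f g assume "f \<in> hom D X Y \<and> g \<in> hom D Y Z"
    then have f: "f \<in> hom D X Y" and g: "g \<in> hom D Y Z" by auto
    have gf: "g \<cdot>\<^bsub>D\<^esub> f \<in> hom D X Z" using D.comp_hom[OF f g] .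
    have o: "X \<in> Obj D" "Y \<in> Obj D" "Z \<in> Obj D" using D.hom_objs f g by auto
    have "e Z \<cdot>\<^bsub>D\<^esub> (conj g \<cdot>\<^bsub>D\<^esub> conj f) = (g \<cdot>\<^bsub>D\<^esub> e Y) \<cdot>\<^bsub>D\<^esub> conj f"
      using D.comp_assoc[OF conj[OF f] conj[OF g] e[OF o(3)]] econj[OF g] by simp
    also have "\<dots> = g \<cdot>\<^bsub>D\<^esub> (f \<cdot>\<^bsub>D\<^esub> e X)"
      using D.comp_assoc[OF conj[OF f] e[OF o(2)] g] econj[OF f] by simp
    also have "\<dots> = e Z \<cdot>\<^bsub>D\<^esub> conj (g \<cdot>\<^bsub>D\<^esub> f)"
      using D.comp_assoc[OF e[OF o(1)] f g] econj[OF gf] by simp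
    finally have "conj g \<cdot>\<^bsub>D\<^esub> conj f = conj (g \<cdot>\<^bsub>D\<^esub> f)"
      using cancel D.comp_hom[OF conj[OF f] conj[OF g]] conj[OF gf] o by blast
    then show "Ha (g \<cdot>\<^bsub>D\<^esub> f) = Ha g \<cdot>\<^bsub>C\<^esub> Ha f"
      using inj[OF Ha(1)[OF gf] C.comp_hom[OF Ha(1)[OF f] Ha(1)[OF g]]] Ha(2)[OF gf]
        functor_comp[OF F Ha(1)[OF f] Ha(1)[OF g]] Ha(2)[OF f] Ha(2)[OF g] by simp
  next
    fix X Y f g assume "(f, g) \<in> hom_poset D X Y"
    then have f: "f \<in> hom D X Y" and g: "g \<in> hom D X Y" and le: "(f, g) \<in> Le D"
      unfolding hom_poset_iff by auto
    have o: "X \<in> Obj D" "Y \<in> Obj D" using D.hom_objs f by auto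
    have "(f \<cdot>\<^bsub>D\<^esub> e X, g \<cdot>\<^bsub>D\<^esub> e X) \<in> Le D"
      using D.comp_le_left[OF le e[OF o(1)] f g] .
    then have "(conj f, conj g) \<in> Le D"
      unfolding conj_def DC[OF f] DC[OF g]
      using D.comp_le_right D.comp_hom[OF e[OF o(1)] f] D.comp_hom[OF e[OF o(1)] g] d[OF o(2)]
        by blast
    then show "(Ha f, Ha g) \<in> hom_poset C (Ho X) (Ho Y)"
      unfolding hom_poset_iff using refl[OF Ha(1)[OF f] Ha(1)[OF g]] Ha f g by simp
  qed
  have eps: "natural_iso D D (Fo \<circ> Ho) (Fa \<circ> Ha) id id e"
    unfolding natural_iso_def
  proof (intro conjI ballI allI impI)
    fix X assume "X \<in> Obj D"
    then show "iso D ((Fo \<circ> Ho) X) (id X) (e X)"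
      unfolding iso_def using e d de ed by (auto intro!: bexI[of _ "d X"])
  next
    fix X Y f assume "f \<in> hom D X Y"
    then show "e Y \<cdot>\<^bsub>D\<^esub> (Fa \<circ> Ha) f = id f \<cdot>\<^bsub>D\<^esub> e X"
      using Ha(2) econj by simp
  qed
  define \<eta> where "\<eta> X = (SOME f. f \<in> hom C X (Ho (Fo X)) \<and> Fa f = d (Fo X))" for X
  have eta: "\<eta> X \<in> hom C X (Ho (Fo X))" "Fa (\<eta> X) = d (Fo X)" if X: "X \<in> Obj C" for X
  proof -
    have "\<exists>f. f \<in> hom C X (Ho (Fo X)) \<and> Fa f = d (Fo X)"
      using full[OF X Ho] d functor_obj[OF F X] by blast
    from someI_ex[OF this] show "\<eta> X \<in> hom C X (Ho (Fo X))" "Fa (\<eta> X) = d (Fo X)"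
      unfolding \<eta>_def by auto
  qed
  have "natural_iso C C id id (Ho \<circ> Fo) (Ha \<circ> Fa) \<eta>"
    unfolding natural_iso_def
  proof (intro conjI ballI allI impI)
    fix X assume X: "X \<in> Obj C"
    then have FX: "Fo X \<in> Obj D" using functor_obj[OF F] by blast
    obtain g where g: "g \<in> hom C (Ho (Fo X)) X" "Fa g = e (Fo X)"
      using full[OF Ho[OF FX] X e[OF FX]] by blast
    have "g \<cdot>\<^bsub>C\<^esub> \<eta> X = Idt C X"
      using inj[OF C.comp_hom[OF eta(1)[OF X] g(1)] C.id_hom[OF X]]
        functor_comp[OF F eta(1)[OF X] g(1)] functor_id[OF F X] eta(2)[OF X] g(2) ed[OF FX] by simp
    moreover have "\<eta> X \<cdot>\<^bsub>C\<^esub> g = Idt C (Ho (Fo X))"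
      using inj[OF C.comp_hom[OF g(1) eta(1)[OF X]] C.id_hom[OF Ho[OF FX]]]
        functor_comp[OF F g(1) eta(1)[OF X]] functor_id[OF F Ho[OF FX]] eta(2)[OF X] g(2) de[OF FX]
          by simp
    ultimately show "iso C (id X) ((Ho \<circ> Fo) X) (\<eta> X)"
      unfolding iso_def using eta(1)[OF X] g(1) by auto
  next
    fix X Y f assume f: "f \<in> hom C X Y"
    then have X: "X \<in> Obj C" "Y \<in> Obj C" using C.hom_objs by auto
    note FX = functor_obj[OF F X(1)] and FY = functor_obj[OF F X(2)]
    note Ff = functor_hom[OF F f]
    have HF: "Ha (Fa f) \<in> hom C (Ho (Fo X)) (Ho (Fo Y))" using Ha(1)[OF Ff] .
    have "e (Fo Y) \<cdot>\<^bsub>D\<^esub> (d (Fo Y) \<cdot>\<^bsub>D\<^esub> Fa f) = Fa f"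
      using D.comp_assoc[OF Ff d[OF FY] e[OF FY]] ed[OF FY] D.comp_id_left[OF Ff] by simp
    also have "\<dots> = e (Fo Y) \<cdot>\<^bsub>D\<^esub> (conj (Fa f) \<cdot>\<^bsub>D\<^esub> d (Fo X))"
      using D.comp_assoc[OF d[OF FX] conj[OF Ff] e[OF FY]] econj[OF Ff]
        D.comp_assoc[OF d[OF FX] e[OF FX] Ff] ed[OF FX] D.comp_id_right[OF Ff] by simp
    finally have "d (Fo Y) \<cdot>\<^bsub>D\<^esub> Fa f = conj (Fa f) \<cdot>\<^bsub>D\<^esub> d (Fo X)"
      using cancel D.comp_hom[OF Ff d[OF FY]] D.comp_hom[OF d[OF FX] conj[OF Ff]] FY by blast
    then show "\<eta> Y \<cdot>\<^bsub>C\<^esub> id f = (Ha \<circ> Fa) f \<cdot>\<^bsub>C\<^esub> \<eta> X"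
      using inj[OF C.comp_hom[OF f eta(1)[OF X(2)]] C.comp_hom[OF eta(1)[OF X(1)] HF]]
        functor_comp[OF F f eta(1)[OF X(2)]] functor_comp[OF F eta(1)[OF X(1)] HF]
        eta(2) X Ha(2)[OF Ff] by simp
  qed
  then show ?thesis
    unfolding equivalent_def using F H eps by blast
qed

section \<open>Tensors as universal arrows\<close>

text \<open>
  A tensor \<open>P \<otimes> G\<close> amounts, by the Yoneda lemma, to a universal monotone map \<open>\<eta>\<close> from \<open>P\<close> to
  \<open>K(G, T)\<close>, the one that corresponds to the identity of \<open>T\<close>. In this form tensors are easy to
  build and to transport along isomorphisms of \<open>P\<close>.
\<close>

definition tensor_arrow :: "('o, 'a) poscat \<Rightarrow> 'p rel \<Rightarrow> 'o \<Rightarrow> 'o \<Rightarrow> ('p \<Rightarrow> 'a) \<Rightarrow> bool" where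
  "tensor_arrow C P G T \<eta> \<longleftrightarrow> T \<in> Obj C \<and> mono_rel P (hom_poset C G T) \<eta> \<and>
     (\<forall>X\<in>Obj C. \<forall>f. mono_rel P (hom_poset C G X) f \<longrightarrow>
        (\<exists>h\<in>hom C T X. \<forall>p\<in>Field P. h \<cdot>\<^bsub>C\<^esub> \<eta> p = f p)) \<and>
     (\<forall>X. \<forall>h\<in>hom C T X. \<forall>h'\<in>hom C T X.
        (\<forall>p\<in>Field P. (h \<cdot>\<^bsub>C\<^esub> \<eta> p, h' \<cdot>\<^bsub>C\<^esub> \<eta> p) \<in> Le C) \<longrightarrow> (h, h') \<in> Le C)"

lemma tensor_arrow_reindex:
  assumes T: "tensor_arrow C P G T \<eta>" and j: "bij_betw j (Field P') (Field P)"
    and le: "\<And>x y. x \<in> Field P' \<Longrightarrow> y \<in> Field P' \<Longrightarrow> (x, y) \<in> P' \<longleftrightarrow> (j x, j y) \<in> P"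
  shows "tensor_arrow C P' G T (\<eta> \<circ> j)"
proof -
  define i where "i = inv_into (Field P') j"
  have i: "i p \<in> Field P'" "j (i p) = p" if "p \<in> Field P" for p
    using that j unfolding i_def bij_betw_def by (auto simp: inv_into_into f_inv_into_f)
  have ij: "i (j x) = x" if "x \<in> Field P'" for x
    using that j unfolding i_def bij_betw_def by (auto simp: inv_into_f_f)
  have jF: "j x \<in> Field P" if "x \<in> Field P'" for x
    using that j unfolding bij_betw_def by blast
  show ?thesis
    unfolding tensor_arrow_def
  proof (intro conjI ballI allI impI)
    show "T \<in> Obj C" using T unfolding tensor_arrow_def by blast
    show "mono_rel P' (hom_poset C G T) (\<eta> \<circ> j)"
      using T le unfolding tensor_arrow_def mono_rel_def comp_apply by (meson FieldI1 FieldI2)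
  next
    fix X f assume X: "X \<in> Obj C" and f: "mono_rel P' (hom_poset C G X) f"
    have "mono_rel P (hom_poset C G X) (f \<circ> i)"
      unfolding mono_rel_def comp_apply
    proof (intro allI impI)
      fix x y assume *: "(x, y) \<in> P"
      then have "x \<in> Field P" "y \<in> Field P" by (auto intro: FieldI1 FieldI2)
      then have "(i x, i y) \<in> P'" using * le i by simp
      then show "(f (i x), f (i y)) \<in> hom_poset C G X" using f unfolding mono_rel_def by blast
    qed
    then obtain h where "h \<in> hom C T X" "\<forall>p\<in>Field P. h \<cdot>\<^bsub>C\<^esub> \<eta> p = f (i p)"
      using T X unfolding tensor_arrow_def comp_apply by blast
    then show "\<exists>h\<in>hom C T X. \<forall>p\<in>Field P'. h \<cdot>\<^bsub>C\<^esub> (\<eta> \<circ> j) p = f p"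
      using jF ij by (intro bexI[of _ h]) auto
  next
    fix X h h' assume h: "h \<in> hom C T X" "h' \<in> hom C T X"
      and *: "\<forall>p\<in>Field P'. (h \<cdot>\<^bsub>C\<^esub> (\<eta> \<circ> j) p, h' \<cdot>\<^bsub>C\<^esub> (\<eta> \<circ> j) p) \<in> Le C"
    have "(h \<cdot>\<^bsub>C\<^esub> \<eta> p, h' \<cdot>\<^bsub>C\<^esub> \<eta> p) \<in> Le C" if "p \<in> Field P" for p
      using *[rule_format, OF i(1)[OF that]] i(2)[OF that] by simp
    then show "(h, h') \<in> Le C" using T h unfolding tensor_arrow_def by blast
  qed
qed

context pos_category
begin

lemma tensor_arrow_hom: "tensor_arrow C P G T \<eta> \<Longrightarrow> Preorder P \<Longrightarrow> p \<in> Field P \<Longrightarrow> \<eta> p \<in> hom C G T"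
  using mono_rel_Field[of P "hom_poset C G T" \<eta>] unfolding tensor_arrow_def by simp

lemma tensor_arrow_cotuple:
  assumes "tensor_arrow C P G T \<eta>" "X \<in> Obj C" "mono_rel P (hom_poset C G X) f"
  obtains h where "h \<in> hom C T X" "\<forall>p\<in>Field P. h \<cdot> \<eta> p = f p"
  using assms unfolding tensor_arrow_def by blast

lemma tensor_arrow_le:
  assumes "tensor_arrow C P G T \<eta>" "h \<in> hom C T X" "h' \<in> hom C T X"
    "\<And>p. p \<in> Field P \<Longrightarrow> (h \<cdot> \<eta> p, h' \<cdot> \<eta> p) \<in> Le C"
  shows "(h, h') \<in> Le C"
  using assms unfolding tensor_arrow_def by blast

lemma tensor_arrow_eq:
  assumes T: "tensor_arrow C P G T \<eta>" and P: "Preorder P" and h: "h \<in> hom C T X" "h' \<in> hom C T X"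
    and eq: "\<And>p. p \<in> Field P \<Longrightarrow> h \<cdot> \<eta> p = h' \<cdot> \<eta> p"
  shows "h = h'"
proof -
  have "(h' \<cdot> \<eta> p, h' \<cdot> \<eta> p) \<in> Le C" if "p \<in> Field P" for p
    using le_refl[OF comp_hom[OF tensor_arrow_hom[OF T P that] h(2)]] .
  then have "(h, h') \<in> Le C" "(h', h) \<in> Le C"
    using tensor_arrow_le[OF T h] tensor_arrow_le[OF T h(2,1)] eq by simp_all
  then show ?thesis using le_antisym h by blast
qed

lemma mono_rel_comp:
  assumes "mono_rel P (hom_poset C G T) \<eta>" "h \<in> hom C T X"
  shows "mono_rel P (hom_poset C G X) (\<lambda>p. h \<cdot> \<eta> p)"
  using assms comp_le_right comp_hom unfolding mono_rel_def hom_poset_iff by meson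

lemma mono_rel_restrict: "mono_rel P Q f \<Longrightarrow> restrict f (Field P) \<in> mono_maps P Q"
  unfolding mono_maps_iff mono_rel_def by (auto intro: FieldI1 FieldI2)

lemma mono_rel_Id_on:
  "mono_rel (Id_on M) (hom_poset C G X) f \<longleftrightarrow> (\<forall>x\<in>M. f x \<in> hom C G X)"
  using le_refl unfolding mono_rel_def hom_poset_iff by (auto simp: Id_on_iff)

lemma tensor_if_tensor_arrow:
  assumes T: "tensor_arrow C P G T \<eta>" and P: "Preorder P"
  obtains \<phi> where "tensor C P G T \<phi>"
    "\<forall>X. \<forall>f \<in> mono_maps P (hom_poset C G X). X \<in> Obj C \<longrightarrow>
       \<phi> X f \<in> hom C T X \<and> (\<forall>p\<in>Field P. \<phi> X f \<cdot> \<eta> p = f p)"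
proof -
  define \<phi> where "\<phi> X f = (THE h. h \<in> hom C T X \<and> (\<forall>p\<in>Field P. h \<cdot> \<eta> p = f p))" for X f
  have phiI: "\<phi> X f = h" if "h \<in> hom C T X" "\<forall>p\<in>Field P. h \<cdot> \<eta> p = f p" for X f h
    unfolding \<phi>_def using that tensor_arrow_eq[OF T P]
    by (intro the_equality) auto
  have phi: "\<phi> X f \<in> hom C T X \<and> (\<forall>p\<in>Field P. \<phi> X f \<cdot> \<eta> p = f p)"
    if f: "f \<in> mono_maps P (hom_poset C G X)" and X: "X \<in> Obj C" for X f
  proof -
    have "mono_rel P (hom_poset C G X) f" using f mono_maps_iff by blast
    then obtain h where "h \<in> hom C T X" "\<forall>p\<in>Field P. h \<cdot> \<eta> p = f p"
      using tensor_arrow_cotuple[OF T X] by blast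
    then show ?thesis using phiI by blast
  qed
  have ext: "f = g" if "f \<in> mono_maps P (hom_poset C G X)" "g \<in> mono_maps P (hom_poset C G X)"
    "\<And>p. p \<in> Field P \<Longrightarrow> f p = g p" for f g X
    using that extensionalityI[of f "Field P" g] unfolding mono_maps_iff by blast
  have eta: "mono_rel P (hom_poset C G T) \<eta>" using T unfolding tensor_arrow_def by blast
  have "tensor C P G T \<phi>"
    unfolding tensor_def
  proof (intro conjI ballI allI impI)
    show "T \<in> Obj C" using T unfolding tensor_arrow_def by blast
  next
    fix X assume X: "X \<in> Obj C"
    show "bij_betw (\<phi> X) (mono_maps P (hom_poset C G X)) (hom C T X)"
      unfolding bij_betw_def
    proof
      show "inj_on (\<phi> X) (mono_maps P (hom_poset C G X))"
        using phi[OF _ X] ext by (intro inj_onI) metis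
      have "h \<in> \<phi> X ` mono_maps P (hom_poset C G X)" if h: "h \<in> hom C T X" for h
      proof -
        have "h = \<phi> X (\<lambda>p\<in>Field P. h \<cdot> \<eta> p)" using phiI[OF h] by simp
        then show ?thesis using mono_rel_restrict[OF mono_rel_comp[OF eta h]] by blast
      qed
      then show "\<phi> X ` mono_maps P (hom_poset C G X) = hom C T X" using phi[OF _ X] by blast
    qed
    fix f g assume f: "f \<in> mono_maps P (hom_poset C G X)" and g: "g \<in> mono_maps P (hom_poset C G X)"
    note pf = phi[OF f X] and pg = phi[OF g X]
    have hp: "\<And>p. p \<in> Field P \<Longrightarrow> \<eta> p \<in> hom C G T" using tensor_arrow_hom[OF T P] .
    show "pointwise_le P (hom_poset C G X) f g \<longleftrightarrow> (\<phi> X f, \<phi> X g) \<in> hom_poset C T X"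
    proof
      assume "pointwise_le P (hom_poset C G X) f g"
      then have "(\<phi> X f \<cdot> \<eta> p, \<phi> X g \<cdot> \<eta> p) \<in> Le C" if "p \<in> Field P" for p
        using that pf pg unfolding pointwise_le_def hom_poset_iff by simp
      then show "(\<phi> X f, \<phi> X g) \<in> hom_poset C T X"
        using tensor_arrow_le[OF T] pf pg unfolding hom_poset_iff by blast
    next
      assume "(\<phi> X f, \<phi> X g) \<in> hom_poset C T X"
      then have "(\<phi> X f \<cdot> \<eta> p, \<phi> X g \<cdot> \<eta> p) \<in> hom_poset C G X" if "p \<in> Field P" for p
        using comp_le_left[OF _ hp[OF that]] comp_hom[OF hp[OF that]] pf pg
        unfolding hom_poset_iff by blast
      then show "pointwise_le P (hom_poset C G X) f g"
        unfolding pointwise_le_def using pf pg by simp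
    qed
  next
    fix X Y h f assume h: "h \<in> hom C X Y" and f: "f \<in> mono_maps P (hom_poset C G X)"
    have X: "X \<in> Obj C" using hom_objs h by blast
    note pf = phi[OF f X]
    show "\<phi> Y (\<lambda>p\<in>Field P. h \<cdot> f p) = h \<cdot> \<phi> X f"
      using pf h comp_hom comp_assoc[OF tensor_arrow_hom[OF T P]]
      by (intro phiI) auto
  qed
  then show ?thesis using phi by (intro that) auto
qed

text \<open>
  By naturality \<open>\<phi>\<close> sends \<open>h \<cdot> \<eta>\<close> to \<open>h \<cdot> \<phi> T \<eta> = h\<close>.
\<close>

lemma tensor_arrow_if_tensor:
  assumes T: "tensor C P G T \<phi>" and P: "Preorder P"
    and \<eta>: "\<eta> = the_inv_into (mono_maps P (hom_poset C G T)) (\<phi> T) (Idt C T)"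
  shows "tensor_arrow C P G T \<eta>"
    and "\<And>X f p. X \<in> Obj C \<Longrightarrow> f \<in> mono_maps P (hom_poset C G X) \<Longrightarrow> p \<in> Field P \<Longrightarrow> \<phi> X f \<cdot> \<eta> p = f p"
    and "\<And>X f. X \<in> Obj C \<Longrightarrow> f \<in> mono_maps P (hom_poset C G X) \<Longrightarrow> \<phi> X f \<in> hom C T X"
proof -
  have TO: "T \<in> Obj C" using T unfolding tensor_def by blast
  have bij: "bij_betw (\<phi> X) (mono_maps P (hom_poset C G X)) (hom C T X)" if "X \<in> Obj C" for X
    using T that unfolding tensor_def by blast
  have le: "(\<phi> X f, \<phi> X g) \<in> Le C \<Longrightarrow> pointwise_le P (hom_poset C G X) f g"
    "pointwise_le P (hom_poset C G X) f g \<Longrightarrow> (\<phi> X f, \<phi> X g) \<in> Le C"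
    if "X \<in> Obj C" "f \<in> mono_maps P (hom_poset C G X)" "g \<in> mono_maps P (hom_poset C G X)" for X f g
    using T that bij[OF that(1)] unfolding tensor_def hom_poset_iff bij_betw_def by blast+
  show phi: "\<phi> X f \<in> hom C T X" if "X \<in> Obj C" "f \<in> mono_maps P (hom_poset C G X)" for X f
    using bij[OF that(1)] that(2) unfolding bij_betw_def by blast
  have eta: "\<eta> \<in> mono_maps P (hom_poset C G T)" "\<phi> T \<eta> = Idt C T"
    using bij[OF TO] id_hom[OF TO] f_the_inv_into_f[of "\<phi> T" "mono_maps P (hom_poset C G T)"
      "Idt C T"]
      the_inv_into_into[of "\<phi> T" "mono_maps P (hom_poset C G T)" "Idt C T", OF _ _ subset_refl]
    unfolding \<eta> bij_betw_def by blast+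
  have eta': "mono_rel P (hom_poset C G T) \<eta>" using eta mono_maps_iff by blast
  have mm: "(\<lambda>p\<in>Field P. h \<cdot> \<eta> p) \<in> mono_maps P (hom_poset C G X)" if "h \<in> hom C T X" for h X
    using mono_rel_restrict[OF mono_rel_comp[OF eta' that]] .
  have nat: "\<phi> X (\<lambda>p\<in>Field P. h \<cdot> \<eta> p) = h" if h: "h \<in> hom C T X" for h X
  proof -
    have "\<phi> X (\<lambda>p\<in>Field P. h \<cdot> \<eta> p) = h \<cdot> \<phi> T \<eta>"
      using T h eta(1) unfolding tensor_def by blast
    then show ?thesis using eta(2) comp_id_right[OF h] by simp
  qed
  show phi_eta: "\<phi> X f \<cdot> \<eta> p = f p"
    if X: "X \<in> Obj C" and f: "f \<in> mono_maps P (hom_poset C G X)" and p: "p \<in> Field P" for X f p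
  proof -
    have "(\<lambda>p\<in>Field P. \<phi> X f \<cdot> \<eta> p) = f"
      using nat[OF phi[OF X f]] mm[OF phi[OF X f]] f bij[OF X] unfolding bij_betw_def inj_on_def
        by blast
    then show ?thesis using p by (metis restrict_apply')
  qed
  show "tensor_arrow C P G T \<eta>"
    unfolding tensor_arrow_def
  proof (intro conjI ballI allI impI)
    show "T \<in> Obj C" "mono_rel P (hom_poset C G T) \<eta>" by fact+
  next
    fix X f assume X: "X \<in> Obj C" and f: "mono_rel P (hom_poset C G X) f"
    have r: "restrict f (Field P) \<in> mono_maps P (hom_poset C G X)" using mono_rel_restrict[OF f] .
    show "\<exists>h\<in>hom C T X. \<forall>p\<in>Field P. h \<cdot> \<eta> p = f p"
      using phi[OF X r] phi_eta[OF X r] by auto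
  next
    fix X h h' assume h: "h \<in> hom C T X" "h' \<in> hom C T X"
      and *: "\<forall>p\<in>Field P. (h \<cdot> \<eta> p, h' \<cdot> \<eta> p) \<in> Le C"
    have X: "X \<in> Obj C" using hom_objs h by blast
    have "h \<cdot> \<eta> p \<in> hom C G X" "h' \<cdot> \<eta> p \<in> hom C G X" if "p \<in> Field P" for p
      using mono_rel_Field[OF eta' that] comp_hom h by auto
    then have "pointwise_le P (hom_poset C G X) (\<lambda>p\<in>Field P. h \<cdot> \<eta> p) (\<lambda>p\<in>Field P. h' \<cdot> \<eta> p)"
      using * unfolding pointwise_le_def hom_poset_iff by simp
    then have "(\<phi> X (\<lambda>p\<in>Field P. h \<cdot> \<eta> p), \<phi> X (\<lambda>p\<in>Field P. h' \<cdot> \<eta> p)) \<in> Le C"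
      using le(2)[OF X mm[OF h(1)] mm[OF h(2)]] by blast
    then show "(h, h') \<in> Le C" using nat h by simp
  qed
qed

end

section \<open>Coinserters of posets and subeffective projectives\<close>

definition inserted :: "('z \<Rightarrow> 'x) \<Rightarrow> ('z \<Rightarrow> 'x) \<Rightarrow> 'z set \<Rightarrow> 'x rel" where
  "inserted u0 u1 Z = {(u0 z, u1 z) | z. z \<in> Z}"

text \<open>
  A coinserter of posets is, up to isomorphism, the quotient by the preorder that is generated by
  the order and the pairs \<open>S\<close> to be inserted.
\<close>

definition poset_coinserter :: "'x rel \<Rightarrow> 'y rel \<Rightarrow> 'x rel \<Rightarrow> ('x \<Rightarrow> 'y) \<Rightarrow> bool" where
  "poset_coinserter P Q S f \<longleftrightarrow> f ` Field P = Field Q \<and>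
     (\<forall>x\<in>Field P. \<forall>y\<in>Field P. (f x, f y) \<in> Q \<longleftrightarrow> (x, y) \<in> (P \<union> S)\<^sup>+)"

lemma Preorder_generated:
  assumes "Preorder P" "S \<subseteq> Field P \<times> Field P"
  shows "Preorder ((P \<union> S)\<^sup>+)" "Field ((P \<union> S)\<^sup>+) = Field P"
proof -
  have F: "Field (P \<union> S) = Field P" using assms(2) unfolding Field_def by blast
  show F': "Field ((P \<union> S)\<^sup>+) = Field P"
    unfolding Field_def trancl_domain trancl_range using F[unfolded Field_def] .
  show "Preorder ((P \<union> S)\<^sup>+)"
    unfolding Preorder_iff unfolding F' using preorder_refl[OF assms(1)]
      by (auto intro: trans_trancl)
qed

lemma mono_on_generated:
  assumes f: "mono_rel P Q f" and S: "\<And>x y. (x, y) \<in> S \<Longrightarrow> (f x, f y) \<in> Q" and Q: "Preorder Q"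
    and "(x, y) \<in> (P \<union> S)\<^sup>+"
  shows "(f x, f y) \<in> Q"
  using assms(4)
proof (induction rule: trancl_induct)
  case (base y)
  then show ?case using f S unfolding mono_rel_def by blast
next
  case (step y z)
  then have "(f y, f z) \<in> Q" using f S unfolding mono_rel_def by blast
  then show ?case using step preorder_trans[OF Q] by blast
qed

lemma pos_category_Pos: "pos_category (Pos U)"
  unfolding Pos_def
  by (rule pos_category_concrete)
    (auto simp: mono_maps_def compose_def Pi_def PiE_def partial_order_on_def preorder_refl
      intro: FieldI1 FieldI2)

lemma Pos_hom_iff:
  "a \<in> hom (Pos U) A B \<longleftrightarrow> Partial_order A \<and> small U (Field A) \<and> Partial_order B \<and> small U (Field B) \<and>
     (\<exists>f\<in>mono_maps A B. a = (A, B, f))"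
  unfolding Pos_def concrete_hom_iff by blast

lemma Pos_simps [simp]:
  "Obj (Pos U) = {P. Partial_order P \<and> small U (Field P)}"
  "Dom (Pos U) (A, B, f) = A" "Cod (Pos U) (A, B, f) = B"
  "Idt (Pos U) A = (A, A, \<lambda>x\<in>Field A. x)"
  "(B', D, g) \<cdot>\<^bsub>Pos U\<^esub> (A, B, f) = (A, D, compose (Field A) g f)"
  "((A, B, f), (A', B', g)) \<in> Le (Pos U) \<longleftrightarrow> A' = A \<and> B' = B \<and> pointwise_le A B f g"
  unfolding Pos_def by auto

lemma poset_coinserter_universal:
  assumes R: "(R, P, u0) \<in> hom (Pos U) R P" "(R, P, u1) \<in> hom (Pos U) R P"
    and f: "(P, Q, f) \<in> hom (Pos U) P Q"
    and c: "poset_coinserter P Q (inserted u0 u1 (Field R)) f"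
  shows "coinserter (Pos U) (R, P, u0) (R, P, u1) (P, Q, f)"
proof -
  interpret pos_category "Pos U" by (rule pos_category_Pos)
  define S where "S = inserted u0 u1 (Field R)"
  have P: "Preorder P" "Preorder Q"
    using f unfolding Pos_hom_iff partial_order_on_def by auto
  have u: "u0 z \<in> Field P" "u1 z \<in> Field P" if "z \<in> Field R" for z
    using R that unfolding Pos_hom_iff mono_maps_def by auto
  have fF: "f ` Field P = Field Q"
    and le: "\<And>x y. x \<in> Field P \<Longrightarrow> y \<in> Field P \<Longrightarrow> (f x, f y) \<in> Q \<longleftrightarrow> (x, y) \<in> (P \<union> S)\<^sup>+"
    using c unfolding poset_coinserter_def S_def by blast+
  define r where "r = inv_into (Field P) f"
  have r: "r y \<in> Field P" "f (r y) = y" if "y \<in> Field Q" for y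
    using that unfolding r_def fF[symmetric] by (auto simp: inv_into_into f_inv_into_f)
  show ?thesis
  proof (rule coinserterI[OF R f])
    have "(f (u0 z), f (u1 z)) \<in> Q" if "z \<in> Field R" for z
      using le[OF u[OF that]] that unfolding S_def inserted_def by blast
    then show "((P, Q, f) \<cdot>\<^bsub>Pos U\<^esub> (R, P, u0), (P, Q, f) \<cdot>\<^bsub>Pos U\<^esub> (R, P, u1)) \<in> Le (Pos U)"
      by (simp add: pointwise_le_def compose_def)
  next
    fix Z f' assume f': "f' \<in> hom (Pos U) P Z"
      and le': "(f' \<cdot>\<^bsub>Pos U\<^esub> (R, P, u0), f' \<cdot>\<^bsub>Pos U\<^esub> (R, P, u1)) \<in> Le (Pos U)"
    then obtain k where k: "f' = (P, Z, k)" "k \<in> mono_maps P Z" "Partial_order Z"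
      "small U (Field Z)"
      unfolding Pos_hom_iff by blast
    have Z: "Preorder Z" "antisym Z" using k(3) unfolding partial_order_on_def by auto
    have km: "mono_rel P Z k" "k \<in> extensional (Field P)" using k(2) mono_maps_iff by blast+
    have kS: "(k x, k y) \<in> Z" if "(x, y) \<in> S" for x y
      using le' that unfolding k(1) S_def inserted_def by (auto simp: pointwise_le_def compose_def)
    have kle: "(k x, k y) \<in> Z" if "x \<in> Field P" "y \<in> Field P" "(f x, f y) \<in> Q" for x y
      using mono_on_generated[OF km(1) kS Z(1)] le that by blast
    define g where "g = (\<lambda>y\<in>Field Q. k (r y))"
    have "mono_rel Q Z (\<lambda>y. k (r y))"
      unfolding mono_rel_def
    proof (intro allI impI)
      fix x y assume xy: "(x, y) \<in> Q"
      then have "x \<in> Field Q" "y \<in> Field Q" by (auto intro: FieldI1 FieldI2)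
      then show "(k (r x), k (r y)) \<in> Z" using kle r xy by simp
    qed
    then have "g \<in> mono_maps Q Z"
      unfolding g_def mono_maps_iff mono_rel_def by (auto intro: FieldI1 FieldI2)
    then have "(Q, Z, g) \<in> hom (Pos U) Q Z" using k f unfolding Pos_hom_iff by blast
    moreover have "k = compose (Field P) g f"
    proof (rule extensionalityI[OF km(2)])
      fix x assume x: "x \<in> Field P"
      then have fx: "f x \<in> Field Q" using fF by blast
      then have "(f x, f (r (f x))) \<in> Q" "(f (r (f x)), f x) \<in> Q"
        using r preorder_refl[OF P(2)] by simp_all
      then have "k x = k (r (f x))"
        using kle x r(1)[OF fx] Z(2) unfolding antisym_def by blast
      then show "k x = compose (Field P) g f x"
        using x fx unfolding g_def compose_def by simp
    qed simp
    ultimately show "\<exists>g\<in>hom (Pos U) Q Z. f' = g \<cdot>\<^bsub>Pos U\<^esub> (P, Q, f)"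
      using k(1) by (intro bexI[of _ "(Q, Z, g)"]) auto
  next
    fix Z g g' assume "g \<in> hom (Pos U) Q Z" "g' \<in> hom (Pos U) Q Z"
      and le': "(g \<cdot>\<^bsub>Pos U\<^esub> (P, Q, f), g' \<cdot>\<^bsub>Pos U\<^esub> (P, Q, f)) \<in> Le (Pos U)"
    then obtain k k' where k: "g = (Q, Z, k)" "g' = (Q, Z, k')"
      unfolding Pos_hom_iff by blast
    have "(k (f x), k' (f x)) \<in> Z" if "x \<in> Field P" for x
      using le' that unfolding k by (simp add: pointwise_le_def compose_def)
    then show "(g, g') \<in> Le (Pos U)"
      unfolding k by (simp add: pointwise_le_def flip: fF)
  qed
qed

text \<open>
  The generated preorder has a quotient on the type of \<open>P\<close> itself. It is a coinserter by
  \<open>poset_coinserter_universal\<close>, and so isomorphic to the given one.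
\<close>

lemma poset_coinserter_if_coinserter:
  assumes R: "(R, P, u0) \<in> hom (Pos U) R P" "(R, P, u1) \<in> hom (Pos U) R P"
    and f: "(P, Q, f) \<in> hom (Pos U) P (Q :: 'x rel)"
    and c: "coinserter (Pos U) (R, P, u0) (R, P, u1) (P, Q, f)"
  shows "poset_coinserter P Q (inserted u0 u1 (Field R)) f"
proof -
  interpret pos_category "Pos U :: ('x rel, _) poscat" by (rule pos_category_Pos)
  define S where "S = inserted u0 u1 (Field R)"
  have P: "Preorder P" using f unfolding Pos_hom_iff partial_order_on_def by auto
  have u: "u0 z \<in> Field P" "u1 z \<in> Field P" if "z \<in> Field R" for z
    using R that unfolding Pos_hom_iff mono_maps_def by auto
  have S: "S \<subseteq> Field P \<times> Field P" unfolding S_def inserted_def using u by blast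
  note R' = Preorder_generated[OF P S]
  obtain q :: "'x \<Rightarrow> 'x" and Q' where Q': "Partial_order Q'" "Field Q' = q ` Field P"
    and "\<forall>x\<in>Field P. \<forall>y\<in>Field P. (q x, q y) \<in> Q' \<longleftrightarrow> (x, y) \<in> (P \<union> S)\<^sup>+"
    using poset_quotient[OF R'(1), of id] unfolding R'(2) by (metis inj_on_id)
  then have le: "(q x, q y) \<in> Q' \<longleftrightarrow> (x, y) \<in> (P \<union> S)\<^sup>+" if "x \<in> Field P" "y \<in> Field P" for x y
    using that by blast
  define q' where "q' = restrict q (Field P)"
  have "mono_rel P Q' q"
    unfolding mono_rel_def
  proof (intro allI impI)
    fix x y assume "(x, y) \<in> P"
    then show "(q x, q y) \<in> Q'" using le[of x y] by (auto intro: FieldI1 FieldI2)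
  qed
  then have "q' \<in> mono_maps P Q'"
    unfolding q'_def mono_maps_iff mono_rel_def by (auto intro: FieldI1 FieldI2)
  then have q': "(P, Q', q') \<in> hom (Pos U) P Q'"
    using Q' f small_image[of U "Field P" q] unfolding Pos_hom_iff by simp
  have "poset_coinserter P Q' (inserted u0 u1 (Field R)) q'"
    unfolding poset_coinserter_def q'_def using Q'(2) le S_def by simp
  note cq = poset_coinserter_universal[OF R q' this]
  obtain g g' where gg: "g \<in> hom (Pos U) Q' Q" "g' \<in> hom (Pos U) Q Q'"
    "(P, Q, f) = g \<cdot>\<^bsub>Pos U\<^esub> (P, Q', q')" "(P, Q', q') = g' \<cdot>\<^bsub>Pos U\<^esub> (P, Q, f)"
      "g \<cdot>\<^bsub>Pos U\<^esub> g' = Idt (Pos U) Q"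
    using coinserter_unique[OF c f cq q'] .
  then obtain k k' where k: "g = (Q', Q, k)" "g' = (Q, Q', k')" "k \<in> mono_maps Q' Q"
    "k' \<in> mono_maps Q Q'"
    unfolding Pos_hom_iff by blast
  have fk: "f x = k (q x)" "q x = k' (f x)" if "x \<in> Field P" for x
    using gg(3,4) that unfolding k q'_def by (auto simp: compose_def fun_eq_iff split: if_splits)
  have kk: "k (k' y) = y" if "y \<in> Field Q" for y
    using gg(5) that unfolding k by (auto simp: compose_def fun_eq_iff split: if_splits)
  have kmono: "(k x, k y) \<in> Q" if "(x, y) \<in> Q'" for x y
    using k(3) that unfolding mono_maps_def by blast
  have k'mono: "(k' x, k' y) \<in> Q'" if "(x, y) \<in> Q" for x y
    using k(4) that unfolding mono_maps_def by blast
  have "f ` Field P = Field Q"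
  proof
    show "f ` Field P \<subseteq> Field Q" using f unfolding Pos_hom_iff mono_maps_def by auto
    show "Field Q \<subseteq> f ` Field P"
    proof
      fix y assume y: "y \<in> Field Q"
      then have "k' y \<in> q ` Field P" using k(4) Q'(2) unfolding mono_maps_def by auto
      then show "y \<in> f ` Field P" using kk[OF y] fk(1) by force
    qed
  qed
  moreover have "(f x, f y) \<in> Q \<longleftrightarrow> (x, y) \<in> (P \<union> S)\<^sup>+" if "x \<in> Field P" "y \<in> Field P" for x y
    using le[OF that] fk[OF that(1)] fk[OF that(2)] kmono k'mono by metis
  ultimately show ?thesis unfolding poset_coinserter_def S_def by blast
qed

text \<open>
  The elementary meaning of a subeffective projective: points form small sets, and on points
  coinserters of reflexive pairs are surjective and order two points only if a chain of inserted
  pairs and inequalities forces it.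
\<close>

lemma (in pos_category) subeffective_projective_iff:
  "subeffective_projective U C G \<longleftrightarrow> G \<in> Obj C \<and> (\<forall>X\<in>Obj C. small U (hom C G X)) \<and>
     (\<forall>Z X Y u0 u1 f. u0 \<in> hom C Z X \<and> u1 \<in> hom C Z X \<and> f \<in> hom C X Y \<and>
        reflexive_pair C u0 u1 \<and> coinserter C u0 u1 f \<longrightarrow>
        poset_coinserter (hom_poset C G X) (hom_poset C G Y)
          (inserted (\<lambda>z. u0 \<cdot> z) (\<lambda>z. u1 \<cdot> z) (hom C G Z)) (\<lambda>x. f \<cdot> x))"
  (is "?L \<longleftrightarrow> ?R")
proof -
  have DC: "Dom C h = X" "Cod C h = Y" if "h \<in> hom C X Y" for h X Y
    using that unfolding hom_def by auto
  have map: "hom_functor_map C G h = (hom_poset C G X, hom_poset C G Y, \<lambda>f\<in>hom C G X. h \<cdot> f)"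
    if "h \<in> hom C X Y" for h X Y
    unfolding hom_functor_map_def DC[OF that] ..
  have hm: "hom_functor_map C G h \<in> hom (Pos U) (hom_poset C G X) (hom_poset C G Y)"
    if "\<forall>X\<in>Obj C. small U (hom C G X)" "h \<in> hom C X Y" for h X Y
  proof -
    have "mono_rel (hom_poset C G X) (hom_poset C G Y) (\<lambda>f. h \<cdot> f)"
      using that(2) comp_hom comp_le_right unfolding mono_rel_def hom_poset_iff by blast
    from mono_rel_restrict[OF this] show ?thesis
      unfolding map[OF that(2)] Pos_hom_iff
      using that(1) hom_objs[OF that(2)] Partial_order_hom_poset by auto
  qed
  have ins: "inserted (\<lambda>f\<in>hom C G Z. u0 \<cdot> f) (\<lambda>f\<in>hom C G Z. u1 \<cdot> f) (hom C G Z) =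
    inserted (\<lambda>z. u0 \<cdot> z) (\<lambda>z. u1 \<cdot> z) (hom C G Z)" for Z u0 u1
    unfolding inserted_def by (auto simp: restrict_def)
  have pc: "poset_coinserter (hom_poset C G X) Q S (\<lambda>x\<in>hom C G X. f \<cdot> x) \<longleftrightarrow>
    poset_coinserter (hom_poset C G X) Q S (\<lambda>x. f \<cdot> x)" for X Q S f
    unfolding poset_coinserter_def by auto
  have iff: "coinserter (Pos U) (hom_functor_map C G u0) (hom_functor_map C G u1) (hom_functor_map C
    G f) \<longleftrightarrow>
      poset_coinserter (hom_poset C G X) (hom_poset C G Y)
          (inserted (\<lambda>z. u0 \<cdot> z) (\<lambda>z. u1 \<cdot> z) (hom C G Z)) (\<lambda>x. f \<cdot> x)"
    if s: "\<forall>X\<in>Obj C. small U (hom C G X)" and u: "u0 \<in> hom C Z X" "u1 \<in> hom C Z X" "f \<in> hom C X Y"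
      for Z X Y u0 u1 f
    using poset_coinserter_universal[OF hm[OF s u(1), unfolded map[OF u(1)]] hm[OF s u(2), unfolded
      map[OF u(2)]]
       hm[OF s u(3), unfolded map[OF u(3)]]]
     poset_coinserter_if_coinserter[OF hm[OF s u(1), unfolded map[OF u(1)]] hm[OF s u(2), unfolded
       map[OF u(2)]]
       hm[OF s u(3), unfolded map[OF u(3)]]]
    unfolding map[OF u(1)] map[OF u(2)] map[OF u(3)] Field_hom_poset ins pc by blast
  show ?thesis
  proof
    assume L: ?L
    then have s: "\<forall>X\<in>Obj C. small U (hom C G X)"
      unfolding subeffective_projective_def pos_functor_def by auto
    then show ?R
      using L iff[OF s] unfolding subeffective_projective_def preserves_reflexive_coinserters_def
      by blast
  next
    assume R: ?R
    then have s: "\<forall>X\<in>Obj C. small U (hom C G X)" by blast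
    have "pos_functor C (Pos U) (hom_poset C G) (hom_functor_map C G)"
      unfolding pos_functor_def
    proof (intro conjI ballI allI impI)
      fix X assume X: "X \<in> Obj C"
      show "hom_poset C G X \<in> Obj (Pos U)" using s X Partial_order_hom_poset by simp
      show "hom_functor_map C G (Idt C X) = Idt (Pos U) (hom_poset C G X)"
        unfolding map[OF id_hom[OF X]] using comp_id_left by (auto simp: fun_eq_iff)
    next
      fix X Y f assume "f \<in> hom C X Y"
      then show "hom_functor_map C G f \<in> hom (Pos U) (hom_poset C G X) (hom_poset C G Y)"
        by (rule hm[OF s])
    next
      fix X Y Z f g assume "f \<in> hom C X Y \<and> g \<in> hom C Y Z"
      then have f: "f \<in> hom C X Y" and g: "g \<in> hom C Y Z" by auto
      show "hom_functor_map C G (g \<cdot> f) = hom_functor_map C G g \<cdot>\<^bsub>Pos U\<^esub> hom_functor_map C G f"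
        unfolding map[OF f] map[OF g] map[OF comp_hom[OF f g]]
        using comp_assoc[OF _ f g] comp_hom[OF _ f] by (auto simp: compose_def fun_eq_iff)
    next
      fix X Y f g assume "(f, g) \<in> hom_poset C X Y"
      then have f: "f \<in> hom C X Y" and g: "g \<in> hom C X Y" and le: "(f, g) \<in> Le C"
        unfolding hom_poset_iff by auto
      show "(hom_functor_map C G f, hom_functor_map C G g) \<in> hom_poset (Pos U) (hom_poset C G X)
        (hom_poset C G Y)"
        unfolding hom_poset_iff using hm[OF s f] hm[OF s g] comp_le_left[OF le _ f g]
          comp_hom[OF _ f] comp_hom[OF _ g]
        unfolding map[OF f] map[OF g] by (simp add: pointwise_le_def hom_poset_iff)
    qed
    moreover have "preserves_reflexive_coinserters C (Pos U) (hom_functor_map C G)"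
      unfolding preserves_reflexive_coinserters_def
    proof (intro allI impI)
      fix u0 u1 f assume *: "reflexive_pair C u0 u1 \<and> coinserter C u0 u1 f"
      then obtain Z X Y where u: "u0 \<in> hom C Z X" "u1 \<in> hom C Z X" "f \<in> hom C X Y"
        using coinserterE by blast
      show "coinserter (Pos U) (hom_functor_map C G u0) (hom_functor_map C G u1) (hom_functor_map C
        G f)"
        using iff[OF s u] R u * by blast
    qed
    ultimately show ?L unfolding subeffective_projective_def using R by blast
  qed
qed

section \<open>Models of inequations and free algebras\<close>

definition models :: "'u itself \<Rightarrow> 's signature \<Rightarrow> ('s trm \<times> 's trm) set \<Rightarrow> ('s, 'c) oalg set" where
  "models U \<Sigma> E =
     {A. ordered_algebra \<Sigma> A \<and> small U (carr A) \<and> (\<forall>(s, t)\<in>E. satisfies A s t)}"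

abbreviation inequations :: "'s signature \<Rightarrow> ('s trm \<times> 's trm) set \<Rightarrow> bool" where
  "inequations \<Sigma> E \<equiv> \<forall>(s, t)\<in>E. is_term \<Sigma> s \<and> is_term \<Sigma> t"

lemma model_ordered: "A \<in> models U \<Sigma> E \<Longrightarrow> ordered_algebra \<Sigma> A"
  unfolding models_def by blast

lemma model_preordered: "A \<in> models U \<Sigma> E \<Longrightarrow> preordered_algebra \<Sigma> A"
  unfolding models_def by (auto simp: ordered_algebra_iff)

lemma model_Preorder: "A \<in> models U \<Sigma> E \<Longrightarrow> Preorder (ord A)"
  by (rule alg_preorder[OF model_preordered])

lemma model_antisym: "A \<in> models U \<Sigma> E \<Longrightarrow> antisym (ord A)"
  unfolding models_def by (auto simp: ordered_algebra_iff)

lemma model_small: "A \<in> models U \<Sigma> E \<Longrightarrow> small U (carr A)"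
  unfolding models_def by blast

lemma model_eqI: "A \<in> models U \<Sigma> E \<Longrightarrow> (x, y) \<in> ord A \<Longrightarrow> (y, x) \<in> ord A \<Longrightarrow> x = y"
  using model_antisym unfolding antisym_def by blast

lemma models_image:
  assumes E: "inequations \<Sigma> E" and A: "preordered_algebra \<Sigma> A" "\<forall>(s, t)\<in>E. satisfies A s t"
    and q: "oalg_hom \<Sigma> A B q" "carr B = q ` carr A" and B: "ordered_algebra \<Sigma> B" "small U (carr B)"
  shows "B \<in> models U \<Sigma> E"
  using satisfies_image[OF A(1) _ _ q] A(2) B E unfolding models_def by fast

definition oalg_iso :: "'s signature \<Rightarrow> ('s, 'x) oalg \<Rightarrow> ('s, 'y) oalg \<Rightarrow> ('x \<Rightarrow> 'y) \<Rightarrow> bool" where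
  "oalg_iso \<Sigma> A B i \<longleftrightarrow> oalg_hom \<Sigma> A B i \<and> i ` carr A = carr B \<and>
     (\<forall>x\<in>carr A. \<forall>y\<in>carr A. (i x, i y) \<in> ord B \<longrightarrow> (x, y) \<in> ord A)"

lemma oalg_iso_comp:
  assumes "oalg_iso \<Sigma> A B i" "oalg_iso \<Sigma> B C j"
  shows "oalg_iso \<Sigma> A C (j \<circ> i)"
proof -
  have "(j \<circ> i) ` carr A = carr C" using assms unfolding oalg_iso_def by (metis image_comp)
  moreover have "i x \<in> carr B" if "x \<in> carr A" for x
    using assms(1) that unfolding oalg_iso_def by blast
  ultimately show ?thesis
    using assms oalg_hom_comp unfolding oalg_iso_def comp_apply by metis
qed

lemma oalg_iso_inverse:
  assumes A: "ordered_algebra \<Sigma> A" and B: "ordered_algebra \<Sigma> B" and i: "oalg_iso \<Sigma> A B i"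
  obtains j where "oalg_iso \<Sigma> B A j" "\<forall>x\<in>carr A. j (i x) = x" "\<forall>y\<in>carr B. i (j y) = y"
proof -
  have i': "oalg_hom \<Sigma> A B i" "carr B = i ` carr A"
    "\<And>x y. x \<in> carr A \<Longrightarrow> y \<in> carr A \<Longrightarrow> (i x, i y) \<in> ord B \<Longrightarrow> (x, y) \<in> ord A"
    using i unfolding oalg_iso_def by auto
  obtain j where j: "oalg_hom \<Sigma> B A j" "\<forall>x\<in>carr A. j (i x) = x"
    using oalg_hom_factor[OF ordered_is_preordered[OF A] i'(1) oalg_hom_id i'(2) _ i'(3)]
      A alg_preorder[OF ordered_is_preordered[OF B]] unfolding ordered_algebra_iff by blast
  have ij: "\<forall>y\<in>carr B. i (j y) = y" using j(2) i'(2) by auto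
  have "j ` carr B = carr A" using j(2) i'(2) by force
  moreover have "(x, y) \<in> ord B" if "x \<in> carr B" "y \<in> carr B" "(j x, j y) \<in> ord A" for x y
    using oalg_hom_mono[OF i'(1) that(3)] ij that by simp
  ultimately have "oalg_iso \<Sigma> B A j" unfolding oalg_iso_def using j(1) by blast
  then show ?thesis using j(2) ij by (rule that)
qed

text \<open>
  The universal property is required only for targets in the universe, together with generation by
  the image of \<open>P\<close>. Generation yields uniqueness and order reflection without a further
  quantification over homomorphisms.
\<close>

definition free_on ::
    "'u itself \<Rightarrow> 's signature \<Rightarrow> ('s trm \<times> 's trm) set \<Rightarrow> 'p rel \<Rightarrow> ('s, 'u) oalg \<Rightarrow> ('p \<Rightarrow> 'u) \<Rightarrow> bool"
      where
  "free_on U \<Sigma> E P A \<eta> \<longleftrightarrow> A \<in> models U \<Sigma> E \<and> mono_rel P (ord A) \<eta> \<and>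
     (\<forall>x\<in>carr A. \<exists>t\<in>tms \<Sigma> (Field P). x = eval_tm A \<eta> t) \<and>
     (\<forall>B\<in>models U \<Sigma> E. \<forall>f :: 'p \<Rightarrow> 'u. mono_rel P (ord B) f \<longrightarrow>
        (\<exists>h. oalg_hom \<Sigma> A B h \<and> (\<forall>p\<in>Field P. h (\<eta> p) = f p)))"

text \<open>
  A term is put below another if its value is below in every model under every monotone valuation
  of its variables. With this preorder evaluation is a monotone homomorphism by definition, which
  makes the quotient of the term algebra a model as well as free.
\<close>

lemma free_algebra_exists:
  fixes U :: "'u itself" and \<Sigma> :: "'s signature" and P :: "'p rel"
  assumes U: "universe U" and S: "small_signature U \<Sigma>" and E: "inequations \<Sigma> E"
    and P: "Preorder P" "small U (Field P)"
  shows "\<exists>A \<eta>. free_on U \<Sigma> E P A \<eta>"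
proof -
  define T where "T = tms \<Sigma> (Field P)"
  define TA :: "('s, ('s, 'p) tm) oalg" where
    "TA = \<lparr>ord = {(s, t). s \<in> T \<and> t \<in> T \<and> (\<forall>B\<in>models U \<Sigma> E. \<forall>f :: 'p \<Rightarrow> 'u. mono_rel P (ord B) f \<longrightarrow>
              (eval_tm B f s, eval_tm B f t) \<in> ord B)},
            opn = \<lambda>n \<sigma> ts. TOp \<sigma> ts\<rparr>"
  have ord: "(s, t) \<in> ord TA \<longleftrightarrow> s \<in> T \<and> t \<in> T \<and>
      (\<forall>B\<in>models U \<Sigma> E. \<forall>f :: 'p \<Rightarrow> 'u. mono_rel P (ord B) f \<longrightarrow> (eval_tm B f s, eval_tm B f t) \<in> ord
        B)" for s t
    unfolding TA_def by simp
  have opn [simp]: "opn TA n \<sigma> ts = TOp \<sigma> ts" for n \<sigma> ts unfolding TA_def by simp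
  have cl: "eval_tm B f t \<in> carr B"
    if "t \<in> T" "B \<in> models U \<Sigma> E" "mono_rel P (ord B) f" for B and f :: "'p \<Rightarrow> 'u" and t
    using eval_tm_closed[OF model_preordered[OF that(2)] that(1)[unfolded T_def]]
      mono_rel_Field[OF that(3)]
    by blast
  have refl: "(t, t) \<in> ord TA" if "t \<in> T" for t
    unfolding ord using that by (intro conjI ballI allI impI preorder_refl[OF model_Preorder] cl)
  have carr: "carr TA = T"
  proof
    show "carr TA \<subseteq> T" using ord unfolding Field_def by blast
    show "T \<subseteq> carr TA" using refl by (blast intro: FieldI1)
  qed
  have PTA: "Preorder (ord TA)"
    unfolding Preorder_iff unfolding carr
  proof
    show "trans (ord TA)"
    proof (rule transI)
      fix a b c assume "(a, b) \<in> ord TA" "(b, c) \<in> ord TA"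
      then show "(a, c) \<in> ord TA"
        unfolding ord by (meson preorder_trans[OF model_Preorder])
    qed
  qed (use refl in blast)
  have "preordered_algebra \<Sigma> TA"
    unfolding preordered_algebra_def
  proof (intro conjI allI ballI impI)
    fix n \<sigma> assume s: "\<sigma> \<in> \<Sigma> n"
    { fix xs assume "xs \<in> lists (carr TA)" "length xs = n"
      then show "opn TA n \<sigma> xs \<in> carr TA"
        unfolding carr using s by (auto simp: T_def lists_eq_set) }
    fix xs ys assume *: "length xs = n \<and> list_all2 (\<lambda>x y. (x, y) \<in> ord TA) xs ys"
    then have l: "length ys = n" using list_all2_lengthD by fastforce
    have xy: "(xs ! i, ys ! i) \<in> ord TA" if "i < n" for i
      using * that unfolding list_all2_conv_all_nth by blast
    then have "xs ! i \<in> T \<and> ys ! i \<in> T" if "i < n" for i using that ord by blast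
    then have "set xs \<subseteq> T \<and> set ys \<subseteq> T" using * l unfolding set_conv_nth by auto
    moreover have "(eval_tm B f (TOp \<sigma> xs), eval_tm B f (TOp \<sigma> ys)) \<in> ord B"
      if B: "B \<in> models U \<Sigma> E" and f: "mono_rel P (ord B) f" for B and f :: "'p \<Rightarrow> 'u"
    proof -
      have "list_all2 (\<lambda>x y. (x, y) \<in> ord B) (map (eval_tm B f) xs) (map (eval_tm B f) ys)"
        unfolding list_all2_conv_all_nth using xy * l B f ord by simp
      then show ?thesis
        using opn_mono[OF model_preordered[OF B], of \<sigma> "map (eval_tm B f) xs"
          "map (eval_tm B f) ys"] s * l
        by simp
    qed
    ultimately show "(opn TA n \<sigma> xs, opn TA n \<sigma> ys) \<in> ord TA"
      unfolding ord opn using s * l by (simp add: T_def)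
  qed (rule PTA)
  note TA = this
  have ev: "oalg_hom \<Sigma> TA B (eval_tm B f)"
    if B: "B \<in> models U \<Sigma> E" and f: "mono_rel P (ord B) f" for B and f :: "'p \<Rightarrow> 'u"
    unfolding oalg_hom_def mono_rel_def using B f ord by auto
  have sat: "satisfies TA s t" if st: "(s, t) \<in> E" for s t
  proof (rule satisfies_if_jointly_reflecting[OF TA])
    show "is_term \<Sigma> s" "is_term \<Sigma> t" using E st by auto
    fix x y assume "x \<in> carr TA" "y \<in> carr TA"
      and *: "\<And>(B :: ('s, 'u) oalg) f. oalg_hom \<Sigma> TA B f \<Longrightarrow> satisfies B s t \<Longrightarrow> (f x, f y) \<in> ord B"
    moreover have "(eval_tm B f x, eval_tm B f y) \<in> ord B"
      if "B \<in> models U \<Sigma> E" "mono_rel P (ord B) f" for B and f :: "'p \<Rightarrow> 'u"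
      using *[OF ev[OF that]] that(1) st unfolding models_def by blast
    ultimately show "(x, y) \<in> ord TA" unfolding ord carr by blast
  qed
  obtain A :: "('s, 'u) oalg" and q where A: "ordered_algebra \<Sigma> A" "small U (carr A)"
    "carr A = q ` carr TA" "oalg_hom \<Sigma> TA A q"
    and le: "\<forall>x\<in>carr TA. \<forall>y\<in>carr TA. (q x, q y) \<in> ord A \<longleftrightarrow> (x, y) \<in> ord TA"
    using preordered_algebra_quotient[OF TA, of U] small_tms[OF U S P(2)] unfolding carr T_def
      by metis
  have AM: "A \<in> models U \<Sigma> E"
    using models_image[OF E TA _ A(4,3,1,2)] sat by blast
  define \<eta> where "\<eta> p = q (TVar p)" for p
  have "mono_rel P (ord A) \<eta>"
    unfolding mono_rel_def
  proof (intro allI impI)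
    fix x y assume xy: "(x, y) \<in> P"
    then have "(TVar x, TVar y) \<in> ord TA"
      unfolding ord T_def by (auto simp: mono_rel_def intro: FieldI1 FieldI2)
    then show "(\<eta> x, \<eta> y) \<in> ord A" unfolding \<eta>_def by (rule oalg_hom_mono[OF A(4)])
  qed
  moreover have "q t = eval_tm A \<eta> t" if "t \<in> T" for t
  proof -
    have "eval_tm TA TVar t = t" for t :: "('s, 'p) tm"
      by (induction t) (simp_all add: map_idI)
    moreover have "TVar ` Field P \<subseteq> carr TA" unfolding carr T_def by auto
    ultimately show ?thesis
      using hom_eval_tm[OF TA A(4) that[unfolded T_def], of TVar] unfolding \<eta>_def by simp
  qed
  then have "\<forall>x\<in>carr A. \<exists>t\<in>tms \<Sigma> (Field P). x = eval_tm A \<eta> t"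
    unfolding A(3) carr T_def by blast
  moreover have "\<exists>h. oalg_hom \<Sigma> A B h \<and> (\<forall>p\<in>Field P. h (\<eta> p) = f p)"
    if B: "B \<in> models U \<Sigma> E" and f: "mono_rel P (ord B) f" for B and f :: "'p \<Rightarrow> 'u"
  proof -
    have "(eval_tm B f x, eval_tm B f y) \<in> ord B"
      if "x \<in> carr TA" "y \<in> carr TA" "(q x, q y) \<in> ord A" for x y
    proof -
      have "(x, y) \<in> ord TA" using that le by blast
      then show ?thesis using B f unfolding ord by blast
    qed
    then obtain h where h: "oalg_hom \<Sigma> A B h" "\<forall>x\<in>carr TA. h (q x) = eval_tm B f x"
      using oalg_hom_factor[OF TA A(4) ev[OF B f] A(3) model_antisym[OF B] _ model_Preorder[OF AM]]
        by blast
    have "h (\<eta> p) = f p" if "p \<in> Field P" for p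
      using h(2) that unfolding \<eta>_def carr T_def by simp
    then show ?thesis using h(1) by blast
  qed
  ultimately have "free_on U \<Sigma> E P A \<eta>"
    unfolding free_on_def using AM by blast
  then show ?thesis by blast
qed

section \<open>Categories represented by algebras\<close>

abbreviation model_cat ::
    "'u itself \<Rightarrow> 's signature \<Rightarrow> ('s trm \<times> 's trm) set \<Rightarrow>
      (('s, 'u) oalg, ('s, 'u) oalg \<times> ('s, 'u) oalg \<times> ('u \<Rightarrow> 'u)) poscat" where
  "model_cat U \<Sigma> E \<equiv> concrete_cat (models U \<Sigma> E) ord (alg_homs \<Sigma>)"

lemma variety_iff:
  "variety (V :: (('u, 'u) oalg, _) poscat) \<longleftrightarrow>
     (\<exists>\<Sigma> E. small_signature TYPE('u) \<Sigma> \<and> inequations \<Sigma> E \<and> V = model_cat TYPE('u) \<Sigma> E)"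
proof -
  have "{A :: ('u, 'u) oalg. ordered_algebra \<Sigma> A \<and> small TYPE('u) (carr A)} \<inter>
    {A. \<forall>(s, t)\<in>E. satisfies A s t} =
      models TYPE('u) \<Sigma> E" for \<Sigma> :: "'u signature" and E
    unfolding models_def by blast
  then show ?thesis
    unfolding variety_def Alg_def full_subcategory_concrete by simp
qed

lemma hom_model_cat:
  "a \<in> hom (model_cat U \<Sigma> E) A B \<longleftrightarrow> A \<in> models U \<Sigma> E \<and> B \<in> models U \<Sigma> E \<and>
     (\<exists>f. oalg_hom \<Sigma> A B f \<and> f \<in> extensional (carr A) \<and> a = (A, B, f))"
  unfolding concrete_hom_iff using alg_homs_iff[OF model_Preorder] by blast

lemma restrict_hom_model_cat:
  assumes "A \<in> models U \<Sigma> E" "B \<in> models U \<Sigma> E" "oalg_hom \<Sigma> A B f"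
  shows "(A, B, restrict f (carr A)) \<in> hom (model_cat U \<Sigma> E) A B"
  unfolding hom_model_cat
  using assms oalg_hom_cong[OF model_preordered[OF assms(1)] _ assms(3), of "restrict f (carr A)"]
    by auto

lemma pos_category_models:
  fixes U :: "'u itself" and \<Sigma> :: "'s signature"
  shows "pos_category (model_cat U \<Sigma> E)"
proof (rule pos_category_concrete)
  fix A :: "('s, 'u) oalg" assume A: "A \<in> models U \<Sigma> E"
  show "Partial_order (ord A)"
    using model_ordered[OF A] unfolding ordered_algebra_def by blast
  show "(\<lambda>x\<in>carr A. x) \<in> alg_homs \<Sigma> A A"
    using oalg_hom_cong[OF model_preordered[OF A] _ oalg_hom_id, of "\<lambda>x\<in>carr A. x"]
    unfolding alg_homs_iff[OF model_Preorder[OF A]] by auto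
  fix B :: "('s, 'u) oalg" assume B: "B \<in> models U \<Sigma> E"
  show "alg_homs \<Sigma> A B \<subseteq> mono_maps (ord A) (ord B)" unfolding alg_homs_def by blast
  fix D :: "('s, 'u) oalg" and f g assume "D \<in> models U \<Sigma> E" "f \<in> alg_homs \<Sigma> A B"
    "g \<in> alg_homs \<Sigma> B D"
  then have "oalg_hom \<Sigma> A D (g \<circ> f)"
    using oalg_hom_comp unfolding alg_homs_iff[OF model_Preorder[OF A]]
      alg_homs_iff[OF model_Preorder[OF B]] by blast
  then show "compose (carr A) g f \<in> alg_homs \<Sigma> A D"
    using oalg_hom_cong[OF model_preordered[OF A], of "g \<circ> f" "compose (carr A) g f"]
    unfolding alg_homs_iff[OF model_Preorder[OF A]] by (simp add: compose_def)
qed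

text \<open>
  An equivalence of \<open>K\<close> with the models of \<open>E\<close>, spelled out: \<open>alg\<close> and \<open>m\<close> are the functor on
  objects and morphisms. The carriers have an arbitrary type \<open>'c\<close>, since the natural carrier of
  the algebra of an object may be a set of morphisms of \<open>K\<close>; only the models on \<open>'u\<close> have to be
  represented.
\<close>

locale represented = pos_category K for K :: "('o, 'a) poscat" (structure) +
  fixes U :: "'u itself" and \<Sigma> :: "'s signature" and E :: "('s trm \<times> 's trm) set"
    and alg :: "'o \<Rightarrow> ('s, 'c) oalg" and m :: "'a \<Rightarrow> 'c \<Rightarrow> 'c"
  assumes alg_model: "X \<in> Obj K \<Longrightarrow> alg X \<in> models U \<Sigma> E"
    and m_hom: "h \<in> hom K X Y \<Longrightarrow> oalg_hom \<Sigma> (alg X) (alg Y) (m h)"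
    and m_id: "X \<in> Obj K \<Longrightarrow> x \<in> carr (alg X) \<Longrightarrow> m (Idt K X) x = x"
    and m_comp: "h \<in> hom K X Y \<Longrightarrow> k \<in> hom K Y Z \<Longrightarrow> x \<in> carr (alg X) \<Longrightarrow> m (k \<cdot> h) x = m k (m h x)"
    and m_le: "h \<in> hom K X Y \<Longrightarrow> h' \<in> hom K X Y \<Longrightarrow>
          (h, h') \<in> Le K \<longleftrightarrow> (\<forall>x\<in>carr (alg X). (m h x, m h' x) \<in> ord (alg Y))"
    and m_full: "X \<in> Obj K \<Longrightarrow> Y \<in> Obj K \<Longrightarrow> oalg_hom \<Sigma> (alg X) (alg Y) f \<Longrightarrow>
          \<exists>h\<in>hom K X Y. \<forall>x\<in>carr (alg X). m h x = f x"
    and ess_surj: "\<And>A :: ('s, 'u) oalg. A \<in> models U \<Sigma> E \<Longrightarrow> \<exists>X\<in>Obj K. \<exists>i. oalg_iso \<Sigma> A (alg X) i"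

lemma iso_model_catD:
  assumes "iso (model_cat U \<Sigma> E) A B a"
  shows "\<exists>i. oalg_iso \<Sigma> A B i"
proof -
  obtain b where ab: "a \<in> hom (model_cat U \<Sigma> E) A B" "b \<in> hom (model_cat U \<Sigma> E) B A"
    "b \<cdot>\<^bsub>model_cat U \<Sigma> E\<^esub> a = Idt (model_cat U \<Sigma> E) A"
      "a \<cdot>\<^bsub>model_cat U \<Sigma> E\<^esub> b = Idt (model_cat U \<Sigma> E) B"
    using assms unfolding iso_def by blast
  then obtain f g where f: "oalg_hom \<Sigma> A B f" "a = (A, B, f)" and g: "oalg_hom \<Sigma> B A g"
    "b = (B, A, g)"
    unfolding hom_model_cat by blast
  have gf: "g (f x) = x" if "x \<in> carr A" for x
    using ab(3) that unfolding f g by (auto simp: compose_def fun_eq_iff split: if_splits)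
  have fg: "f (g x) = x" if "x \<in> carr B" for x
    using ab(4) that unfolding f g by (auto simp: compose_def fun_eq_iff split: if_splits)
  have "f ` carr A = carr B"
    using oalg_hom_carr[OF f(1)] oalg_hom_carr[OF g(1)] fg by force
  moreover have "(x, y) \<in> ord A" if "x \<in> carr A" "y \<in> carr A" "(f x, f y) \<in> ord B" for x y
    using oalg_hom_mono[OF g(1) that(3)] gf that by simp
  ultimately show ?thesis unfolding oalg_iso_def using f(1) by blast
qed

lemma iso_model_catI:
  assumes A: "A \<in> models U \<Sigma> E" and B: "B \<in> models U \<Sigma> E" and i: "oalg_iso \<Sigma> A B i"
  shows "\<exists>a. iso (model_cat U \<Sigma> E) A B a"
proof -
  obtain j where j: "oalg_iso \<Sigma> B A j" "\<forall>x\<in>carr A. j (i x) = x" "\<forall>y\<in>carr B. i (j y) = y"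
    using oalg_iso_inverse[OF model_ordered[OF A] model_ordered[OF B] i] .
  have ij: "oalg_hom \<Sigma> A B i" "oalg_hom \<Sigma> B A j" using i j(1) unfolding oalg_iso_def by auto
  note r = restrict_hom_model_cat[OF A B ij(1)] restrict_hom_model_cat[OF B A ij(2)]
  have "iso (model_cat U \<Sigma> E) A B (A, B, restrict i (carr A))"
    unfolding iso_def using r j(2,3) oalg_hom_carr[OF ij(1)] oalg_hom_carr[OF ij(2)]
    by (intro conjI bexI[of _ "(B, A, restrict j (carr B))"]) (auto simp: compose_def fun_eq_iff)
  then show ?thesis by blast
qed

theorem represented_if_equivalent:
  fixes U :: "'u itself" and \<Sigma> :: "'s signature" and E :: "('s trm \<times> 's trm) set"
  assumes K: "pos_category K" and "equivalent K (model_cat U \<Sigma> E)"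
  shows "\<exists>alg m. represented K U \<Sigma> E (alg :: _ \<Rightarrow> ('s, 'u) oalg) m"
proof -
  interpret K: pos_category K by (rule K)
  let ?V = "model_cat U \<Sigma> E"
  obtain Fo Fa where F: "full_order_embedding K ?V Fo Fa"
    and es: "\<forall>Z\<in>Obj ?V. \<exists>X\<in>Obj K. \<exists>i. iso ?V (Fo X) Z i"
    using full_order_embedding_if_equivalent[OF K pos_category_models assms(2)] .
  have FF: "pos_functor K ?V Fo Fa" using F unfolding full_order_embedding_def by blast
  define m where "m h = snd (snd (Fa h))" for h
  have Fa: "Fa h = (Fo X, Fo Y, m h)" "oalg_hom \<Sigma> (Fo X) (Fo Y) (m h)"
    "m h \<in> extensional (carr (Fo X))"
    if "h \<in> hom K X Y" for h X Y
    using functor_hom[OF FF that] unfolding hom_model_cat m_def by auto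
  have Fo: "Fo X \<in> models U \<Sigma> E" if "X \<in> Obj K" for X using functor_obj[OF FF that] by simp
  have "represented K U \<Sigma> E Fo m"
  proof (unfold_locales)
    fix X assume X: "X \<in> Obj K"
    show "Fo X \<in> models U \<Sigma> E" using Fo[OF X] .
    fix x assume "x \<in> carr (Fo X)"
    then show "m (Idt K X) x = x"
      using functor_id[OF FF X] Fa(1)[OF K.id_hom[OF X]] by simp
  next
    fix h X Y assume "h \<in> hom K X Y"
    then show "oalg_hom \<Sigma> (Fo X) (Fo Y) (m h)" by (rule Fa)
  next
    fix h X Y k Z x assume h: "h \<in> hom K X Y" and k: "k \<in> hom K Y Z" and x: "x \<in> carr (Fo X)"
    show "m (k \<cdot>\<^bsub>K\<^esub> h) x = m k (m h x)"
      using functor_comp[OF FF h k] Fa(1)[OF h] Fa(1)[OF k] Fa(1)[OF K.comp_hom[OF h k]] x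
      by (simp add: compose_def)
  next
    fix h X Y h' assume h: "h \<in> hom K X Y" "h' \<in> hom K X Y"
    have "(h, h') \<in> Le K \<longleftrightarrow> (Fa h, Fa h') \<in> Le ?V"
      using functor_le[OF FF h] F h unfolding full_order_embedding_def by blast
    then show "(h, h') \<in> Le K \<longleftrightarrow> (\<forall>x\<in>carr (Fo X). (m h x, m h' x) \<in> ord (Fo Y))"
      using Fa(1)[OF h(1)] Fa(1)[OF h(2)] by (simp add: pointwise_le_def)
  next
    fix X Y f assume X: "X \<in> Obj K" "Y \<in> Obj K" and f: "oalg_hom \<Sigma> (Fo X) (Fo Y) f"
    from restrict_hom_model_cat[OF Fo[OF X(1)] Fo[OF X(2)] f]
    obtain h where h: "h \<in> hom K X Y" "Fa h = (Fo X, Fo Y, restrict f (carr (Fo X)))"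
      using F X unfolding full_order_embedding_def by blast
    then have "m h = restrict f (carr (Fo X))" unfolding m_def by simp
    then show "\<exists>h\<in>hom K X Y. \<forall>x\<in>carr (Fo X). m h x = f x"
      using h(1) by (intro bexI[of _ h]) simp_all
  next
    fix A :: "('s, 'u) oalg" assume A: "A \<in> models U \<Sigma> E"
    then obtain X i where X: "X \<in> Obj K" "iso ?V (Fo X) A i" using es by auto
    obtain j where j: "oalg_iso \<Sigma> (Fo X) A j" using iso_model_catD[OF X(2)] by blast
    obtain k where "oalg_iso \<Sigma> A (Fo X) k"
      using oalg_iso_inverse[OF model_ordered[OF Fo[OF X(1)]] model_ordered[OF A] j] .
    then show "\<exists>X\<in>Obj K. \<exists>i. oalg_iso \<Sigma> A (Fo X) i" using X(1) by blast
  qed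
  then show ?thesis by blast
qed

text \<open>
  Each \<open>alg X\<close> is small, so it has an isomorphic copy \<open>B X\<close> in the universe; \<open>q\<close> and \<open>r\<close> are the
  mutually inverse isomorphisms.
\<close>

theorem (in represented) equivalent_models:
  assumes E: "inequations \<Sigma> E"
  shows "equivalent K (model_cat U \<Sigma> E)"
proof -
  let ?V = "model_cat U \<Sigma> E"
  have "\<forall>X\<in>Obj K. \<exists>(B :: ('s, 'u) oalg) q r. B \<in> models U \<Sigma> E \<and> oalg_iso \<Sigma> (alg X) B q \<and> oalg_iso \<Sigma>
    B (alg X) r \<and>
     (\<forall>x\<in>carr (alg X). r (q x) = x) \<and> (\<forall>y\<in>carr B. q (r y) = y)"
  proof
    fix X assume "X \<in> Obj K"
    note A = alg_model[OF this]
    obtain B :: "('s, 'u) oalg" and q where B: "ordered_algebra \<Sigma> B" "small U (carr B)"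
      "carr B = q ` carr (alg X)" "oalg_hom \<Sigma> (alg X) B q"
      "\<forall>x\<in>carr (alg X). \<forall>y\<in>carr (alg X). (q x, q y) \<in> ord B \<longleftrightarrow> (x, y) \<in> ord (alg X)"
      using preordered_algebra_quotient[OF model_preordered[OF A] model_small[OF A]] by metis
    have "B \<in> models U \<Sigma> E"
      using models_image[OF E model_preordered[OF A] _ B(4,3,1,2)] A unfolding models_def by blast
    moreover have q: "oalg_iso \<Sigma> (alg X) B q" unfolding oalg_iso_def using B(3-5) by auto
    ultimately show "\<exists>(B :: ('s, 'u) oalg) q r. B \<in> models U \<Sigma> E \<and> oalg_iso \<Sigma> (alg X) B q \<and>
       oalg_iso \<Sigma> B (alg X) r \<and> (\<forall>x\<in>carr (alg X). r (q x) = x) \<and> (\<forall>y\<in>carr B. q (r y) = y)"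
      using oalg_iso_inverse[OF model_ordered[OF A] B(1) q] by metis
  qed
  then obtain B :: "'o \<Rightarrow> ('s, 'u) oalg" and q r where B: "\<forall>X\<in>Obj K. B X \<in> models U \<Sigma> E \<and>
     oalg_iso \<Sigma> (alg X) (B X) (q X) \<and> oalg_iso \<Sigma> (B X) (alg X) (r X) \<and>
     (\<forall>x\<in>carr (alg X). r X (q X x) = x) \<and> (\<forall>y\<in>carr (B X). q X (r X y) = y)"
    by metis
  have BM: "B X \<in> models U \<Sigma> E" and qi: "oalg_iso \<Sigma> (alg X) (B X) (q X)"
    and qh: "oalg_hom \<Sigma> (alg X) (B X) (q X)" and rh: "oalg_hom \<Sigma> (B X) (alg X) (r X)"
    if "X \<in> Obj K" for X
    using B that unfolding oalg_iso_def by blast+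
  have rq: "r X (q X x) = x" if "X \<in> Obj K" "x \<in> carr (alg X)" for X x using B that by blast
  have qr: "q X (r X y) = y" if "X \<in> Obj K" "y \<in> carr (B X)" for X y using B that by blast
  have qc: "q X x \<in> carr (B X)" if "X \<in> Obj K" "x \<in> carr (alg X)" for X x
    using oalg_hom_carr[OF qh] that by blast
  have rc: "r X x \<in> carr (alg X)" if "X \<in> Obj K" "x \<in> carr (B X)" for X x
    using oalg_hom_carr[OF rh] that by blast
  define f where "f h X Y = (\<lambda>y\<in>carr (B X). q Y (m h (r X y)))" for h X Y
  define Fa where "Fa h = (B (Dom K h), B (Cod K h), f h (Dom K h) (Cod K h))" for h
  have Fa: "Fa h = (B X, B Y, f h X Y)" if "h \<in> hom K X Y" for h X Y
    using that unfolding Fa_def hom_def by auto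
  have fhom: "oalg_hom \<Sigma> (B X) (B Y) (\<lambda>y. q Y (m h (r X y)))" if "h \<in> hom K X Y" for h X Y
    using oalg_hom_comp[OF oalg_hom_comp[OF rh m_hom[OF that]] qh] hom_objs[OF that]
      by (simp add: comp_def)
  have Fahom: "Fa h \<in> hom ?V (B X) (B Y)" if "h \<in> hom K X Y" for h X Y
    unfolding Fa[OF that] f_def using restrict_hom_model_cat[OF BM BM fhom] hom_objs[OF that] that
      by blast
  have mc: "m h x \<in> carr (alg Y)" if "h \<in> hom K X Y" "x \<in> carr (alg X)" for h X Y x
    using oalg_hom_carr[OF m_hom] that by blast
  have Fale: "(Fa h, Fa h') \<in> Le ?V \<longleftrightarrow> (h, h') \<in> Le K" if h: "h \<in> hom K X Y" "h' \<in> hom K X Y"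
    for h h' X Y
  proof -
    have o: "X \<in> Obj K" "Y \<in> Obj K" using hom_objs h by auto
    have "(Fa h, Fa h') \<in> Le ?V \<longleftrightarrow> (\<forall>y\<in>carr (B X). (q Y (m h (r X y)), q Y (m h' (r X y))) \<in> ord
      (B Y))"
      unfolding Fa[OF h(1)] Fa[OF h(2)] f_def by (simp add: pointwise_le_def)
    also have "\<dots> \<longleftrightarrow> (\<forall>x\<in>carr (alg X). (q Y (m h x), q Y (m h' x)) \<in> ord (B Y))"
      using rc[OF o(1)] qc[OF o(1)] rq[OF o(1)] by metis
    also have "\<dots> \<longleftrightarrow> (\<forall>x\<in>carr (alg X). (m h x, m h' x) \<in> ord (alg Y))"
      using qi[OF o(2)] oalg_hom_mono[OF qh[OF o(2)]] mc[OF h(1)] mc[OF h(2)] unfolding oalg_iso_def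
        by blast
    also have "\<dots> \<longleftrightarrow> (h, h') \<in> Le K" using m_le[OF h] by simp
    finally show ?thesis .
  qed
  have "pos_functor K ?V B Fa"
    unfolding pos_functor_def
  proof (intro conjI ballI allI impI)
    fix X assume X: "X \<in> Obj K"
    show "B X \<in> Obj ?V" using BM[OF X] by simp
    show "Fa (Idt K X) = Idt ?V (B X)"
      unfolding Fa[OF id_hom[OF X]] f_def using m_id[OF X] rc[OF X] qr[OF X]
        by (auto simp: fun_eq_iff)
  next
    fix X Y Z h k assume "h \<in> hom K X Y \<and> k \<in> hom K Y Z"
    then have h: "h \<in> hom K X Y" and k: "k \<in> hom K Y Z" by auto
    have o: "X \<in> Obj K" "Y \<in> Obj K" using hom_objs h by auto
    have "q Z (m (k \<cdot> h) (r X y)) = q Z (m k (r Y (q Y (m h (r X y)))))" if "y \<in> carr (B X)" for y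
      using m_comp[OF h k] rq[OF o(2)] mc[OF h] rc[OF o(1) that] by simp
    moreover have "q Y (m h (r X y)) \<in> carr (B Y)" if "y \<in> carr (B X)" for y
      using qc[OF o(2)] mc[OF h] rc[OF o(1) that] by blast
    ultimately show "Fa (k \<cdot> h) = Fa k \<cdot>\<^bsub>?V\<^esub> Fa h"
      unfolding Fa[OF h] Fa[OF k] Fa[OF comp_hom[OF h k]]
        by (auto simp: f_def compose_def fun_eq_iff)
  next
    fix X Y h h' assume "(h, h') \<in> hom_poset K X Y"
    then show "(Fa h, Fa h') \<in> hom_poset ?V (B X) (B Y)"
      unfolding hom_poset_iff using Fahom Fale by blast
  qed (rule Fahom)
  moreover have "\<exists>h\<in>hom K X Y. Fa h = b" if X: "X \<in> Obj K" "Y \<in> Obj K"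
    and b: "b \<in> hom ?V (B X) (B Y)" for X Y b
  proof -
    obtain g where g: "oalg_hom \<Sigma> (B X) (B Y) g" "g \<in> extensional (carr (B X))" "b = (B X, B Y, g)"
      using b unfolding hom_model_cat by blast
    have "oalg_hom \<Sigma> (alg X) (alg Y) (r Y \<circ> g \<circ> q X)"
      using oalg_hom_comp[OF qh[OF X(1)] oalg_hom_comp[OF g(1) rh[OF X(2)]]]
        by (simp add: comp_assoc)
    then obtain h where h: "h \<in> hom K X Y" "\<forall>x\<in>carr (alg X). m h x = r Y (g (q X x))"
      using m_full[OF X] by fastforce
    have "q Y (m h (r X y)) = g y" if y: "y \<in> carr (B X)" for y
      using h(2) rc[OF X(1) y] qr[OF X(1) y] qr[OF X(2)] oalg_hom_carr[OF g(1) y] by simp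
    then have "f h X Y = g"
      unfolding f_def using g(2) by (auto simp: fun_eq_iff extensional_def)
    then show ?thesis using h(1) Fa[OF h(1)] g(3) by blast
  qed
  ultimately have "full_order_embedding K ?V B Fa"
    unfolding full_order_embedding_def using Fale by blast
  moreover have "\<exists>X\<in>Obj K. \<exists>i. iso ?V (B X) Z i" if "Z \<in> Obj ?V" for Z
  proof -
    have Z: "Z \<in> models U \<Sigma> E" using that by simp
    obtain X i where X: "X \<in> Obj K" and i: "oalg_iso \<Sigma> Z (alg X) i" using ess_surj[OF Z] by blast
    obtain j where "oalg_iso \<Sigma> (B X) Z j"
      using oalg_iso_inverse[OF model_ordered[OF Z] model_ordered[OF BM[OF X]] oalg_iso_comp[OF i
        qi[OF X]]] .
    then show ?thesis using iso_model_catI[OF BM[OF X] Z] X by blast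
  qed
  ultimately show ?thesis
    using equivalent_if_full_order_embedding[OF pos_category_axioms pos_category_models] by blast
qed

section \<open>Coinserters in a category represented by algebras\<close>

text \<open>
  The subalgebra of \<open>A \<times> A\<close> consisting of the pairs that \<open>f\<close> puts in order, the comma object of
  \<open>f\<close> with itself.
\<close>

definition kernel_algebra :: "('s, 'x) oalg \<Rightarrow> ('s, 'y) oalg \<Rightarrow> ('x \<Rightarrow> 'y) \<Rightarrow> ('s, 'x \<times> 'x) oalg" where
  "kernel_algebra A B f =
     \<lparr>ord = {((s, t), (s', t')). (f s, f t) \<in> ord B \<and> (f s', f t') \<in> ord B \<and>
               (s, s') \<in> ord A \<and> (t, t') \<in> ord A},
      opn = \<lambda>n \<sigma> xs. (opn A n \<sigma> (map fst xs), opn A n \<sigma> (map snd xs))\<rparr>"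

lemma carr_kernel_algebra:
  assumes "preordered_algebra \<Sigma> A"
  shows "carr (kernel_algebra A B f) = {(s, t). s \<in> carr A \<and> t \<in> carr A \<and> (f s, f t) \<in> ord B}"
proof
  show "carr (kernel_algebra A B f) \<subseteq> {(s, t). s \<in> carr A \<and> t \<in> carr A \<and> (f s, f t) \<in> ord B}"
    unfolding kernel_algebra_def by (auto simp: Field_def)
  have "((s, t), (s, t)) \<in> ord (kernel_algebra A B f)"
    if "s \<in> carr A" "t \<in> carr A" "(f s, f t) \<in> ord B" for s t
    unfolding kernel_algebra_def using that preorder_refl[OF alg_preorder[OF assms]] by simp
  then show "{(s, t). s \<in> carr A \<and> t \<in> carr A \<and> (f s, f t) \<in> ord B} \<subseteq> carr (kernel_algebra A B f)"
    by (auto intro: FieldI1)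
qed

lemma kernel_algebra_projections:
  assumes A: "preordered_algebra \<Sigma> A"
  shows "oalg_hom \<Sigma> (kernel_algebra A B f) A fst" "oalg_hom \<Sigma> (kernel_algebra A B f) A snd"
  unfolding oalg_hom_def mono_rel_def by (auto simp: kernel_algebra_def)

lemma preordered_kernel_algebra:
  assumes A: "preordered_algebra \<Sigma> A" and B: "preordered_algebra \<Sigma> B" and f: "oalg_hom \<Sigma> A B f"
  shows "preordered_algebra \<Sigma> (kernel_algebra A B f)"
proof -
  let ?K = "kernel_algebra A B f"
  note carr = carr_kernel_algebra[OF A, of B f]
  have cl: "(f (opn A (length xs) \<sigma> (map fst xs)), f (opn A (length xs) \<sigma> (map snd xs))) \<in> ord B"
    "opn A (length xs) \<sigma> (map fst xs) \<in> carr A" "opn A (length xs) \<sigma> (map snd xs) \<in> carr A"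
    if s: "\<sigma> \<in> \<Sigma> (length xs)" and xs: "set xs \<subseteq> carr ?K" for \<sigma> xs
  proof -
    have 1: "set (map fst xs) \<subseteq> carr A" "set (map snd xs) \<subseteq> carr A"
      using xs unfolding carr by auto
    then show "opn A (length xs) \<sigma> (map fst xs) \<in> carr A"
      "opn A (length xs) \<sigma> (map snd xs) \<in> carr A"
      using opn_closed[OF A, of \<sigma> "map fst xs"] opn_closed[OF A, of \<sigma> "map snd xs"] s by auto
    have "(f (fst (xs ! i)), f (snd (xs ! i))) \<in> ord B" if "i < length xs" for i
      using xs nth_mem[OF that] unfolding carr by auto
    then have "list_all2 (\<lambda>x y. (x, y) \<in> ord B) (map f (map fst xs)) (map f (map snd xs))"
      unfolding list_all2_conv_all_nth by simp
    then show "(f (opn A (length xs) \<sigma> (map fst xs)), f (opn A (length xs) \<sigma> (map snd xs))) \<in> ord B"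
      using opn_mono[OF B, of \<sigma> "map f (map fst xs)"] s 1
        oalg_hom_opn[OF f, of \<sigma> "map fst xs"] oalg_hom_opn[OF f, of \<sigma> "map snd xs"] by simp
  qed
  show ?thesis
    unfolding preordered_algebra_def
  proof (intro conjI allI ballI impI)
    show "Preorder (ord ?K)"
      unfolding Preorder_iff
    proof
      show "\<forall>x\<in>carr ?K. (x, x) \<in> ord ?K"
        unfolding carr using preorder_refl[OF alg_preorder[OF A]] by (auto simp: kernel_algebra_def)
      show "trans (ord ?K)"
        unfolding trans_def using preorder_trans[OF alg_preorder[OF A]]
        by (auto simp: kernel_algebra_def)
    qed
    fix n \<sigma> assume s: "\<sigma> \<in> \<Sigma> n"
    { fix xs assume "xs \<in> lists (carr ?K)" "length xs = n"
      then show "opn ?K n \<sigma> xs \<in> carr ?K"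
        using cl[of \<sigma> xs] s unfolding carr by (auto simp: kernel_algebra_def lists_eq_set) }
    fix xs ys assume *: "length xs = n \<and> list_all2 (\<lambda>x y. (x, y) \<in> ord ?K) xs ys"
    then have l: "length ys = n" and xy: "\<And>i. i < n \<Longrightarrow> (xs ! i, ys ! i) \<in> ord ?K"
      unfolding list_all2_conv_all_nth by auto
    then have c: "set xs \<subseteq> carr ?K" "set ys \<subseteq> carr ?K"
      using * list_all2_Field by blast+
    have "(fst (xs ! i), fst (ys ! i)) \<in> ord A \<and> (snd (xs ! i), snd (ys ! i)) \<in> ord A" if "i < n"
      for i
      using xy[OF that] unfolding kernel_algebra_def by auto
    then have "list_all2 (\<lambda>x y. (x, y) \<in> ord A) (map fst xs) (map fst ys)"
      "list_all2 (\<lambda>x y. (x, y) \<in> ord A) (map snd xs) (map snd ys)"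
      unfolding list_all2_conv_all_nth using * l by auto
    then show "(opn ?K n \<sigma> xs, opn ?K n \<sigma> ys) \<in> ord ?K"
      using cl(1)[of \<sigma> xs] cl(1)[of \<sigma> ys] c s * l
        opn_mono[OF A, of \<sigma> "map fst xs"] opn_mono[OF A, of \<sigma> "map snd xs"]
      by (simp add: kernel_algebra_def)
  qed
qed

text \<open>
  This is where reflexivity of the pair enters. In one coordinate at a time, a step of the
  generated preorder is a step of the order or a pair from \<open>S\<close>; as \<open>S\<close> contains the diagonal and
  is closed under the operations, the step carries over to the value of the operation.
\<close>

lemma preordered_algebra_generated:
  assumes A: "preordered_algebra \<Sigma> A" and S: "S \<subseteq> carr A \<times> carr A"
    and diag: "\<And>x. x \<in> carr A \<Longrightarrow> (x, x) \<in> S"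
    and S_op: "\<And>\<sigma> xs ys. \<sigma> \<in> \<Sigma> (length xs) \<Longrightarrow> list_all2 (\<lambda>x y. (x, y) \<in> S) xs ys \<Longrightarrow>
      (opn A (length xs) \<sigma> xs, opn A (length xs) \<sigma> ys) \<in> S"
  shows "preordered_algebra \<Sigma> (A\<lparr>ord := (ord A \<union> S)\<^sup>+\<rparr>)"
proof -
  let ?R = "(ord A \<union> S)\<^sup>+"
  note R = Preorder_generated[OF alg_preorder[OF A] S]
  have refl: "list_all2 (\<lambda>x y. (x, y) \<in> ord A) ps ps" "list_all2 (\<lambda>x y. (x, y) \<in> S) ps ps"
    if "set ps \<subseteq> carr A" for ps
    using that diag preorder_refl[OF alg_preorder[OF A]] by (auto simp: list_all2_same)
  have step: "(opn A n \<sigma> (ps @ x # zs), opn A n \<sigma> (ps @ y # zs)) \<in> ?R"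
    if n: "Suc (length ps + length zs) = n" and s: "\<sigma> \<in> \<Sigma> n" and ps: "set ps \<union> set zs \<subseteq> carr A"
      and xy: "(x, y) \<in> ?R" for n \<sigma> ps zs x y
    using xy
  proof (induction rule: trancl_induct)
    case (base y)
    have "(opn A n \<sigma> (ps @ x # zs), opn A n \<sigma> (ps @ y # zs)) \<in> ord A \<union> S"
      using base opn_mono[OF A, of \<sigma> "ps @ x # zs" "ps @ y # zs"] S_op[of \<sigma> "ps @ x # zs"
        "ps @ y # zs"] refl ps n s
      by (auto simp: list_all2_appendI)
    then show ?case by blast
  next
    case (step y z)
    have "(opn A n \<sigma> (ps @ y # zs), opn A n \<sigma> (ps @ z # zs)) \<in> ord A \<union> S"
      using step(2) opn_mono[OF A, of \<sigma> "ps @ y # zs" "ps @ z # zs"] S_op[of \<sigma> "ps @ y # zs"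
        "ps @ z # zs"] refl ps n s
      by (auto simp: list_all2_appendI)
    then show ?case using step(3) by (rule trancl_into_trancl[rotated])
  qed
  show ?thesis
    unfolding preordered_algebra_def
  proof (intro conjI allI ballI impI)
    fix n \<sigma> assume s: "\<sigma> \<in> \<Sigma> n"
    { fix xs assume "xs \<in> lists (carr (A\<lparr>ord := ?R\<rparr>))" "length xs = n"
      then show "opn (A\<lparr>ord := ?R\<rparr>) n \<sigma> xs \<in> carr (A\<lparr>ord := ?R\<rparr>)"
        using opn_closed[OF A, of \<sigma> xs] s R(2) by (auto simp: lists_eq_set) }
    fix xs ys assume *: "length xs = n \<and> list_all2 (\<lambda>x y. (x, y) \<in> ord (A\<lparr>ord := ?R\<rparr>)) xs ys"
    have "(opn A n \<sigma> xs, opn A n \<sigma> ys) \<in> ?R"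
    proof (rule opn_mono_if_coordinatewise[where n = n])
      show "Preorder ?R" using R by simp
      show "opn A n \<sigma> xs \<in> Field ?R" if "length xs = n" "set xs \<subseteq> Field ?R" for xs
        using opn_closed[OF A, of \<sigma> xs] that s unfolding R(2) by simp
    qed (use * step s R(2) in auto)
    then show "(opn (A\<lparr>ord := ?R\<rparr>) n \<sigma> xs, opn (A\<lparr>ord := ?R\<rparr>) n \<sigma> ys) \<in> ord (A\<lparr>ord := ?R\<rparr>)" by simp
  qed (use R in simp)
qed

locale algebraic = represented K U \<Sigma> E alg m
  for K :: "('o, 'a) poscat" (structure) and U :: "'u itself" and \<Sigma> :: "'s signature" and E
    and alg :: "'o \<Rightarrow> ('s, 'u) oalg" and m :: "'a \<Rightarrow> 'u \<Rightarrow> 'u" +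
  assumes universe: "universe U" and small_sig: "small_signature U \<Sigma>" and ineqs: "inequations \<Sigma> E"
begin

lemmas alg_preordered = model_preordered[OF alg_model]
lemmas alg_Preorder = model_Preorder[OF alg_model]

lemma m_carr: "h \<in> hom K X Y \<Longrightarrow> x \<in> carr (alg X) \<Longrightarrow> m h x \<in> carr (alg Y)"
  using oalg_hom_carr[OF m_hom] .

lemma m_mono: "h \<in> hom K X Y \<Longrightarrow> (x, y) \<in> ord (alg X) \<Longrightarrow> (m h x, m h y) \<in> ord (alg Y)"
  using oalg_hom_mono[OF m_hom] .

lemma m_eqI:
  assumes h: "h \<in> hom K X Y" "h' \<in> hom K X Y" and eq: "\<And>x. x \<in> carr (alg X) \<Longrightarrow> m h x = m h' x"
  shows "h = h'"
proof -
  have "(m h' x, m h' x) \<in> ord (alg Y)" if "x \<in> carr (alg X)" for x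
    using preorder_refl[OF alg_Preorder] m_carr[OF h(2) that] hom_objs[OF h(1)] by blast
  then have "(h, h') \<in> Le K" "(h', h) \<in> Le K" using m_le[OF h] m_le[OF h(2,1)] eq by auto
  then show ?thesis using le_antisym h by blast
qed

text \<open>
  A factor through a surjective homomorphism is again a homomorphism, so a coinserter of
  underlying posets is a coinserter of algebras.
\<close>

lemma coinserter_if_poset_coinserter:
  assumes u: "u0 \<in> hom K Z X" "u1 \<in> hom K Z X" and f: "f \<in> hom K X Y"
    and c: "poset_coinserter (ord (alg X)) (ord (alg Y)) (inserted (m u0) (m u1) (carr (alg Z)))
      (m f)"
  shows "coinserter K u0 u1 f"
proof -
  define S where "S = inserted (m u0) (m u1) (carr (alg Z))"
  have o: "X \<in> Obj K" "Y \<in> Obj K" "Z \<in> Obj K" using hom_objs u f by auto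
  have sur: "carr (alg Y) = m f ` carr (alg X)"
    and le: "\<And>x y. x \<in> carr (alg X) \<Longrightarrow> y \<in> carr (alg X) \<Longrightarrow> (m f x, m f y) \<in> ord (alg Y)
      \<longleftrightarrow> (x, y) \<in> (ord (alg X) \<union> S)\<^sup>+"
    using c unfolding poset_coinserter_def S_def by blast+
  show ?thesis
  proof (rule coinserterI[OF u f])
    have "(m f (m u0 z), m f (m u1 z)) \<in> ord (alg Y)" if "z \<in> carr (alg Z)" for z
      using le[OF m_carr[OF u(1) that] m_carr[OF u(2) that]] that unfolding S_def inserted_def
        by blast
    then show "(f \<cdot> u0, f \<cdot> u1) \<in> Le K"
      using m_le[OF comp_hom[OF u(1) f] comp_hom[OF u(2) f]] m_comp[OF u(1) f] m_comp[OF u(2) f]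
        by simp
  next
    fix W f' assume f': "f' \<in> hom K X W" and le': "(f' \<cdot> u0, f' \<cdot> u1) \<in> Le K"
    have W: "W \<in> Obj K" using hom_objs[OF f'] by blast
    have S: "(m f' x, m f' y) \<in> ord (alg W)" if "(x, y) \<in> S" for x y
      using le' that m_le[OF comp_hom[OF u(1) f'] comp_hom[OF u(2) f']] m_comp[OF u(1) f']
        m_comp[OF u(2) f']
      unfolding S_def inserted_def by auto
    have "mono_rel (ord (alg X)) (ord (alg W)) (m f')" using m_hom[OF f'] unfolding oalg_hom_def
      by blast
    note gen = mono_on_generated[OF this S alg_Preorder[OF W]]
    obtain g where g: "oalg_hom \<Sigma> (alg Y) (alg W) g" "\<forall>x\<in>carr (alg X). g (m f x) = m f' x"
      using oalg_hom_factor[OF alg_preordered[OF o(1)] m_hom[OF f] m_hom[OF f'] sur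
        model_antisym[OF alg_model[OF W]] _ alg_Preorder[OF o(2)]]
        le gen by blast
    obtain k where k: "k \<in> hom K Y W" "\<forall>y\<in>carr (alg Y). m k y = g y" using m_full[OF o(2) W g(1)]
      by blast
    have "f' = k \<cdot> f"
      using g(2) k(2) m_carr[OF f] m_comp[OF f k(1)]
        by (intro m_eqI[OF f' comp_hom[OF f k(1)]]) simp
    then show "\<exists>g\<in>hom K Y W. f' = g \<cdot> f" using k(1) by blast
  next
    fix W g g' assume g: "g \<in> hom K Y W" "g' \<in> hom K Y W" and "(g \<cdot> f, g' \<cdot> f) \<in> Le K"
    then have "\<forall>x\<in>carr (alg X). (m g (m f x), m g' (m f x)) \<in> ord (alg W)"
      using m_le[OF comp_hom[OF f g(1)] comp_hom[OF f g(2)]] m_comp[OF f g(1)] m_comp[OF f g(2)]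
        by simp
    then show "(g, g') \<in> Le K" using m_le[OF g] sur by auto
  qed
qed

text \<open>
  Constructions of algebras enter \<open>K\<close> in this way: the quotient of a preordered algebra is a
  model, and \<open>K\<close> represents all models in the universe.
\<close>

lemma quotient_object:
  fixes A :: "('s, 'x) oalg"
  assumes A: "preordered_algebra \<Sigma> A" "small U (carr A)" "\<forall>(s, t)\<in>E. satisfies A s t"
  obtains X e where "X \<in> Obj K" "oalg_hom \<Sigma> A (alg X) e" "carr (alg X) = e ` carr A"
    "\<forall>x\<in>carr A. \<forall>y\<in>carr A. (e x, e y) \<in> ord (alg X) \<longleftrightarrow> (x, y) \<in> ord A"
proof -
  obtain B :: "('s, 'u) oalg" and q where B: "ordered_algebra \<Sigma> B" "small U (carr B)"
    "carr B = q ` carr A" "oalg_hom \<Sigma> A B q"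
    and le: "\<forall>x\<in>carr A. \<forall>y\<in>carr A. (q x, q y) \<in> ord B \<longleftrightarrow> (x, y) \<in> ord A"
    using preordered_algebra_quotient[OF A(1,2)] .
  have BM: "B \<in> models U \<Sigma> E" using models_image[OF ineqs A(1,3) B(4,3,1,2)] .
  obtain X i where X: "X \<in> Obj K" and i: "oalg_iso \<Sigma> B (alg X) i" using ess_surj[OF BM] by blast
  have ih: "oalg_hom \<Sigma> B (alg X) i" "carr (alg X) = i ` carr B"
    and ile: "\<And>x y. x \<in> carr B \<Longrightarrow> y \<in> carr B \<Longrightarrow> (i x, i y) \<in> ord (alg X) \<Longrightarrow> (x, y) \<in> ord B"
    using i unfolding oalg_iso_def by auto
  have qc: "q x \<in> carr B" if "x \<in> carr A" for x using that B(3) by blast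
  have "\<forall>x\<in>carr A. \<forall>y\<in>carr A. ((i \<circ> q) x, (i \<circ> q) y) \<in> ord (alg X) \<longleftrightarrow> (x, y) \<in> ord A"
    using le ile qc oalg_hom_mono[OF ih(1)] by (metis comp_apply)
  moreover have "carr (alg X) = (i \<circ> q) ` carr A" using ih(2) B(3) by (simp add: image_comp)
  ultimately show ?thesis using X oalg_hom_comp[OF B(4) ih(1)] by (intro that)
qed

text \<open>
  A surjection \<open>c\<close> is the coinserter of the two projections of its kernel algebra, as the order of
  its codomain is exactly what these projections insert.
\<close>

lemma surjective_subregular_epi:
  assumes c: "c \<in> hom K T X" and sur: "carr (alg X) = m c ` carr (alg T)"
  shows "subregular_epi K c"
proof -
  have o: "T \<in> Obj K" "X \<in> Obj K" using hom_objs c by auto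
  let ?A = "kernel_algebra (alg T) (alg X) (m c)"
  note T = alg_preordered[OF o(1)]
  note A = preordered_kernel_algebra[OF T alg_preordered[OF o(2)] m_hom[OF c]]
  note carr = carr_kernel_algebra[OF T, of "alg X" "m c"]
  note pr = kernel_algebra_projections[OF T, of "alg X" "m c"]
  have "carr ?A \<subseteq> carr (alg T) \<times> carr (alg T)" unfolding carr by blast
  then have "small U (carr ?A)"
    using small_subset small_Times[OF universe] model_small[OF alg_model[OF o(1)]] by blast
  moreover have "\<forall>(s, t)\<in>E. satisfies ?A s t"
  proof -
    have "satisfies ?A s t" if st: "(s, t) \<in> E" for s t
    proof (rule satisfies_if_jointly_reflecting[OF A])
      show "is_term \<Sigma> s" "is_term \<Sigma> t" using ineqs st by auto
      fix x y assume x: "x \<in> carr ?A" "y \<in> carr ?A"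
        and *: "\<And>(B :: ('s, 'u) oalg) f. oalg_hom \<Sigma> ?A B f \<Longrightarrow> satisfies B s t \<Longrightarrow> (f x, f y) \<in> ord B"
      have "satisfies (alg T) s t" using alg_model[OF o(1)] st unfolding models_def by blast
      then have "(fst x, fst y) \<in> ord (alg T)" "(snd x, snd y) \<in> ord (alg T)" using * pr by blast+
      then show "(x, y) \<in> ord ?A" using x unfolding carr by (auto simp: kernel_algebra_def)
    qed
    then show ?thesis by blast
  qed
  ultimately obtain Z e where Z: "Z \<in> Obj K" and e: "oalg_hom \<Sigma> ?A (alg Z) e"
    "carr (alg Z) = e ` carr ?A"
    and le: "\<forall>x\<in>carr ?A. \<forall>y\<in>carr ?A. (e x, e y) \<in> ord (alg Z) \<longleftrightarrow> (x, y) \<in> ord ?A"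
    by (rule quotient_object[OF A])
  have proj: "\<exists>u\<in>hom K Z T. \<forall>x\<in>carr ?A. m u (e x) = p x" if p: "oalg_hom \<Sigma> ?A (alg T) p" for p
  proof -
    have "(p x, p y) \<in> ord (alg T)" if "x \<in> carr ?A" "y \<in> carr ?A" "(e x, e y) \<in> ord (alg Z)"
      for x y
      using that le oalg_hom_mono[OF p] by blast
    then obtain g where g: "oalg_hom \<Sigma> (alg Z) (alg T) g" "\<forall>x\<in>carr ?A. g (e x) = p x"
      using oalg_hom_factor[OF A e(1) p e(2) model_antisym[OF alg_model[OF o(1)]] _
        alg_Preorder[OF Z]] by blast
    obtain u where "u \<in> hom K Z T" "\<forall>z\<in>carr (alg Z). m u z = g z" using m_full[OF Z o(1) g(1)]
      by blast
    then show ?thesis using g(2) e(2) by auto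
  qed
  obtain u0 u1 where u: "u0 \<in> hom K Z T" "u1 \<in> hom K Z T"
    and u': "\<forall>x\<in>carr ?A. m u0 (e x) = fst x" "\<forall>x\<in>carr ?A. m u1 (e x) = snd x"
    using proj[OF pr(1)] proj[OF pr(2)] by blast
  have S: "inserted (m u0) (m u1) (carr (alg Z)) = carr ?A"
  proof -
    have "inserted (m u0) (m u1) (carr (alg Z)) = (\<lambda>x. (m u0 (e x), m u1 (e x))) ` carr ?A"
      unfolding inserted_def e(2) by blast
    also have "\<dots> = (\<lambda>x. x) ` carr ?A" using u' by (intro image_cong) auto
    finally show ?thesis by simp
  qed
  have "(m c x, m c y) \<in> ord (alg X) \<longleftrightarrow> (x, y) \<in> (ord (alg T) \<union> carr ?A)\<^sup>+"
    if "x \<in> carr (alg T)" "y \<in> carr (alg T)" for x y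
  proof
    assume "(m c x, m c y) \<in> ord (alg X)"
    then show "(x, y) \<in> (ord (alg T) \<union> carr ?A)\<^sup>+" using that unfolding carr by blast
  next
    have "mono_rel (ord (alg T)) (ord (alg X)) (m c)" using m_hom[OF c] unfolding oalg_hom_def
      by blast
    moreover assume "(x, y) \<in> (ord (alg T) \<union> carr ?A)\<^sup>+"
    ultimately show "(m c x, m c y) \<in> ord (alg X)"
      using mono_on_generated[of "ord (alg T)" "ord (alg X)" "m c" "carr ?A" x y]
        alg_Preorder[OF o(2)]
      unfolding carr by blast
  qed
  then have "poset_coinserter (ord (alg T)) (ord (alg X)) (inserted (m u0) (m u1) (carr (alg Z)))
    (m c)"
    unfolding poset_coinserter_def S using sur by blast
  then show ?thesis
    unfolding subregular_epi_def using coinserter_if_poset_coinserter[OF u c] by blast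
qed

text \<open>
  The quotient \<open>Q\<close> of \<open>X\<close> by the generated preorder is a model, so it is the coinserter in \<open>K\<close>
  too; the given coinserter is isomorphic to it.
\<close>

lemma reflexive_coinserter_underlying:
  assumes u: "u0 \<in> hom K Z X" "u1 \<in> hom K Z X" and f: "f \<in> hom K X Y"
    and r: "reflexive_pair K u0 u1" and c: "coinserter K u0 u1 f"
  shows "poset_coinserter (ord (alg X)) (ord (alg Y)) (inserted (m u0) (m u1) (carr (alg Z))) (m f)"
proof -
  define S where "S = inserted (m u0) (m u1) (carr (alg Z))"
  have o: "X \<in> Obj K" "Y \<in> Obj K" "Z \<in> Obj K" using hom_objs u f by auto
  note X = alg_preordered[OF o(1)]
  obtain d where d: "d \<in> hom K X Z" "u0 \<cdot> d = Idt K X" "u1 \<cdot> d = Idt K X"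
    using r u unfolding reflexive_pair_def hom_def by auto
  have S: "S \<subseteq> carr (alg X) \<times> carr (alg X)"
    unfolding S_def inserted_def using m_carr[OF u(1)] m_carr[OF u(2)] by blast
  have diag: "(x, x) \<in> S" if "x \<in> carr (alg X)" for x
  proof -
    have "m u0 (m d x) = x" "m u1 (m d x) = x"
      using m_comp[OF d(1) u(1) that] m_comp[OF d(1) u(2) that] d m_id[OF o(1) that] by simp_all
    then show ?thesis unfolding S_def inserted_def using m_carr[OF d(1) that] by force
  qed
  have S_op: "(opn (alg X) (length xs) \<sigma> xs, opn (alg X) (length xs) \<sigma> ys) \<in> S"
    if s: "\<sigma> \<in> \<Sigma> (length xs)" and xy: "list_all2 (\<lambda>x y. (x, y) \<in> S) xs ys" for \<sigma> xs ys
  proof -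
    have "\<exists>zs. set zs \<subseteq> carr (alg Z) \<and> xs = map (m u0) zs \<and> ys = map (m u1) zs"
      using xy
    proof (induction rule: list_all2_induct)
      case (Cons x xs y ys)
      then obtain z zs where "z \<in> carr (alg Z)" "x = m u0 z" "y = m u1 z"
        "set zs \<subseteq> carr (alg Z)" "xs = map (m u0) zs" "ys = map (m u1) zs"
        unfolding S_def inserted_def by blast
      then show ?case by (intro exI[of _ "z # zs"]) simp
    qed simp
    then obtain zs where zs: "set zs \<subseteq> carr (alg Z)" "xs = map (m u0) zs" "ys = map (m u1) zs"
      by blast
    define z where "z = opn (alg Z) (length zs) \<sigma> zs"
    have s': "\<sigma> \<in> \<Sigma> (length zs)" using s zs(2) by simp
    have "opn (alg X) (length xs) \<sigma> xs = m u0 z" "opn (alg X) (length xs) \<sigma> ys = m u1 z"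
      using oalg_hom_opn[OF m_hom[OF u(1)] s' zs(1)] oalg_hom_opn[OF m_hom[OF u(2)] s' zs(1)]
      unfolding z_def zs(2,3) by simp_all
    moreover have "z \<in> carr (alg Z)"
      unfolding z_def by (rule opn_closed[OF alg_preordered[OF o(3)] s' zs(1)])
    ultimately show ?thesis unfolding S_def inserted_def by blast
  qed
  let ?A = "(alg X)\<lparr>ord := (ord (alg X) \<union> S)\<^sup>+\<rparr>"
  note A = preordered_algebra_generated[OF X S diag S_op]
  have carr: "carr ?A = carr (alg X)" using Preorder_generated(2)[OF alg_Preorder[OF o(1)] S]
    by simp
  have id: "oalg_hom \<Sigma> (alg X) ?A (\<lambda>x. x)"
    unfolding oalg_hom_def mono_rel_def by auto
  have "satisfies ?A s t" if "(s, t) \<in> E" for s t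
    using satisfies_image[OF X _ _ id] carr that ineqs alg_model[OF o(1)] unfolding models_def
      by fastforce
  then have "\<forall>(s, t)\<in>E. satisfies ?A s t" by blast
  moreover have "small U (carr ?A)" using model_small[OF alg_model[OF o(1)]] carr by simp
  ultimately obtain Q e where Q: "Q \<in> Obj K" and e: "oalg_hom \<Sigma> ?A (alg Q) e"
    "carr (alg Q) = e ` carr ?A"
    and le: "\<forall>x\<in>carr ?A. \<forall>y\<in>carr ?A. (e x, e y) \<in> ord (alg Q) \<longleftrightarrow> (x, y) \<in> ord ?A"
    using quotient_object[OF A] by metis
  have "oalg_hom \<Sigma> (alg X) (alg Q) e" using oalg_hom_comp[OF id e(1)] by (simp add: comp_def)
  then obtain k where k: "k \<in> hom K X Q" "\<forall>x\<in>carr (alg X). m k x = e x" using m_full[OF o(1) Q]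
    by blast
  have kc: "poset_coinserter (ord (alg X)) (ord (alg Q)) (inserted (m u0) (m u1) (carr (alg Z)))
    (m k)"
    unfolding poset_coinserter_def S_def[symmetric] using e(2) le k(2) unfolding carr by auto
  obtain g g' where g: "g \<in> hom K Q Y" "g' \<in> hom K Y Q" "f = g \<cdot> k" "k = g' \<cdot> f" "g \<cdot> g' = Idt K Y"
    using coinserter_unique[OF c f coinserter_if_poset_coinserter[OF u k(1) kc] k(1)] .
  have mf: "m f x = m g (m k x)" "m k x = m g' (m f x)" if "x \<in> carr (alg X)" for x
    using m_comp[OF k(1) g(1) that, folded g(3)] m_comp[OF f g(2) that, folded g(4)] .
  have "y \<in> m f ` carr (alg X)" if y: "y \<in> carr (alg Y)" for y
  proof -
    have "m g' y \<in> m k ` carr (alg X)"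
      using m_carr[OF g(2) y] kc unfolding poset_coinserter_def by simp
    moreover have "m g (m g' y) = y" using m_comp[OF g(2,1) y] g(5) m_id[OF o(2) y] by simp
    ultimately show ?thesis using mf(1) by force
  qed
  then have "m f ` carr (alg X) = carr (alg Y)" using m_carr[OF f] by blast
  moreover have "(m f x, m f y) \<in> ord (alg Y) \<longleftrightarrow> (m k x, m k y) \<in> ord (alg Q)"
    if "x \<in> carr (alg X)" "y \<in> carr (alg X)" for x y
    using mf[OF that(1)] mf[OF that(2)] m_mono[OF g(1)] m_mono[OF g(2)] by metis
  ultimately show ?thesis using kc unfolding poset_coinserter_def by simp
qed

section \<open>The generator of a category represented by algebras\<close>

text \<open>
  The counterpart of \<open>free_on\<close> in \<open>K\<close>, for an object whose algebra is free on \<open>P\<close>.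
\<close>

definition free_object :: "'p rel \<Rightarrow> 'o \<Rightarrow> ('p \<Rightarrow> 'u) \<Rightarrow> bool" where
  "free_object P T \<eta> \<longleftrightarrow> T \<in> Obj K \<and> mono_rel P (ord (alg T)) \<eta> \<and>
     (\<forall>x\<in>carr (alg T). \<exists>t\<in>tms \<Sigma> (Field P). x = eval_tm (alg T) \<eta> t) \<and>
     (\<forall>X\<in>Obj K. \<forall>f :: 'p \<Rightarrow> 'u. mono_rel P (ord (alg X)) f \<longrightarrow>
        (\<exists>h\<in>hom K T X. \<forall>p\<in>Field P. m h (\<eta> p) = f p))"

lemma free_object_obj: "free_object P T \<eta> \<Longrightarrow> T \<in> Obj K"
  unfolding free_object_def by (elim conjE)

lemma free_object_mono: "free_object P T \<eta> \<Longrightarrow> mono_rel P (ord (alg T)) \<eta>"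
  unfolding free_object_def by (elim conjE)

lemma free_object_generated:
  "free_object P T \<eta> \<Longrightarrow> \<forall>x\<in>carr (alg T). \<exists>t\<in>tms \<Sigma> (Field P). x = eval_tm (alg T) \<eta> t"
  unfolding free_object_def by (elim conjE)

lemma free_object_extend:
  "free_object P T \<eta> \<Longrightarrow> X \<in> Obj K \<Longrightarrow> mono_rel P (ord (alg X)) f \<Longrightarrow>
    \<exists>h\<in>hom K T X. \<forall>p\<in>Field P. m h (\<eta> p) = f p"
  unfolding free_object_def by (elim conjE) simp

lemma free_object_exists:
  fixes P :: "'p rel"
  assumes P: "Preorder P" "small U (Field P)"
  shows "\<exists>T \<eta>. free_object P T \<eta>"
proof -
  obtain A \<eta> where F: "free_on U \<Sigma> E P A \<eta>"
    using free_algebra_exists[OF universe small_sig ineqs P] by blast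
  then have A: "A \<in> models U \<Sigma> E" and eta: "mono_rel P (ord A) \<eta>" unfolding free_on_def by auto
  obtain T i where T: "T \<in> Obj K" and i: "oalg_iso \<Sigma> A (alg T) i" using ess_surj[OF A] by blast
  obtain j where j: "oalg_iso \<Sigma> (alg T) A j" "\<forall>x\<in>carr A. j (i x) = x" "\<forall>y\<in>carr (alg T). i (j y) = y"
    using oalg_iso_inverse[OF model_ordered[OF A] model_ordered[OF alg_model[OF T]] i] .
  have ih: "oalg_hom \<Sigma> A (alg T) i" and jh: "oalg_hom \<Sigma> (alg T) A j"
    using i j unfolding oalg_iso_def by auto
  have "\<exists>t\<in>tms \<Sigma> (Field P). x = eval_tm (alg T) (\<lambda>p. i (\<eta> p)) t" if x: "x \<in> carr (alg T)" for x
  proof -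
    obtain t where t: "t \<in> tms \<Sigma> (Field P)" "j x = eval_tm A \<eta> t"
      using F oalg_hom_carr[OF jh x] unfolding free_on_def by blast
    have "\<eta> ` Field P \<subseteq> carr A" using mono_rel_Field[OF eta] by blast
    then have "i (j x) = eval_tm (alg T) (\<lambda>p. i (\<eta> p)) t"
      using hom_eval_tm[OF model_preordered[OF A] ih t(1)] t(2) by simp
    then show ?thesis using t(1) j(3) x by auto
  qed
  moreover have "mono_rel P (ord (alg T)) (\<lambda>p. i (\<eta> p))"
    using eta oalg_hom_mono[OF ih] unfolding mono_rel_def by blast
  moreover have "\<exists>h\<in>hom K T X. \<forall>p\<in>Field P. m h (i (\<eta> p)) = f p"
    if X: "X \<in> Obj K" and f: "mono_rel P (ord (alg X)) f" for X and f :: "'p \<Rightarrow> 'u"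
  proof -
    obtain h where h: "oalg_hom \<Sigma> A (alg X) h" "\<forall>p\<in>Field P. h (\<eta> p) = f p"
      using F alg_model[OF X] f unfolding free_on_def by blast
    obtain k where k: "k \<in> hom K T X" "\<forall>x\<in>carr (alg T). m k x = h (j x)"
      using m_full[OF T X oalg_hom_comp[OF jh h(1)]] by auto
    have "\<eta> p \<in> carr A" "i (\<eta> p) \<in> carr (alg T)" if "p \<in> Field P" for p
      using mono_rel_Field[OF eta that] oalg_hom_carr[OF ih] by auto
    then have "\<forall>p\<in>Field P. m k (i (\<eta> p)) = f p" using k(2) h(2) j(2) by simp
    then show ?thesis using k(1) by blast
  qed
  ultimately have "free_object P T (\<lambda>p. i (\<eta> p))" unfolding free_object_def using T by blast
  then show ?thesis by blast
qed

text \<open>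
  Homomorphisms are compared on generators, because operations are monotone.
\<close>

lemma free_object_le:
  assumes F: "free_object P T \<eta>" and h: "h \<in> hom K T X" "h' \<in> hom K T X"
    and le: "\<And>p. p \<in> Field P \<Longrightarrow> (m h (\<eta> p), m h' (\<eta> p)) \<in> ord (alg X)"
  shows "(h, h') \<in> Le K"
proof -
  have o: "T \<in> Obj K" "X \<in> Obj K" using hom_objs h by auto
  have eta: "\<eta> ` Field P \<subseteq> carr (alg T)"
    using mono_rel_Field[OF free_object_mono[OF F]] by blast
  have "(m h x, m h' x) \<in> ord (alg X)" if x: "x \<in> carr (alg T)" for x
  proof -
    obtain t where t: "t \<in> tms \<Sigma> (Field P)" "x = eval_tm (alg T) \<eta> t"
      using free_object_generated[OF F] x by blast
    show ?thesis
      using hom_eval_tm[OF alg_preordered[OF o(1)] m_hom[OF h(1)] t(1) eta]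
        hom_eval_tm[OF alg_preordered[OF o(1)] m_hom[OF h(2)] t(1) eta]
        eval_tm_mono[OF alg_preordered[OF o(2)] t(1), of "\<lambda>p. m h (\<eta> p)" "\<lambda>p. m h' (\<eta> p)"] le t(2)
          by simp
  qed
  then show ?thesis using m_le[OF h] by blast
qed

end

text \<open>
  \<open>G\<close> represents the free algebra on one generator \<open>g\<close>: evaluation at \<open>g\<close> identifies the points
  \<open>G \<rightarrow> X\<close> with the elements of \<open>X\<close>.
\<close>

locale algebraic_generator = algebraic K U \<Sigma> E alg m
  for K :: "('o, 'a) poscat" (structure) and U :: "'u itself" and \<Sigma> :: "'s signature" and E
    and alg :: "'o \<Rightarrow> ('s, 'u) oalg" and m :: "'a \<Rightarrow> 'u \<Rightarrow> 'u" +
  fixes G :: 'o and g :: 'u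
  assumes G_obj: "G \<in> Obj K" and g_carr: "g \<in> carr (alg G)"
    and point_exists: "X \<in> Obj K \<Longrightarrow> x \<in> carr (alg X) \<Longrightarrow> \<exists>h\<in>hom K G X. m h g = x"
    and point_le: "h \<in> hom K G X \<Longrightarrow> h' \<in> hom K G X \<Longrightarrow> (m h g, m h' g) \<in> ord (alg X) \<Longrightarrow> (h, h') \<in> Le K"

lemma (in algebraic) generator_exists: "\<exists>G g. algebraic_generator K U \<Sigma> E alg m G g"
proof -
  have "small U {()}" by (intro small_countable[OF universe]) simp
  then obtain G \<eta> where F: "free_object (Id_on {()}) G \<eta>"
    using free_object_exists[OF Preorder_Id_on, of "{()}"] by auto
  have o: "G \<in> Obj K" "\<eta> () \<in> carr (alg G)"
    using free_object_obj[OF F] mono_rel_Field[OF free_object_mono[OF F], of "()"] by auto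
  have "algebraic_generator K U \<Sigma> E alg m G (\<eta> ())"
  proof unfold_locales
    fix X x assume X: "X \<in> Obj K" and x: "x \<in> carr (alg X)"
    have "mono_rel (Id_on {()}) (ord (alg X)) (\<lambda>_. x)"
      using preorder_refl[OF alg_Preorder[OF X] x] unfolding mono_rel_def by auto
    then show "\<exists>h\<in>hom K G X. m h (\<eta> ()) = x"
      using free_object_extend[OF F X] by fastforce
  next
    fix h X h' assume "h \<in> hom K G X" "h' \<in> hom K G X" "(m h (\<eta> ()), m h' (\<eta> ())) \<in> ord (alg X)"
    then show "(h, h') \<in> Le K" using free_object_le[OF F] by simp
  qed (use o in auto)
  then show ?thesis by blast
qed

lemma trancl_transport:
  assumes j: "bij_betw j A B" and R: "R \<subseteq> A \<times> A" and S: "S \<subseteq> B \<times> B"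
    and iff: "\<And>x y. x \<in> A \<Longrightarrow> y \<in> A \<Longrightarrow> (x, y) \<in> R \<longleftrightarrow> (j x, j y) \<in> S"
    and xy: "x \<in> A" "y \<in> A"
  shows "(x, y) \<in> R\<^sup>+ \<longleftrightarrow> (j x, j y) \<in> S\<^sup>+"
proof
  assume "(x, y) \<in> R\<^sup>+"
  then show "(j x, j y) \<in> S\<^sup>+"
  proof (induction rule: trancl_induct)
    case (base y)
    then show ?case using iff R by blast
  next
    case (step y z)
    then have "(j y, j z) \<in> S" using iff R by blast
    then show ?case using step(3) by (rule trancl_into_trancl[rotated])
  qed
next
  have "(u, v) \<in> S\<^sup>+ \<Longrightarrow> \<forall>x\<in>A. \<forall>y\<in>A. j x = u \<longrightarrow> j y = v \<longrightarrow> (x, y) \<in> R\<^sup>+" for u v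
  proof (induction rule: trancl_induct)
    case (base v)
    then show ?case using iff by blast
  next
    case (step v w)
    have "v \<in> B" using step(2) S by blast
    then obtain z where "z \<in> A" "j z = v" using j unfolding bij_betw_def by blast
    then show ?case using step iff by (blast intro: trancl_into_trancl)
  qed
  then show "(j x, j y) \<in> S\<^sup>+ \<Longrightarrow> (x, y) \<in> R\<^sup>+" using xy by blast
qed

context algebraic_generator
begin

lemma point_le_iff:
  "h \<in> hom K G X \<Longrightarrow> h' \<in> hom K G X \<Longrightarrow> (h, h') \<in> Le K \<longleftrightarrow> (m h g, m h' g) \<in> ord (alg X)"
  using point_le m_le g_carr by blast

lemma point_carr: "h \<in> hom K G X \<Longrightarrow> m h g \<in> carr (alg X)"
  using m_carr g_carr by blast

lemma point_eqI:
  assumes h: "h \<in> hom K G X" "h' \<in> hom K G X" and eq: "m h g = m h' g"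
  shows "h = h'"
  using point_le_iff[OF h] point_le_iff[OF h(2,1)] eq le_refl[OF h(1)] point_le_iff[OF h(1,1)]
    le_antisym[OF _ _ h] by simp

lemma point_comp: "h \<in> hom K G X \<Longrightarrow> k \<in> hom K X Y \<Longrightarrow> m (k \<cdot> h) g = m k (m h g)"
  using m_comp g_carr by blast

lemma points_bij: "X \<in> Obj K \<Longrightarrow> bij_betw (\<lambda>h. m h g) (hom K G X) (carr (alg X))"
  unfolding bij_betw_def using point_eqI point_carr point_exists
    by (auto simp: inj_on_def image_iff) metis

lemma small_points:
  assumes X: "X \<in> Obj K"
  shows "small U (hom K G X)"
proof (rule small_bij)
  show "small U (carr (alg X))" using model_small[OF alg_model[OF X]] .
  show "inj_on (\<lambda>h. m h g) (hom K G X)" using bij_betw_imp_inj_on[OF points_bij[OF X]] .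
  show "(\<lambda>h. m h g) ` hom K G X \<subseteq> carr (alg X)" using point_carr by blast
qed

definition point :: "'o \<Rightarrow> 'u \<Rightarrow> 'a" where
  "point X x = (SOME h. h \<in> hom K G X \<and> m h g = x)"

lemma point: "X \<in> Obj K \<Longrightarrow> x \<in> carr (alg X) \<Longrightarrow> point X x \<in> hom K G X \<and> m (point X x) g = x"
  unfolding point_def using someI_ex[OF point_exists[unfolded Bex_def]] .

lemma tensor_arrow_if_free:
  assumes F: "free_object P T \<eta>"
  shows "tensor_arrow K P G T (\<lambda>p. point T (\<eta> p))"
proof -
  note T = free_object_obj[OF F] and eta = free_object_mono[OF F]
  have pt: "point T (\<eta> p) \<in> hom K G T" "m (point T (\<eta> p)) g = \<eta> p" if "p \<in> Field P" for p
    using point[OF T mono_rel_Field[OF eta that]] by auto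
  show ?thesis
    unfolding tensor_arrow_def
  proof (intro conjI ballI allI impI)
    show "T \<in> Obj K" by (rule T)
    have "(point T (\<eta> p), point T (\<eta> q)) \<in> hom_poset K G T" if "(p, q) \<in> P" for p q
    proof -
      have "p \<in> Field P" "q \<in> Field P" using that by (auto intro: FieldI1 FieldI2)
      then show ?thesis
        unfolding hom_poset_iff using pt point_le_iff that eta unfolding mono_rel_def by metis
    qed
    then show "mono_rel P (hom_poset K G T) (\<lambda>p. point T (\<eta> p))" unfolding mono_rel_def by blast
  next
    fix X f assume X: "X \<in> Obj K" and f: "mono_rel P (hom_poset K G X) f"
    have "mono_rel P (ord (alg X)) (\<lambda>p. m (f p) g)"
      using f point_le_iff unfolding mono_rel_def hom_poset_iff by blast
    then obtain h where h: "h \<in> hom K T X" "\<forall>p\<in>Field P. m h (\<eta> p) = m (f p) g"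
      using free_object_extend[OF F X] by blast
    have fp: "f p \<in> hom K G X" if "p \<in> Field P" for p using mono_rel_Field[OF f that] by simp
    have "h \<cdot> point T (\<eta> p) = f p" if p: "p \<in> Field P" for p
      using point_eqI[OF comp_hom[OF pt(1)[OF p] h(1)] fp[OF p]] point_comp[OF pt(1)[OF p] h(1)]
        pt(2)[OF p] h(2) p by simp
    then show "\<exists>h\<in>hom K T X. \<forall>p\<in>Field P. h \<cdot> point T (\<eta> p) = f p" using h(1) by blast
  next
    fix X h h' assume h: "h \<in> hom K T X" "h' \<in> hom K T X"
      and *: "\<forall>p\<in>Field P. (h \<cdot> point T (\<eta> p), h' \<cdot> point T (\<eta> p)) \<in> Le K"
    have "(m h (\<eta> p), m h' (\<eta> p)) \<in> ord (alg X)" if p: "p \<in> Field P" for p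
      using * p point_le_iff[OF comp_hom[OF pt(1)[OF p] h(1)] comp_hom[OF pt(1)[OF p] h(2)]]
        point_comp[OF pt(1)[OF p] h(1)] point_comp[OF pt(1)[OF p] h(2)] pt(2)[OF p] by simp
    then show "(h, h') \<in> Le K" using free_object_le[OF F h] by blast
  qed
qed

lemma tensor_exists:
  assumes "Preorder P" "small U (Field P)"
  obtains T \<eta> where "tensor_arrow K P G T \<eta>"
    "\<forall>x\<in>carr (alg T). \<exists>t\<in>tms \<Sigma> (Field P). x = eval_tm (alg T) (\<lambda>p. m (\<eta> p) g) t"
proof -
  obtain T \<eta> where F: "free_object P T \<eta>" using free_object_exists[OF assms] by blast
  have "m (point T (\<eta> p)) g = \<eta> p" if "p \<in> Field P" for p
    using point[OF free_object_obj[OF F] mono_rel_Field[OF free_object_mono[OF F] that]] by blast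
  then have "eval_tm (alg T) (\<lambda>p. m (point T (\<eta> p)) g) t = eval_tm (alg T) \<eta> t"
    if "t \<in> tms \<Sigma> (Field P)" for t
    using eval_tm_cong[OF that, of "\<lambda>p. m (point T (\<eta> p)) g" \<eta>] by blast
  then have "\<forall>x\<in>carr (alg T). \<exists>t\<in>tms \<Sigma> (Field P). x = eval_tm (alg T) (\<lambda>p. m (point T (\<eta> p)) g) t"
    using free_object_generated[OF F] by metis
  then show ?thesis using tensor_arrow_if_free[OF F] by (rule that[rotated])
qed

text \<open>
  The canonical morphism is onto, since it takes the universal point \<open>\<eta> f\<close> to \<open>f\<close>.
\<close>

lemma generator_subregular: "subregular_generator U K G"
  unfolding subregular_generator_def
proof (intro conjI allI impI ballI)
  show "G \<in> Obj K" by (rule G_obj)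
next
  fix P :: "'u rel" assume P: "Partial_order P \<and> small U (Field P)"
  then have P': "Preorder P" "small U (Field P)" unfolding partial_order_on_def by auto
  obtain T \<eta> where "tensor_arrow K P G T \<eta>" using tensor_exists[OF P'] by blast
  then show "\<exists>T \<phi>. tensor K P G T \<phi>" using tensor_if_tensor_arrow[OF _ P'(1)] by metis
next
  fix X assume X: "X \<in> Obj K"
  let ?P = "hom_poset K G X"
  have P: "Preorder ?P" using Partial_order_hom_poset unfolding partial_order_on_def by blast
  have "small U (Field ?P)" using small_points[OF X] by simp
  from tensor_exists[OF P this] obtain T \<eta> where T: "tensor_arrow K ?P G T \<eta>" by blast
  obtain \<phi> where phi: "tensor K ?P G T \<phi>"
    and phi': "\<forall>X. \<forall>f \<in> mono_maps ?P (hom_poset K G X). X \<in> Obj K \<longrightarrow>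
       \<phi> X f \<in> hom K T X \<and> (\<forall>p\<in>Field ?P. \<phi> X f \<cdot> \<eta> p = f p)"
    using tensor_if_tensor_arrow[OF T P] .
  have "(\<lambda>f\<in>hom K G X. f) \<in> mono_maps ?P ?P"
    using mono_rel_restrict[of ?P ?P "\<lambda>f. f"] unfolding mono_rel_def by simp
  then have c: "canonical K G X \<phi> \<in> hom K T X" "\<forall>f\<in>hom K G X. canonical K G X \<phi> \<cdot> \<eta> f = f"
    unfolding canonical_def using phi'[rule_format, OF _ X] by auto
  have "x \<in> m (canonical K G X \<phi>) ` carr (alg T)" if x: "x \<in> carr (alg X)" for x
  proof -
    note f = point[OF X x, THEN conjunct1]
    have eta: "\<eta> (point X x) \<in> hom K G T" using tensor_arrow_hom[OF T P] f by simp
    have "m (canonical K G X \<phi>) (m (\<eta> (point X x)) g) = x"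
      using point_comp[OF eta c(1)] c(2) f point[OF X x] by simp
    then show ?thesis using point_carr[OF eta] by force
  qed
  then have "carr (alg X) = m (canonical K G X \<phi>) ` carr (alg T)" using m_carr[OF c(1)] by blast
  then show "\<exists>T \<phi>. tensor K ?P G T \<phi> \<and> subregular_epi K (canonical K G X \<phi>)"
    using phi surjective_subregular_epi[OF c(1)] by blast
qed

text \<open>
  Evaluation at \<open>g\<close> transports the description of reflexive coinserters from elements to points.
\<close>

lemma generator_subeffective_projective: "subeffective_projective U K G"
  unfolding subeffective_projective_iff
proof (intro conjI allI impI ballI)
  show "G \<in> Obj K" by (rule G_obj)
  show "small U (hom K G X)" if "X \<in> Obj K" for X using small_points[OF that] .
  fix Z X Y u0 u1 f assume *: "u0 \<in> hom K Z X \<and> u1 \<in> hom K Z X \<and> f \<in> hom K X Y \<and>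
    reflexive_pair K u0 u1 \<and> coinserter K u0 u1 f"
  then have u: "u0 \<in> hom K Z X" "u1 \<in> hom K Z X" and f: "f \<in> hom K X Y" by auto
  have o: "X \<in> Obj K" "Y \<in> Obj K" "Z \<in> Obj K" using hom_objs u f by auto
  let ?S = "inserted (m u0) (m u1) (carr (alg Z))"
  let ?S' = "inserted (\<lambda>z. u0 \<cdot> z) (\<lambda>z. u1 \<cdot> z) (hom K G Z)"
  have c: "poset_coinserter (ord (alg X)) (ord (alg Y)) ?S (m f)"
    using reflexive_coinserter_underlying[OF u f] * by blast
  have ins: "(x, y) \<in> ?S' \<longleftrightarrow> (m x g, m y g) \<in> ?S" if x: "x \<in> hom K G X" and y: "y \<in> hom K G X"
    for x y
  proof
    assume "(x, y) \<in> ?S'"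
    then obtain z where "z \<in> hom K G Z" "x = u0 \<cdot> z" "y = u1 \<cdot> z" unfolding inserted_def by blast
    then show "(m x g, m y g) \<in> ?S"
      unfolding inserted_def using point_comp[OF _ u(1)] point_comp[OF _ u(2)] point_carr by blast
  next
    assume "(m x g, m y g) \<in> ?S"
    then obtain w where w: "w \<in> carr (alg Z)" "m x g = m u0 w" "m y g = m u1 w"
      unfolding inserted_def by blast
    obtain z where z: "z \<in> hom K G Z" "m z g = w" using point_exists[OF o(3) w(1)] by blast
    have "x = u0 \<cdot> z" "y = u1 \<cdot> z"
      using point_eqI[OF x comp_hom[OF z(1) u(1)]] point_eqI[OF y comp_hom[OF z(1) u(2)]]
        point_comp[OF z(1) u(1)] point_comp[OF z(1) u(2)] z(2) w by simp_all
    then show "(x, y) \<in> ?S'" unfolding inserted_def using z(1) by blast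
  qed
  have tr: "(x, y) \<in> (hom_poset K G X \<union> ?S')\<^sup>+ \<longleftrightarrow> (m x g, m y g) \<in> (ord (alg X) \<union> ?S)\<^sup>+"
    if "x \<in> hom K G X" "y \<in> hom K G X" for x y
  proof (rule trancl_transport[OF points_bij[OF o(1)] _ _ _ that])
    show "hom_poset K G X \<union> ?S' \<subseteq> hom K G X \<times> hom K G X"
      unfolding hom_poset_def inserted_def using comp_hom u by blast
    show "ord (alg X) \<union> ?S \<subseteq> carr (alg X) \<times> carr (alg X)"
      unfolding inserted_def using m_carr u by (auto intro: FieldI1 FieldI2)
    show "(x, y) \<in> hom_poset K G X \<union> ?S' \<longleftrightarrow> (m x g, m y g) \<in> ord (alg X) \<union> ?S"
      if "x \<in> hom K G X" "y \<in> hom K G X" for x y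
      using ins[OF that] point_le_iff[OF that] that by (simp add: hom_poset_iff)
  qed
  show "poset_coinserter (hom_poset K G X) (hom_poset K G Y) ?S' (\<lambda>x. f \<cdot> x)"
    unfolding poset_coinserter_def Field_hom_poset
  proof (intro conjI ballI)
    have "y \<in> (\<lambda>x. f \<cdot> x) ` hom K G X" if y: "y \<in> hom K G Y" for y
    proof -
      have "m y g \<in> m f ` carr (alg X)" using point_carr[OF y] c unfolding poset_coinserter_def
        by blast
      then obtain a where a: "a \<in> carr (alg X)" "m y g = m f a" by blast
      obtain x where x: "x \<in> hom K G X" "m x g = a" using point_exists[OF o(1) a(1)] by blast
      have "y = f \<cdot> x"
        using point_eqI[OF y comp_hom[OF x(1) f]] point_comp[OF x(1) f] x(2) a(2) by simp
      then show ?thesis using x(1) by blast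
    qed
    then show "(\<lambda>x. f \<cdot> x) ` hom K G X = hom K G Y" using comp_hom[OF _ f] by blast
    fix x y assume xy: "x \<in> hom K G X" "y \<in> hom K G X"
    note fx = comp_hom[OF xy(1) f] and fy = comp_hom[OF xy(2) f]
    have "(f \<cdot> x, f \<cdot> y) \<in> hom_poset K G Y \<longleftrightarrow> (m f (m x g), m f (m y g)) \<in> ord (alg Y)"
      unfolding hom_poset_iff using fx fy point_le_iff[OF fx fy] point_comp[OF xy(1) f]
        point_comp[OF xy(2) f] by simp
    also have "\<dots> \<longleftrightarrow> (m x g, m y g) \<in> (ord (alg X) \<union> ?S)\<^sup>+"
      using c point_carr[OF xy(1)] point_carr[OF xy(2)] unfolding poset_coinserter_def by blast
    finally show "(f \<cdot> x, f \<cdot> y) \<in> hom_poset K G Y \<longleftrightarrow> (x, y) \<in> (hom_poset K G X \<union> ?S')\<^sup>+"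
      using tr[OF xy] by simp
  qed
qed

text \<open>
  A point of \<open>M.G\<close> is an element of the free algebra on \<open>M\<close>, that is, the value of a term \<open>t\<close>. It
  comes from the copower over the finite set \<open>M'\<close> of variables of \<open>t\<close>.
\<close>

lemma generator_abstractly_finite: "abstractly_finite U K G"
  unfolding abstractly_finite_def
proof (intro conjI allI impI)
  show "G \<in> Obj K" by (rule G_obj)
next
  fix M :: "'u set" assume M: "small U M"
  note P = Preorder_Id_on
  have sm: "small U (Field (Id_on M'))" if "M' \<subseteq> M" for M' using small_subset[OF M that] by simp
  from tensor_exists[OF P sm[OF subset_refl]] obtain T0 \<eta>0
    where T0: "tensor_arrow K (Id_on M) G T0 \<eta>0"
    "\<forall>x\<in>carr (alg T0). \<exists>t\<in>tms \<Sigma> M. x = eval_tm (alg T0) (\<lambda>p. m (\<eta>0 p) g) t"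
    by auto
  show "\<exists>T \<phi>. copower K M G T \<phi>" using tensor_if_tensor_arrow[OF T0(1) P] by metis
  fix T \<phi> f assume "copower K M G T \<phi> \<and> f \<in> hom K G T"
  then have T: "copower K M G T \<phi>" and f: "f \<in> hom K G T" by auto
  define \<eta> where "\<eta> = injections K M G T \<phi>"
  note eta = tensor_arrow_if_tensor(1)[OF T P \<eta>_def[unfolded injections_def]]
  have TO: "T \<in> Obj K" "T0 \<in> Obj K" using eta T0(1) unfolding tensor_arrow_def by auto
  have etah: "\<eta> p \<in> hom K G T" and eta0h: "\<eta>0 p \<in> hom K G T0" if "p \<in> M" for p
    using tensor_arrow_hom[OF eta P] tensor_arrow_hom[OF T0(1) P] that by auto
  \<comment> \<open>The given copower \<open>T\<close> is isomorphic to the free one \<open>T0\<close>; a retraction suffices to see that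
      its points are values of terms.\<close>
  obtain k where k: "k \<in> hom K T0 T" "\<forall>p\<in>M. k \<cdot> \<eta>0 p = \<eta> p"
    using tensor_arrow_cotuple[OF T0(1) TO(1), of \<eta>] etah unfolding mono_rel_Id_on Field_Id_on
      by blast
  obtain r where r: "r \<in> hom K T T0" "\<forall>p\<in>M. r \<cdot> \<eta> p = \<eta>0 p"
    using tensor_arrow_cotuple[OF eta TO(2), of \<eta>0] eta0h unfolding mono_rel_Id_on Field_Id_on
      by blast
  have "k \<cdot> r = Idt K T"
    using tensor_arrow_eq[OF eta P comp_hom[OF r(1) k(1)] id_hom[OF TO(1)]] k(2) r(2)
      comp_assoc[OF etah r(1) k(1)] comp_id_left[OF etah] by simp
  then have kr: "k \<cdot> (r \<cdot> f) = f" using comp_assoc[OF f r(1) k(1)] comp_id_left[OF f] by simp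
  obtain t where t: "t \<in> tms \<Sigma> M" "m (r \<cdot> f) g = eval_tm (alg T0) (\<lambda>p. m (\<eta>0 p) g) t"
    using T0(2) point_carr[OF comp_hom[OF f r(1)]] by blast
  have ft: "m f g = eval_tm (alg T) (\<lambda>p. m (\<eta> p) g) t"
  proof -
    have "m f g = m k (eval_tm (alg T0) (\<lambda>p. m (\<eta>0 p) g) t)"
      using point_comp[OF comp_hom[OF f r(1)] k(1)] kr t(2) by simp
    also have "\<dots> = eval_tm (alg T) (\<lambda>p. m k (m (\<eta>0 p) g)) t"
    proof (rule hom_eval_tm[OF alg_preordered[OF TO(2)] m_hom[OF k(1)] t(1)])
      show "(\<lambda>p. m (\<eta>0 p) g) ` M \<subseteq> carr (alg T0)" using point_carr[OF eta0h] by blast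
    qed
    also have "\<dots> = eval_tm (alg T) (\<lambda>p. m (\<eta> p) g) t"
    proof (rule eval_tm_cong[OF t(1)])
      fix p assume "p \<in> M"
      then show "m k (m (\<eta>0 p) g) = m (\<eta> p) g" using point_comp[OF eta0h k(1)] k(2) by simp
    qed
    finally show ?thesis .
  qed
  define M' where "M' = vars t"
  have M': "finite M'" "M' \<subseteq> M" "t \<in> tms \<Sigma> M'"
    using t(1) finite_vars unfolding M'_def tms_def by auto
  from tensor_exists[OF P sm[OF M'(2)]] obtain T' \<eta>' where T': "tensor_arrow K (Id_on M') G T' \<eta>'"
    by blast
  obtain \<phi>' where phi: "copower K M' G T' \<phi>'"
    and phi': "\<forall>X. \<forall>f \<in> mono_maps (Id_on M') (hom_poset K G X). X \<in> Obj K \<longrightarrow>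
       \<phi>' X f \<in> hom K T' X \<and> (\<forall>p\<in>Field (Id_on M'). \<phi>' X f \<cdot> \<eta>' p = f p)"
    using tensor_if_tensor_arrow[OF T' P] .
  define i where "i = copower_inclusion K G M' \<phi>' M T \<phi>"
  have "restrict \<eta> M' \<in> mono_maps (Id_on M') (hom_poset K G T)"
    using mono_rel_restrict[of "Id_on M'" "hom_poset K G T" \<eta>] etah M'(2) unfolding mono_rel_Id_on
      by auto
  then have i: "i \<in> hom K T' T" "\<forall>p\<in>M'. i \<cdot> \<eta>' p = \<eta> p"
    unfolding i_def copower_inclusion_def \<eta>_def[symmetric] using phi' TO(1) by auto
  have TO': "T' \<in> Obj K" using T' unfolding tensor_arrow_def by blast
  have etah': "\<eta>' p \<in> hom K G T'" if "p \<in> M'" for p using tensor_arrow_hom[OF T' P] that by simp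
  define y where "y = eval_tm (alg T') (\<lambda>p. m (\<eta>' p) g) t"
  have v: "(\<lambda>p. m (\<eta>' p) g) ` M' \<subseteq> carr (alg T')" using point_carr[OF etah'] by blast
  have y: "y \<in> carr (alg T')" unfolding y_def
    using eval_tm_closed[OF alg_preordered[OF TO'] M'(3) v] .
  note h = point[OF TO' y]
  have "m (i \<cdot> point T' y) g = m i y" using point_comp[OF _ i(1)] h by simp
  also have "\<dots> = eval_tm (alg T) (\<lambda>p. m i (m (\<eta>' p) g)) t"
    unfolding y_def using hom_eval_tm[OF alg_preordered[OF TO'] m_hom[OF i(1)] M'(3) v] .
  also have "\<dots> = eval_tm (alg T) (\<lambda>p. m (\<eta> p) g) t"
  proof (rule eval_tm_cong[OF M'(3)])
    fix p assume "p \<in> M'"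
    then show "m i (m (\<eta>' p) g) = m (\<eta> p) g" using point_comp[OF etah' i(1)] i(2) by simp
  qed
  finally have "f = i \<cdot> point T' y"
    using point_eqI[OF f comp_hom[OF h[THEN conjunct1] i(1)]] ft by simp
  then show "\<exists>M' T' \<phi>'. finite M' \<and> M' \<subseteq> M \<and> copower K M' G T' \<phi>' \<and>
      (\<exists>g\<in>hom K G T'. f = copower_inclusion K G M' \<phi>' M T \<phi> \<cdot> g)"
    using M'(1,2) phi h unfolding i_def by blast
qed

end

theorem generator_if_variety:
  fixes K :: "('o, 'a) poscat"
    and V :: "(('u, 'u) oalg, ('u, 'u) oalg \<times> ('u, 'u) oalg \<times> ('u \<Rightarrow> 'u)) poscat"
  assumes U: "universe TYPE('u)" and K: "pos_category K" and V: "variety V" "equivalent K V"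
  shows "\<exists>G. subregular_generator TYPE('u) K G \<and> abstractly_finite TYPE('u) K G \<and>
    subeffective_projective TYPE('u) K G"
proof -
  obtain \<Sigma> E where S: "small_signature TYPE('u) \<Sigma>" and E: "inequations \<Sigma> E"
    and V': "V = model_cat TYPE('u) \<Sigma> E"
    using V(1) unfolding variety_iff by blast
  obtain alg and m :: "'a \<Rightarrow> 'u \<Rightarrow> 'u" where r: "represented K TYPE('u) \<Sigma> E alg m"
    using represented_if_equivalent[OF K V(2)[unfolded V']] by blast
  interpret algebraic K "TYPE('u)" \<Sigma> E alg m
    using r U S E unfolding algebraic_def algebraic_axioms_def by blast
  obtain G g where "algebraic_generator K TYPE('u) \<Sigma> E alg m G g" using generator_exists by blast
  then interpret algebraic_generator K "TYPE('u)" \<Sigma> E alg m G g .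
  show ?thesis
    using generator_subregular generator_abstractly_finite generator_subeffective_projective
      by blast
qed

section \<open>The variety of a subregular generator\<close>

locale generator = pos_category K for K :: "('o, 'a) poscat" (structure) +
  fixes U :: "'u itself" and G :: 'o
  assumes universe: "universe U"
    and reflexive_coinserters: "has_reflexive_coinserters K"
    and subregular: "subregular_generator U K G"
    and finite_gen: "abstractly_finite U K G"
    and projective: "subeffective_projective U K G"
begin

lemma small_hom: "X \<in> Obj K \<Longrightarrow> small U (hom K G X)"
  using projective unfolding subeffective_projective_iff by blast

lemma hom_preserves_coinserter:
  assumes "u0 \<in> hom K Z X" "u1 \<in> hom K Z X" "f \<in> hom K X Y" "reflexive_pair K u0 u1"
    "coinserter K u0 u1 f"
  shows "poset_coinserter (hom_poset K G X) (hom_poset K G Y)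
          (inserted (\<lambda>z. u0 \<cdot> z) (\<lambda>z. u1 \<cdot> z) (hom K G Z)) (\<lambda>x. f \<cdot> x)"
  using projective assms unfolding subeffective_projective_iff by blast

lemma tensor_exists:
  fixes P :: "'p rel"
  assumes P: "Partial_order P" "small U (Field P)"
  shows "\<exists>T \<eta>. tensor_arrow K P G T \<eta>"
proof -
  have P': "Preorder P" "antisym P" using P(1) unfolding partial_order_on_def by auto
  obtain j :: "'p \<Rightarrow> 'u" where j: "inj_on j (Field P)" using small_inj[OF P(2)] .
  obtain q :: "'p \<Rightarrow> 'u" and Q where Q: "Partial_order Q" "Field Q = q ` Field P"
    and le: "\<forall>x\<in>Field P. \<forall>y\<in>Field P. (q x, q y) \<in> Q \<longleftrightarrow> (x, y) \<in> P"
    using poset_quotient[OF P'(1) j] .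
  have Q': "Preorder Q" using Q(1) unfolding partial_order_on_def by auto
  have "inj_on q (Field P)"
  proof (rule inj_onI)
    fix x y assume xy: "x \<in> Field P" "y \<in> Field P" "q x = q y"
    then have "(q x, q y) \<in> Q" "(q y, q x) \<in> Q"
      using preorder_refl[OF Q', of "q x"] Q(2) by auto
    then show "x = y" using le xy(1,2) P'(2) unfolding antisym_def by blast
  qed
  then have bij: "bij_betw q (Field P) (Field Q)" unfolding bij_betw_def Q(2) by blast
  have "small U (Field Q)" unfolding Q(2) using small_image[OF P(2)] .
  then obtain T \<phi> where "tensor K Q G T \<phi>" using subregular Q(1) unfolding subregular_generator_def
    by blast
  then have "tensor_arrow K Q G T (the_inv_into (mono_maps Q (hom_poset K G T)) (\<phi> T) (Idt K T))"
    by (rule tensor_arrow_if_tensor(1)[OF _ Q' refl])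
  from tensor_arrow_reindex[OF this bij] le show ?thesis by blast
qed

lemma copower_exists: "small U M \<Longrightarrow> \<exists>T \<eta>. tensor_arrow K (Id_on M) G T \<eta>"
  by (rule tensor_exists) (auto simp: partial_order_on_def Preorder_Id_on[unfolded Field_Id_on]
    antisym_def)

lemma copower_cotuple:
  assumes "tensor_arrow K (Id_on M) G T \<eta>" "X \<in> Obj K" "\<forall>x\<in>M. f x \<in> hom K G X"
  obtains h where "h \<in> hom K T X" "\<forall>x\<in>M. h \<cdot> \<eta> x = f x"
  using tensor_arrow_cotuple[OF assms(1,2), of f] assms(3) unfolding mono_rel_Id_on Field_Id_on
    by blast

lemma copower_hom: "tensor_arrow K (Id_on M) G T \<eta> \<Longrightarrow> x \<in> M \<Longrightarrow> \<eta> x \<in> hom K G T"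
  using tensor_arrow_hom[OF _ Preorder_Id_on] by simp

lemma canonical_coinserter:
  assumes X: "X \<in> Obj K"
  obtains T \<eta> c u0 u1 where "tensor_arrow K (hom_poset K G X) G T \<eta>" "c \<in> hom K T X"
    "\<forall>f\<in>hom K G X. c \<cdot> \<eta> f = f" "coinserter K u0 u1 c"
proof -
  let ?P = "hom_poset K G X"
  have P: "Preorder ?P" using Partial_order_hom_poset unfolding partial_order_on_def by blast
  obtain T \<phi> where T: "tensor K ?P G T \<phi>" and c: "subregular_epi K (canonical K G X \<phi>)"
    using subregular X unfolding subregular_generator_def by blast
  define \<eta> where "\<eta> = the_inv_into (mono_maps ?P (hom_poset K G T)) (\<phi> T) (Idt K T)"
  note eta = tensor_arrow_if_tensor[OF T P \<eta>_def]
  have m: "(\<lambda>f\<in>hom K G X. f) \<in> mono_maps ?P ?P"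
    using mono_rel_restrict[of ?P ?P "\<lambda>f. f"] unfolding mono_rel_def by simp
  obtain u0 u1 where "coinserter K u0 u1 (canonical K G X \<phi>)" using c unfolding subregular_epi_def
    by blast
  moreover have "canonical K G X \<phi> \<in> hom K T X"
    unfolding canonical_def by (rule eta(3)[OF X m])
  moreover have "\<forall>f\<in>hom K G X. canonical K G X \<phi> \<cdot> \<eta> f = f"
  proof
    fix f assume f: "f \<in> hom K G X"
    show "canonical K G X \<phi> \<cdot> \<eta> f = f"
      using eta(2)[OF X m, of f] f unfolding canonical_def Field_hom_poset restrict_apply'[OF f]
        by blast
  qed
  ultimately show ?thesis using eta(1) by (intro that)
qed

text \<open>
  The coinserter \<open>c : K(G, X) \<otimes> G \<rightarrow> X\<close> can be cancelled, and morphisms out of the tensor are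
  compared on the points \<open>\<eta> f\<close>, which \<open>c\<close> sends to \<open>f\<close>.
\<close>

lemma hom_le_if_points_le:
  assumes h: "h \<in> hom K X Y" "h' \<in> hom K X Y" and le: "\<And>x. x \<in> hom K G X \<Longrightarrow> (h \<cdot> x, h' \<cdot> x) \<in> Le K"
  shows "(h, h') \<in> Le K"
proof -
  have X: "X \<in> Obj K" using hom_objs h by blast
  obtain T \<eta> c u0 u1 where T: "tensor_arrow K (hom_poset K G X) G T \<eta>" and c: "c \<in> hom K T X"
    "\<forall>f\<in>hom K G X. c \<cdot> \<eta> f = f" "coinserter K u0 u1 c"
    by (rule canonical_coinserter[OF X])
  have P: "Preorder (hom_poset K G X)" using Partial_order_hom_poset unfolding partial_order_on_def
    by blast
  have "(h \<cdot> c, h' \<cdot> c) \<in> Le K"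
  proof (rule tensor_arrow_le[OF T comp_hom[OF c(1) h(1)] comp_hom[OF c(1) h(2)]])
    fix f assume "f \<in> Field (hom_poset K G X)"
    then have f: "f \<in> hom K G X" "\<eta> f \<in> hom K G T" using tensor_arrow_hom[OF T P] by auto
    show "((h \<cdot> c) \<cdot> \<eta> f, (h' \<cdot> c) \<cdot> \<eta> f) \<in> Le K"
      using comp_assoc[OF f(2) c(1) h(1)] comp_assoc[OF f(2) c(1) h(2)] c(2) f(1) le by simp
  qed
  then show ?thesis using coinserter_cancel[OF c(3,1) h] by blast
qed

definition fin_copower :: "nat \<Rightarrow> 'o \<times> (nat \<Rightarrow> 'a)" where
  "fin_copower n = (SOME p. tensor_arrow K (Id_on {..<n}) G (fst p) (snd p))"

abbreviation copow :: "nat \<Rightarrow> 'o" where "copow n \<equiv> fst (fin_copower n)"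

abbreviation coproj :: "nat \<Rightarrow> nat \<Rightarrow> 'a" where "coproj n \<equiv> snd (fin_copower n)"

lemma fin_copower: "tensor_arrow K (Id_on {..<n}) G (copow n) (coproj n)"
proof -
  have "small U {..<n}" by (intro small_countable[OF universe]) simp
  then have "\<exists>p. tensor_arrow K (Id_on {..<n}) G (fst p) (snd p)" using copower_exists by simp
  from someI_ex[OF this] show ?thesis unfolding fin_copower_def .
qed

lemma copow_obj: "copow n \<in> Obj K"
  using fin_copower unfolding tensor_arrow_def by blast

lemma coproj_hom: "i < n \<Longrightarrow> coproj n i \<in> hom K G (copow n)"
  using copower_hom[OF fin_copower] by simp

definition cotuple :: "'o \<Rightarrow> 'a list \<Rightarrow> 'a" where
  "cotuple X xs = (SOME h. h \<in> hom K (copow (length xs)) X \<and> (\<forall>i<length xs. h \<cdot> coproj (length xs)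
    i = xs ! i))"

lemma cotuple:
  assumes "X \<in> Obj K" "set xs \<subseteq> hom K G X"
  shows "cotuple X xs \<in> hom K (copow (length xs)) X"
    "\<And>i. i < length xs \<Longrightarrow> cotuple X xs \<cdot> coproj (length xs) i = xs ! i"
proof -
  have "\<forall>i\<in>{..<length xs}. xs ! i \<in> hom K G X" using assms(2) by auto
  then have "\<exists>h. h \<in> hom K (copow (length xs)) X \<and> (\<forall>i<length xs. h \<cdot> coproj (length xs) i = xs !
    i)"
    using copower_cotuple[OF fin_copower assms(1)] by (metis lessThan_iff)
  from someI_ex[OF this]
  show "cotuple X xs \<in> hom K (copow (length xs)) X"
    "\<And>i. i < length xs \<Longrightarrow> cotuple X xs \<cdot> coproj (length xs) i = xs ! i"
    unfolding cotuple_def by auto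
qed

lemma cotuple_comp:
  assumes h: "h \<in> hom K X Y" and xs: "set xs \<subseteq> hom K G X"
  shows "h \<cdot> cotuple X xs = cotuple Y (map (\<lambda>x. h \<cdot> x) xs)"
proof -
  have o: "X \<in> Obj K" "Y \<in> Obj K" using hom_objs h by auto
  have ys: "set (map (\<lambda>x. h \<cdot> x) xs) \<subseteq> hom K G Y" using xs comp_hom[OF _ h] by auto
  note t = cotuple[OF o(1) xs] and t' = cotuple[OF o(2) ys, unfolded length_map]
  show ?thesis
  proof (rule tensor_arrow_eq[OF fin_copower Preorder_Id_on comp_hom[OF t(1) h] t'(1)])
    fix i assume "i \<in> Field (Id_on {..<length xs})"
    then have i: "i < length xs" by simp
    show "(h \<cdot> cotuple X xs) \<cdot> coproj (length xs) i = cotuple Y (map (\<lambda>x. h \<cdot> x) xs) \<cdot> coproj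
      (length xs) i"
      using comp_assoc[OF coproj_hom[OF i] t(1) h] t(2)[OF i] t'(2)[OF i] i by simp
  qed
qed

lemma cotuple_le:
  assumes X: "X \<in> Obj K" and le: "list_all2 (\<lambda>x y. (x, y) \<in> hom_poset K G X) xs ys"
  shows "(cotuple X xs, cotuple X ys) \<in> Le K"
proof -
  have l: "length ys = length xs" and xy: "\<And>i. i < length xs \<Longrightarrow> (xs ! i, ys ! i) \<in> hom_poset K G X"
    using le unfolding list_all2_conv_all_nth by auto
  have s: "set xs \<subseteq> hom K G X" "set ys \<subseteq> hom K G X" using list_all2_Field[OF le] by auto
  note t = cotuple[OF X s(1)] and t' = cotuple[OF X s(2), unfolded l]
  show ?thesis
    using tensor_arrow_le[OF fin_copower t(1) t'(1)] t(2) t'(2) xy unfolding hom_poset_iff by simp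
qed

text \<open>
  Operation symbols have to be elements of the universe, so the small set \<open>K(G, n.G)\<close> is encoded
  there.
\<close>

definition enc :: "nat \<Rightarrow> 'a \<Rightarrow> 'u" where
  "enc n = (SOME e. inj_on e (hom K G (copow n)))"

definition sig :: "'u signature" where
  "sig n = enc n ` hom K G (copow n)"

definition dec :: "nat \<Rightarrow> 'u \<Rightarrow> 'a" where
  "dec n = inv_into (hom K G (copow n)) (enc n)"

lemma dec_hom: "\<sigma> \<in> sig n \<Longrightarrow> dec n \<sigma> \<in> hom K G (copow n)"
  unfolding sig_def dec_def by (rule inv_into_into)

lemma dec_surj:
  assumes "s \<in> hom K G (copow n)"
  obtains \<sigma> where "\<sigma> \<in> sig n" "dec n \<sigma> = s"
proof -
  obtain e :: "'a \<Rightarrow> 'u" where "inj_on e (hom K G (copow n))"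
    using small_inj[OF small_hom[OF copow_obj]] .
  then have "inj_on (enc n) (hom K G (copow n))" unfolding enc_def
    by (rule someI[of "\<lambda>e. inj_on e (hom K G (copow n))"])
  then have "dec n (enc n s) = s" unfolding dec_def using assms by (rule inv_into_f_f)
  then show ?thesis using that[of "enc n s"] assms unfolding sig_def by blast
qed

lemma small_sig: "small_signature U sig"
  unfolding small_signature_def sig_def using small_image[OF small_hom[OF copow_obj]] by blast

definition alg :: "'o \<Rightarrow> ('u, 'a) oalg" where
  "alg X = \<lparr>ord = hom_poset K G X, opn = \<lambda>n \<sigma> xs. cotuple X xs \<cdot> dec n \<sigma>\<rparr>"

lemma alg_simps [simp]: "ord (alg X) = hom_poset K G X"
  "opn (alg X) n \<sigma> xs = cotuple X xs \<cdot> dec n \<sigma>"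
  unfolding alg_def by auto

lemma alg_ordered:
  assumes X: "X \<in> Obj K"
  shows "ordered_algebra sig (alg X)"
  unfolding ordered_algebra_def alg_simps
proof (intro conjI allI ballI impI)
  show "Partial_order (hom_poset K G X)" by (rule Partial_order_hom_poset)
  fix n \<sigma> assume s: "\<sigma> \<in> sig n"
  have cl: "cotuple X xs \<cdot> dec n \<sigma> \<in> hom K G X" if "set xs \<subseteq> hom K G X" "length xs = n" for xs
    using comp_hom[OF dec_hom[OF s]] cotuple(1)[OF X that(1)] that(2) by blast
  show "cotuple X xs \<cdot> dec n \<sigma> \<in> Field (hom_poset K G X)"
    if "xs \<in> lists (Field (hom_poset K G X))" "length xs = n" for xs
    using cl[OF _ that(2)] that(1) by (simp add: lists_eq_set)
  fix xs ys assume *: "length xs = n \<and> list_all2 (\<lambda>x y. (x, y) \<in> hom_poset K G X) xs ys"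
  then have l: "length xs = n" "length ys = n" using list_all2_lengthD[OF conjunct2[OF *]] by auto
  have xy: "set xs \<subseteq> hom K G X" "set ys \<subseteq> hom K G X"
    using * list_all2_Field[of "hom_poset K G X" xs ys] by auto
  show "(cotuple X xs \<cdot> dec n \<sigma>, cotuple X ys \<cdot> dec n \<sigma>) \<in> hom_poset K G X"
    unfolding hom_poset_iff
  proof (intro conjI cl[OF xy(1) l(1)] cl[OF xy(2) l(2)])
    show "(cotuple X xs \<cdot> dec n \<sigma>, cotuple X ys \<cdot> dec n \<sigma>) \<in> Le K"
      using comp_le_left[OF cotuple_le[OF X conjunct2[OF *]] dec_hom[OF s]]
        cotuple(1)[OF X xy(1)] cotuple(1)[OF X xy(2)] l by simp
  qed
qed

lemmas alg_preordered = ordered_is_preordered[OF alg_ordered]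

lemma alg_hom:
  assumes h: "h \<in> hom K X Y"
  shows "oalg_hom sig (alg X) (alg Y) (\<lambda>x. h \<cdot> x)"
  unfolding oalg_hom_def
proof (intro conjI allI impI)
  show "mono_rel (ord (alg X)) (ord (alg Y)) (\<lambda>x. h \<cdot> x)"
    unfolding mono_rel_def alg_simps hom_poset_iff using comp_hom[OF _ h] comp_le_right[OF _ _ _ h]
      by blast
  fix \<sigma> xs assume *: "\<sigma> \<in> sig (length xs) \<and> set xs \<subseteq> carr (alg X)"
  then have xs: "set xs \<subseteq> hom K G X" by simp
  show "h \<cdot> opn (alg X) (length xs) \<sigma> xs = opn (alg Y) (length xs) \<sigma> (map (\<lambda>x. h \<cdot> x) xs)"
    using comp_assoc[OF dec_hom cotuple(1)[OF _ xs] h] cotuple_comp[OF h xs] hom_objs[OF h] *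
      by simp
qed

section \<open>Points of tensors are finitary\<close>

definition generated :: "'o \<Rightarrow> ('p \<Rightarrow> 'a) \<Rightarrow> 'p set \<Rightarrow> bool" where
  "generated T \<eta> M \<longleftrightarrow> (\<forall>s\<in>hom K G T. \<exists>\<sigma> xs. \<sigma> \<in> sig (length xs) \<and> set xs \<subseteq> M \<and>
     s = opn (alg T) (length xs) \<sigma> (map \<eta> xs))"

text \<open>
  Abstract finiteness factors \<open>s\<close> through some \<open>M'.G\<close> with \<open>M'\<close> finite. An enumeration \<open>xs\<close> of
  \<open>M'\<close>, of length \<open>n\<close>, gives \<open>r : M'.G \<rightarrow> n.G\<close>, and composing it with the factor \<open>G \<rightarrow> M'.G\<close> of \<open>s\<close>
  yields the operation symbol.
\<close>

lemma copower_generated_in_universe: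
  fixes M :: "'u set"
  assumes M: "small U M" and T: "tensor_arrow K (Id_on M) G T \<eta>"
  shows "generated T \<eta> M"
  unfolding generated_def
proof
  fix s assume s: "s \<in> hom K G T"
  have TO: "T \<in> Obj K" using T unfolding tensor_arrow_def by blast
  note P = Preorder_Id_on
  obtain \<phi> where phi: "copower K M G T \<phi>"
    and phi': "\<forall>X. \<forall>f \<in> mono_maps (Id_on M) (hom_poset K G X). X \<in> Obj K \<longrightarrow>
       \<phi> X f \<in> hom K T X \<and> (\<forall>p\<in>Field (Id_on M). \<phi> X f \<cdot> \<eta> p = f p)"
    using tensor_if_tensor_arrow[OF T P] .
  define \<iota> where "\<iota> = injections K M G T \<phi>"
  note iota = tensor_arrow_if_tensor[OF phi P \<iota>_def[unfolded injections_def]]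
  have etah: "\<eta> p \<in> hom K G T" and iotah: "\<iota> p \<in> hom K G T" if "p \<in> M" for p
    using copower_hom[OF T that] copower_hom[OF iota(1) that] .
  have "\<iota> p = \<eta> p" if p: "p \<in> M" for p
  proof -
    have m: "restrict \<eta> M \<in> mono_maps (Id_on M) (hom_poset K G T)"
      using mono_rel_restrict[of "Id_on M" "hom_poset K G T" \<eta>] etah unfolding mono_rel_Id_on
        by simp
    have h: "\<phi> T (restrict \<eta> M) \<in> hom K T T" "\<forall>p\<in>M. \<phi> T (restrict \<eta> M) \<cdot> \<eta> p = \<eta> p"
      using phi'[rule_format, OF m TO] by auto
    have "\<phi> T (restrict \<eta> M) = Idt K T"
      using tensor_arrow_eq[OF T P h(1) id_hom[OF TO]] h(2) comp_id_left[OF etah] by simp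
    then have "Idt K T \<cdot> \<iota> p = restrict \<eta> M p" using iota(2)[OF TO m, of p] p by (metis Field_Id_on)
    then show ?thesis using p comp_id_left[OF iotah[OF p]] by simp
  qed
  note iota_eta = this
  obtain M' T' \<phi>' g where M': "finite M'" "M' \<subseteq> M" and T': "copower K M' G T' \<phi>'"
    and g: "g \<in> hom K G T'"
    and sg: "s = copower_inclusion K G M' \<phi>' M T \<phi> \<cdot> g"
    using finite_gen M phi s unfolding abstractly_finite_def by meson
  define \<eta>' where "\<eta>' = injections K M' G T' \<phi>'"
  note eta' = tensor_arrow_if_tensor[OF T' P \<eta>'_def[unfolded injections_def]]
  have etah': "\<eta>' p \<in> hom K G T'" if "p \<in> M'" for p using copower_hom[OF eta'(1) that] .
  define i where "i = copower_inclusion K G M' \<phi>' M T \<phi>"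
  have m: "restrict \<iota> M' \<in> mono_maps (Id_on M') (hom_poset K G T)"
    using mono_rel_restrict[of "Id_on M'" "hom_poset K G T" \<iota>] iotah M'(2) unfolding mono_rel_Id_on
      by auto
  have ih: "i \<in> hom K T' T"
    using eta'(3)[OF TO m] unfolding i_def copower_inclusion_def \<iota>_def[symmetric] .
  have i: "i \<cdot> \<eta>' p = \<eta> p" if p: "p \<in> M'" for p
  proof -
    have "i \<cdot> \<eta>' p = restrict \<iota> M' p"
      using eta'(2)[OF TO m, of p] p
      unfolding i_def copower_inclusion_def \<iota>_def[symmetric] Field_Id_on by blast
    then show ?thesis using p iota_eta M'(2) by auto
  qed
  obtain xs where xs: "set xs = M'" using finite_list[OF M'(1)] by blast
  define n where "n = length xs"
  have "\<forall>p\<in>M'. \<exists>k. k < n \<and> xs ! k = p" using xs unfolding n_def in_set_conv_nth[symmetric] by blast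
  then obtain idx where idx: "\<forall>p\<in>M'. idx p < n \<and> xs ! idx p = p" by metis
  obtain r where r: "r \<in> hom K T' (copow n)" "\<forall>p\<in>M'. r \<cdot> \<eta>' p = coproj n (idx p)"
    using copower_cotuple[OF eta'(1) copow_obj, of "\<lambda>p. coproj n (idx p)"] idx coproj_hom by blast
  have etas: "set (map \<eta> xs) \<subseteq> hom K G T" using etah xs M'(2) by auto
  note k = cotuple[OF TO etas, unfolded length_map n_def[symmetric]]
  have "cotuple T (map \<eta> xs) \<cdot> r = i"
  proof (rule tensor_arrow_eq[OF eta'(1) P comp_hom[OF r(1) k(1)] ih])
    fix p assume "p \<in> Field (Id_on M')"
    then have p: "p \<in> M'" by simp
    show "(cotuple T (map \<eta> xs) \<cdot> r) \<cdot> \<eta>' p = i \<cdot> \<eta>' p"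
      using comp_assoc[OF etah'[OF p] r(1) k(1)] r(2) p k(2)[of "idx p"] idx i[OF p] n_def by simp
  qed
  then have "s = cotuple T (map \<eta> xs) \<cdot> (r \<cdot> g)"
    using sg comp_assoc[OF g r(1) k(1)] unfolding i_def by simp
  moreover obtain \<sigma> where "\<sigma> \<in> sig n" "dec n \<sigma> = r \<cdot> g" using dec_surj[OF comp_hom[OF g r(1)]] .
  ultimately show "\<exists>\<sigma> xs. \<sigma> \<in> sig (length xs) \<and> set xs \<subseteq> M \<and>
     s = opn (alg T) (length xs) \<sigma> (map \<eta> xs)"
    using xs M'(2) unfolding n_def by (intro exI[of _ \<sigma>] exI[of _ xs]) simp
qed

lemma copower_generated:
  fixes M :: "'p set"
  assumes M: "small U M" and T: "tensor_arrow K (Id_on M) G T \<eta>"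
  shows "generated T \<eta> M"
proof -
  obtain q :: "'p \<Rightarrow> 'u" where q: "inj_on q M" using small_inj[OF M] .
  define r where "r = inv_into M q"
  have r: "bij_betw r (q ` M) M" unfolding r_def
    using bij_betw_inv_into[OF inj_on_imp_bij_betw[OF q]] .
  have "tensor_arrow K (Id_on (q ` M)) G T (\<eta> \<circ> r)"
  proof (rule tensor_arrow_reindex[OF T])
    show "bij_betw r (Field (Id_on (q ` M))) (Field (Id_on M))" using r by simp
    fix x y assume "x \<in> Field (Id_on (q ` M))" "y \<in> Field (Id_on (q ` M))"
    then show "(x, y) \<in> Id_on (q ` M) \<longleftrightarrow> (r x, r y) \<in> Id_on M"
      using r unfolding bij_betw_def inj_on_def by (auto simp: Id_on_iff)
  qed
  from copower_generated_in_universe[OF small_image[OF M] this]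
  have gen: "generated T (\<eta> \<circ> r) (q ` M)" .
  show ?thesis
    unfolding generated_def
  proof
    fix s assume "s \<in> hom K G T"
    then obtain \<sigma> xs where *: "\<sigma> \<in> sig (length xs)" "set xs \<subseteq> q ` M"
      "s = opn (alg T) (length xs) \<sigma> (map (\<eta> \<circ> r) xs)"
      using gen unfolding generated_def by blast
    moreover have "set (map r xs) \<subseteq> M" using *(2) r unfolding bij_betw_def by auto
    ultimately show "\<exists>\<sigma> xs. \<sigma> \<in> sig (length xs) \<and> set xs \<subseteq> M \<and>
        s = opn (alg T) (length xs) \<sigma> (map \<eta> xs)"
      by (intro exI[of _ \<sigma>] exI[of _ "map r xs"]) simp
  qed
qed

lemma reflexive_pairI:
  assumes "u0 \<in> hom K Z X" "u1 \<in> hom K Z X" "d \<in> hom K X Z" "u0 \<cdot> d = Idt K X" "u1 \<cdot> d = Idt K X"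
  shows "reflexive_pair K u0 u1"
  using assms unfolding reflexive_pair_def parallel_pair_def hom_def by auto

text \<open>
  A parallel pair out of a copower \<open>N.G\<close> is given by two families of points. It is reflexive as
  soon as each universal point of \<open>D = M.G\<close> occurs as a common component of the two families.
\<close>

lemma copower_pair:
  assumes D: "tensor_arrow K (Id_on M) G D \<delta>" and N: "small U N"
    and p: "\<forall>x\<in>N. p0 x \<in> hom K G D" "\<forall>x\<in>N. p1 x \<in> hom K G D"
    and diag: "\<forall>x\<in>M. \<exists>y\<in>N. p0 y = \<delta> x \<and> p1 y = \<delta> x"
  obtains L \<nu> u0 u1 where "tensor_arrow K (Id_on N) G L \<nu>" "u0 \<in> hom K L D" "u1 \<in> hom K L D"
    "\<forall>x\<in>N. u0 \<cdot> \<nu> x = p0 x" "\<forall>x\<in>N. u1 \<cdot> \<nu> x = p1 x" "reflexive_pair K u0 u1"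
proof -
  obtain L \<nu> where L: "tensor_arrow K (Id_on N) G L \<nu>" using copower_exists[OF N] by blast
  have o: "D \<in> Obj K" "L \<in> Obj K" using D L unfolding tensor_arrow_def by auto
  obtain u0 where u0: "u0 \<in> hom K L D" "\<forall>x\<in>N. u0 \<cdot> \<nu> x = p0 x"
    using copower_cotuple[OF L o(1) p(1)] .
  obtain u1 where u1: "u1 \<in> hom K L D" "\<forall>x\<in>N. u1 \<cdot> \<nu> x = p1 x"
    using copower_cotuple[OF L o(1) p(2)] .
  obtain y where y: "\<forall>x\<in>M. y x \<in> N \<and> p0 (y x) = \<delta> x \<and> p1 (y x) = \<delta> x" using diag by metis
  have nuh: "\<nu> (y x) \<in> hom K G L" if "x \<in> M" for x using copower_hom[OF L] y that by blast
  obtain d where d: "d \<in> hom K D L" "\<forall>x\<in>M. d \<cdot> \<delta> x = \<nu> (y x)"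
    using copower_cotuple[OF D o(2), of "\<lambda>x. \<nu> (y x)"] nuh by blast
  have dh: "\<delta> x \<in> hom K G D" if "x \<in> M" for x using copower_hom[OF D that] .
  have "u0 \<cdot> d = Idt K D"
    using tensor_arrow_eq[OF D Preorder_Id_on comp_hom[OF d(1) u0(1)] id_hom[OF o(1)]]
      comp_assoc[OF dh d(1) u0(1)] comp_id_left[OF dh] d(2) u0(2) y by simp
  moreover have "u1 \<cdot> d = Idt K D"
    using tensor_arrow_eq[OF D Preorder_Id_on comp_hom[OF d(1) u1(1)] id_hom[OF o(1)]]
      comp_assoc[OF dh d(1) u1(1)] comp_id_left[OF dh] d(2) u1(2) y by simp
  ultimately have "reflexive_pair K u0 u1" using reflexive_pairI[OF u0(1) u1(1) d(1)] by blast
  then show ?thesis using L u0 u1 by (intro that)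
qed

text \<open>
  The comparison \<open>e : |P|.G \<rightarrow> P \<otimes> G\<close> is the coinserter of the reflexive pair that is indexed by
  the order relation \<open>P\<close>, since a morphism out of \<open>|P|.G\<close> respects this pair exactly if it is
  monotone in \<open>P\<close>. By projectivity \<open>e\<close> is onto on points, and those of \<open>|P|.G\<close> are already known
  to be generated.
\<close>

lemma tensor_generated:
  fixes P :: "'p rel"
  assumes P: "Preorder P" "small U (Field P)" and T: "tensor_arrow K P G T \<eta>"
  shows "generated T \<eta> (Field P)"
proof -
  have TO: "T \<in> Obj K" and etam: "mono_rel P (hom_poset K G T) \<eta>" using T unfolding tensor_arrow_def
    by auto
  obtain D \<delta> where D: "tensor_arrow K (Id_on (Field P)) G D \<delta>" using copower_exists[OF P(2)]
    by blast
  have dh: "\<delta> x \<in> hom K G D" and eh: "\<eta> x \<in> hom K G T" if "x \<in> Field P" for x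
    using copower_hom[OF D that] tensor_arrow_hom[OF T P(1) that] .
  obtain e where e: "e \<in> hom K D T" "\<forall>x\<in>Field P. e \<cdot> \<delta> x = \<eta> x"
    using copower_cotuple[OF D TO, of \<eta>] eh by blast
  have PF: "fst z \<in> Field P \<and> snd z \<in> Field P" if "z \<in> P" for z
    using that by (cases z) (auto intro: FieldI1 FieldI2)
  have "P \<subseteq> Field P \<times> Field P" using PF by auto
  then have "small U P" using small_subset small_Times[OF universe P(2,2)] by blast
  moreover have "\<forall>z\<in>P. \<delta> (fst z) \<in> hom K G D" "\<forall>z\<in>P. \<delta> (snd z) \<in> hom K G D" using PF dh by auto
  moreover have "\<forall>x\<in>Field P. \<exists>z\<in>P. \<delta> (fst z) = \<delta> x \<and> \<delta> (snd z) = \<delta> x"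
    using preorder_refl[OF P(1)] by force
  ultimately obtain L \<nu> u0 u1 where L: "tensor_arrow K (Id_on P) G L \<nu>" and u: "u0 \<in> hom K L D"
    "u1 \<in> hom K L D"
    "\<forall>z\<in>P. u0 \<cdot> \<nu> z = \<delta> (fst z)" "\<forall>z\<in>P. u1 \<cdot> \<nu> z = \<delta> (snd z)" and r: "reflexive_pair K u0 u1"
    by (rule copower_pair[OF D])
  have nuh: "\<nu> z \<in> hom K G L" if "z \<in> P" for z using copower_hom[OF L that] .
  have insert: "(h \<cdot> u0, h \<cdot> u1) \<in> Le K \<longleftrightarrow> (\<forall>x y. (x, y) \<in> P \<longrightarrow> (h \<cdot> \<delta> x, h \<cdot> \<delta> y) \<in> Le K)"
    if h: "h \<in> hom K D W" for h W
  proof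
    assume le: "(h \<cdot> u0, h \<cdot> u1) \<in> Le K"
    show "\<forall>x y. (x, y) \<in> P \<longrightarrow> (h \<cdot> \<delta> x, h \<cdot> \<delta> y) \<in> Le K"
    proof (intro allI impI)
      fix x y assume xy: "(x, y) \<in> P"
      show "(h \<cdot> \<delta> x, h \<cdot> \<delta> y) \<in> Le K"
        using comp_le_left[OF le nuh[OF xy] comp_hom[OF u(1) h] comp_hom[OF u(2) h]]
          comp_assoc[OF nuh[OF xy] u(1) h] comp_assoc[OF nuh[OF xy] u(2) h] u(3,4) xy by auto
    qed
  next
    assume *: "\<forall>x y. (x, y) \<in> P \<longrightarrow> (h \<cdot> \<delta> x, h \<cdot> \<delta> y) \<in> Le K"
    show "(h \<cdot> u0, h \<cdot> u1) \<in> Le K"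
    proof (rule tensor_arrow_le[OF L comp_hom[OF u(1) h] comp_hom[OF u(2) h]])
      fix z assume "z \<in> Field (Id_on P)"
      then have z: "z \<in> P" by simp
      show "((h \<cdot> u0) \<cdot> \<nu> z, (h \<cdot> u1) \<cdot> \<nu> z) \<in> Le K"
        using comp_assoc[OF nuh[OF z] u(1) h] comp_assoc[OF nuh[OF z] u(2) h] u(3,4) z *
          by (cases z) auto
    qed
  qed
  have "coinserter K u0 u1 e"
  proof (rule coinserterI[OF u(1,2) e(1)])
    show "(e \<cdot> u0, e \<cdot> u1) \<in> Le K"
      unfolding insert[OF e(1)] using e(2) etam unfolding mono_rel_def hom_poset_iff
      by (metis FieldI1 FieldI2)
  next
    fix W f' assume f': "f' \<in> hom K D W" and le: "(f' \<cdot> u0, f' \<cdot> u1) \<in> Le K"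
    have W: "W \<in> Obj K" using hom_objs[OF f'] by blast
    have "mono_rel P (hom_poset K G W) (\<lambda>x. f' \<cdot> \<delta> x)"
      using le[unfolded insert[OF f']] comp_hom[OF dh f'] unfolding mono_rel_def hom_poset_iff
      by (auto intro: FieldI1 FieldI2)
    then obtain g where g: "g \<in> hom K T W" "\<forall>x\<in>Field P. g \<cdot> \<eta> x = f' \<cdot> \<delta> x"
      using tensor_arrow_cotuple[OF T W] by blast
    have "f' = g \<cdot> e"
      using tensor_arrow_eq[OF D Preorder_Id_on f' comp_hom[OF e(1) g(1)]] comp_assoc[OF dh e(1)
        g(1)] e(2) g(2) by simp
    then show "\<exists>g\<in>hom K T W. f' = g \<cdot> e" using g(1) by blast
  next
    fix W g g' assume g: "g \<in> hom K T W" "g' \<in> hom K T W" and le: "(g \<cdot> e, g' \<cdot> e) \<in> Le K"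
    show "(g, g') \<in> Le K"
    proof (rule tensor_arrow_le[OF T g])
      fix x assume x: "x \<in> Field P"
      show "(g \<cdot> \<eta> x, g' \<cdot> \<eta> x) \<in> Le K"
        using comp_le_left[OF le dh[OF x] comp_hom[OF e(1) g(1)] comp_hom[OF e(1) g(2)]]
          comp_assoc[OF dh[OF x] e(1) g(1)] comp_assoc[OF dh[OF x] e(1) g(2)] e(2) x by simp
    qed
  qed
  then have surj: "(\<lambda>x. e \<cdot> x) ` hom K G D = hom K G T"
    using hom_preserves_coinserter[OF u(1,2) e(1) r] unfolding poset_coinserter_def by simp
  show ?thesis
    unfolding generated_def
  proof
    fix s assume "s \<in> hom K G T"
    then obtain s' where s': "s' \<in> hom K G D" "s = e \<cdot> s'" using surj by blast
    obtain \<sigma> xs where *: "\<sigma> \<in> sig (length xs)" "set xs \<subseteq> Field P"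
      "s' = opn (alg D) (length xs) \<sigma> (map \<delta> xs)"
      using copower_generated[OF P(2) D] s'(1) unfolding generated_def by blast
    have "set (map \<delta> xs) \<subseteq> carr (alg D)" using *(2) dh by auto
    then have "s = opn (alg T) (length xs) \<sigma> (map (\<lambda>x. e \<cdot> x) (map \<delta> xs))"
      using oalg_hom_opn[OF alg_hom[OF e(1)], of \<sigma> "map \<delta> xs"] *(1,3) s'(2) by simp
    moreover have "map (\<lambda>x. e \<cdot> x) (map \<delta> xs) = map \<eta> xs" using e(2) *(2) by auto
    ultimately show "\<exists>\<sigma> xs. \<sigma> \<in> sig (length xs) \<and> set xs \<subseteq> Field P \<and>
        s = opn (alg T) (length xs) \<sigma> (map \<eta> xs)"
      using *(1,2) by metis
  qed
qed

section \<open>The equivalence with the variety\<close>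

text \<open>
  Let \<open>k : K(G, X) \<otimes> G \<rightarrow> Y\<close> be induced by \<open>a\<close>. As the points of the tensor are generated and \<open>a\<close>
  preserves operations, \<open>k \<cdot> s = a (c \<cdot> s)\<close> for every point \<open>s\<close>, not only for the universal ones.
  So \<open>k\<close> puts in order whatever the coinserter \<open>c\<close> puts in order, and factors through \<open>c\<close>.
\<close>

lemma full:
  assumes o: "X \<in> Obj K" "Y \<in> Obj K" and a: "oalg_hom sig (alg X) (alg Y) a"
  obtains h where "h \<in> hom K X Y" "\<forall>x\<in>hom K G X. h \<cdot> x = a x"
proof -
  let ?P = "hom_poset K G X"
  have P: "Preorder ?P" "small U (Field ?P)"
    using Partial_order_hom_poset small_hom[OF o(1)] unfolding partial_order_on_def by auto
  obtain T \<eta> c u0 u1 where T: "tensor_arrow K ?P G T \<eta>" and c: "c \<in> hom K T X"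
    "\<forall>f\<in>hom K G X. c \<cdot> \<eta> f = f" "coinserter K u0 u1 c"
    by (rule canonical_coinserter[OF o(1)])
  have eh: "\<eta> x \<in> hom K G T" if "x \<in> hom K G X" for x using tensor_arrow_hom[OF T P(1)] that by simp
  have "mono_rel ?P (hom_poset K G Y) a" using a unfolding oalg_hom_def by simp
  then obtain k where k: "k \<in> hom K T Y" "\<forall>x\<in>hom K G X. k \<cdot> \<eta> x = a x"
    using tensor_arrow_cotuple[OF T o(2)] by (metis Field_hom_poset)
  have kc: "k \<cdot> s = a (c \<cdot> s)" if s: "s \<in> hom K G T" for s
  proof -
    obtain \<sigma> xs where *: "\<sigma> \<in> sig (length xs)" "set xs \<subseteq> hom K G X"
      "s = opn (alg T) (length xs) \<sigma> (map \<eta> xs)"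
      using tensor_generated[OF P T] s unfolding generated_def by auto
    have xs: "set (map \<eta> xs) \<subseteq> carr (alg T)" using *(2) eh by auto
    have "c \<cdot> s = opn (alg X) (length xs) \<sigma> (map (\<lambda>x. c \<cdot> x) (map \<eta> xs))"
      using oalg_hom_opn[OF alg_hom[OF c(1)], of \<sigma> "map \<eta> xs"] xs *(1,3) by simp
    also have "map (\<lambda>x. c \<cdot> x) (map \<eta> xs) = xs"
      unfolding map_map using c(2) *(2) by (intro map_idI) auto
    finally have "a (c \<cdot> s) = opn (alg Y) (length xs) \<sigma> (map a xs)"
      using oalg_hom_opn[OF a *(1)] *(2) by simp
    also have "map a xs = map (\<lambda>x. k \<cdot> x) (map \<eta> xs)" using k(2) *(2) by auto
    also have "opn (alg Y) (length xs) \<sigma> (map (\<lambda>x. k \<cdot> x) (map \<eta> xs)) = k \<cdot> s"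
      using oalg_hom_opn[OF alg_hom[OF k(1)], of \<sigma> "map \<eta> xs"] xs *(1,3) by simp
    finally show ?thesis by simp
  qed
  obtain Z X' Y' where Z: "u0 \<in> hom K Z X'" "u1 \<in> hom K Z X'" "c \<in> hom K X' Y'"
    using coinserterE[OF c(3)] .
  then have u: "u0 \<in> hom K Z T" "u1 \<in> hom K Z T" using c(1) unfolding hom_def by auto
  have "(k \<cdot> u0, k \<cdot> u1) \<in> Le K"
  proof (rule hom_le_if_points_le[OF comp_hom[OF u(1) k(1)] comp_hom[OF u(2) k(1)]])
    fix w assume w: "w \<in> hom K G Z"
    note eval_cotuple = comp_hom[OF w u(1)] comp_hom[OF w u(2)]
    have "((c \<cdot> u0) \<cdot> w, (c \<cdot> u1) \<cdot> w) \<in> Le K"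
      using comp_le_left[OF coinserter_le[OF c(3)] w comp_hom[OF u(1) c(1)] comp_hom[OF u(2) c(1)]]
        .
    then have "(c \<cdot> (u0 \<cdot> w), c \<cdot> (u1 \<cdot> w)) \<in> hom_poset K G X"
      unfolding hom_poset_iff using comp_assoc[OF w u(1) c(1)] comp_assoc[OF w u(2) c(1)]
        comp_hom[OF eval_cotuple(1) c(1)] comp_hom[OF eval_cotuple(2) c(1)] by simp
    then have "(a (c \<cdot> (u0 \<cdot> w)), a (c \<cdot> (u1 \<cdot> w))) \<in> Le K"
      using oalg_hom_mono[OF a, of "c \<cdot> (u0 \<cdot> w)" "c \<cdot> (u1 \<cdot> w)"] by (simp add: hom_poset_iff)
    then show "((k \<cdot> u0) \<cdot> w, (k \<cdot> u1) \<cdot> w) \<in> Le K"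
      using kc[OF eval_cotuple(1)] kc[OF eval_cotuple(2)] comp_assoc[OF w u(1) k(1)]
        comp_assoc[OF w u(2) k(1)] by simp
  qed
  then obtain h where h: "h \<in> hom K X Y" "k = h \<cdot> c" using coinserter_factor[OF c(3,1) k(1)]
    by blast
  have "h \<cdot> x = a x" if x: "x \<in> hom K G X" for x
    using comp_assoc[OF eh[OF x] c(1) h(1)] h(2) c(2) k(2) x by simp
  then show ?thesis using h(1) that by blast
qed

definition ineqs :: "('u trm \<times> 'u trm) set" where
  "ineqs = {(s, t). is_term sig s \<and> is_term sig t \<and> (\<forall>X\<in>Obj K. satisfies (alg X) s t)}"

lemma alg_model: "X \<in> Obj K \<Longrightarrow> alg X \<in> models U sig ineqs"
  unfolding models_def ineqs_def using alg_ordered small_hom by auto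

text \<open>
  Only finitely many variables occur, so they can be renamed to natural numbers, which makes the
  inequation a member of \<open>ineqs\<close>.
\<close>

lemma valid_inequation:
  fixes A :: "('u, 'c) oalg"
  assumes A: "A \<in> models U sig ineqs" and t: "t \<in> tms sig M" "t' \<in> tms sig M"
    and v: "v ` M \<subseteq> carr A"
    and valid: "\<And>X w. X \<in> Obj K \<Longrightarrow> w ` M \<subseteq> hom K G X \<Longrightarrow>
      (eval_tm (alg X) w t, eval_tm (alg X) w t') \<in> hom_poset K G X"
  shows "(eval_tm A v t, eval_tm A v t') \<in> ord A"
proof -
  define W where "W = vars t \<union> vars t'"
  have W: "finite W" "t \<in> tms sig W" "t' \<in> tms sig W" "W \<subseteq> M"
    using t finite_vars unfolding W_def tms_def by auto
  obtain f :: "_ \<Rightarrow> nat" where f: "inj_on f W"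
    using finite_imp_inj_to_nat_seg[OF W(1)] by blast
  have "(rename f t, rename f t') \<in> ineqs"
    unfolding ineqs_def satisfies_def
    using is_term_rename[OF t(1)] is_term_rename[OF t(2)] valid
      by (auto simp: image_subset_iff eval_rename)
  then have sat: "satisfies A (rename f t) (rename f t')" using A unfolding models_def by blast
  \<comment> \<open>A value for the numbers that name no variable; the carrier of \<open>A\<close> is not empty because \<open>t\<close>
      has a value in it.\<close>
  define a0 where "a0 = eval_tm A v t"
  have a0: "a0 \<in> carr A" unfolding a0_def using eval_tm_closed[OF model_preordered[OF A] t(1) v] .
  define w where "w i = (if i \<in> f ` W then v (inv_into W f i) else a0)" for i
  have wf: "w (f x) = v x" if "x \<in> W" for x
    unfolding w_def using that f by (simp add: inv_into_f_f)
  have "w i \<in> carr A" for i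
  proof (cases "i \<in> f ` W")
    case True
    then show ?thesis using wf v W(4) by auto
  next
    case False
    then show ?thesis unfolding w_def using a0 by simp
  qed
  then have "range w \<subseteq> carr A" by blast
  then show ?thesis
    using wf sat eval_tm_cong[OF W(2), of "\<lambda>x. w (f x)" v] eval_tm_cong[OF W(3), of "\<lambda>x. w (f x)" v]
    unfolding satisfies_def eval_rename by metis
qed

text \<open>
  Let \<open>F\<close> be the copower \<open>|A|.G\<close>. Its points are values of terms in the elements of \<open>A\<close>, and
  evaluating these terms in \<open>A\<close> instead is a well-defined homomorphism \<open>ev\<close>: an inequality between
  two values in \<open>F\<close> holds under all valuations in all algebras of points, as these are images of
  the one in \<open>F\<close>, and so also in \<open>A\<close>. The coinserter \<open>q\<close> of the pair indexed by all \<open>(s, t)\<close> with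
  \<open>ev s \<le> ev t\<close> then orders the points as \<open>ev\<close> does.
\<close>

lemma essentially_surjective:
  fixes A :: "('u, 'u) oalg"
  assumes A: "A \<in> models U sig ineqs"
  shows "\<exists>X\<in>Obj K. \<exists>i. oalg_iso sig A (alg X) i"
proof -
  define M where "M = carr A"
  have M: "small U M" unfolding M_def using model_small[OF A] .
  obtain F \<eta> where F: "tensor_arrow K (Id_on M) G F \<eta>" using copower_exists[OF M] by blast
  have FO: "F \<in> Obj K" using F unfolding tensor_arrow_def by blast
  have eh: "\<eta> x \<in> hom K G F" if "x \<in> M" for x using copower_hom[OF F that] .
  have em: "\<eta> ` M \<subseteq> carr (alg F)" using eh by auto
  have term_rep: "\<exists>t. t \<in> tms sig M \<and> s = eval_tm (alg F) \<eta> t" if s: "s \<in> hom K G F" for s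
  proof -
    obtain \<sigma> xs where *: "\<sigma> \<in> sig (length xs)" "set xs \<subseteq> M"
      "s = opn (alg F) (length xs) \<sigma> (map \<eta> xs)"
      using copower_generated[OF M F] s unfolding generated_def by blast
    then have "TOp \<sigma> (map TVar xs) \<in> tms sig M \<and> s = eval_tm (alg F) \<eta> (TOp \<sigma> (map TVar xs))"
      by (auto simp: comp_def)
    then show ?thesis by blast
  qed
  have eval_le: "(eval_tm A (\<lambda>x. x) t, eval_tm A (\<lambda>x. x) t') \<in> ord A"
    if t: "t \<in> tms sig M" "t' \<in> tms sig M"
      and le: "(eval_tm (alg F) \<eta> t, eval_tm (alg F) \<eta> t') \<in> hom_poset K G F" for t t'
  proof (rule valid_inequation[OF A t])
    show "(\<lambda>x. x) ` M \<subseteq> carr A" unfolding M_def by simp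
    fix X w assume X: "X \<in> Obj K" and w: "w ` M \<subseteq> hom K G X"
    obtain h where h: "h \<in> hom K F X" "\<forall>x\<in>M. h \<cdot> \<eta> x = w x"
      using copower_cotuple[OF F X, of w] w by blast
    have "h \<cdot> eval_tm (alg F) \<eta> t = eval_tm (alg X) w t" if t: "t \<in> tms sig M" for t
      using hom_eval_tm[OF alg_preordered[OF FO] alg_hom[OF h(1)] t em]
        eval_tm_cong[OF t, of "\<lambda>x. h \<cdot> \<eta> x" w] h(2) by simp
    then show "(eval_tm (alg X) w t, eval_tm (alg X) w t') \<in> hom_poset K G X"
      using oalg_hom_mono[OF alg_hom[OF h(1)]] le t by (metis alg_simps(1))
  qed
  define ev where "ev s = eval_tm A (\<lambda>x. x) (SOME t. t \<in> tms sig M \<and> s = eval_tm (alg F) \<eta> t)" for s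
  have ev: "ev (eval_tm (alg F) \<eta> t) = eval_tm A (\<lambda>x. x) t" if t: "t \<in> tms sig M" for t
  proof -
    have s: "eval_tm (alg F) \<eta> t \<in> hom K G F"
      using eval_tm_closed[OF alg_preordered[OF FO] t em] by simp
    define t' where "t' = (SOME t'. t' \<in> tms sig M \<and> eval_tm (alg F) \<eta> t = eval_tm (alg F) \<eta> t')"
    have t': "t' \<in> tms sig M" "eval_tm (alg F) \<eta> t = eval_tm (alg F) \<eta> t'"
      using someI_ex[OF term_rep[OF s]] unfolding t'_def by blast+
    have "(eval_tm (alg F) \<eta> t, eval_tm (alg F) \<eta> t) \<in> hom_poset K G F"
      using s le_refl[OF s] unfolding hom_poset_iff by blast
    then have "eval_tm A (\<lambda>x. x) t = eval_tm A (\<lambda>x. x) t'"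
      using eval_le[OF t t'(1)] eval_le[OF t'(1) t] t'(2) model_eqI[OF A] by simp
    then show ?thesis unfolding ev_def t'_def by simp
  qed
  have ev_hom: "oalg_hom sig (alg F) A ev"
    unfolding oalg_hom_def
  proof (intro conjI allI impI)
    show "mono_rel (ord (alg F)) (ord A) ev"
      unfolding mono_rel_def
    proof (intro allI impI)
      fix s s' assume le: "(s, s') \<in> ord (alg F)"
      then obtain t t' where "t \<in> tms sig M" "s = eval_tm (alg F) \<eta> t" "t' \<in> tms sig M"
        "s' = eval_tm (alg F) \<eta> t'"
        using term_rep[of s] term_rep[of s'] by (auto simp: hom_poset_iff)
      then show "(ev s, ev s') \<in> ord A" using ev eval_le le by simp
    qed
    fix \<sigma> xs assume *: "\<sigma> \<in> sig (length xs) \<and> set xs \<subseteq> carr (alg F)"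
    then have "\<forall>s\<in>set xs. \<exists>t. t \<in> tms sig M \<and> s = eval_tm (alg F) \<eta> t" using term_rep by auto
    then obtain tt where tt: "\<forall>s\<in>set xs. tt s \<in> tms sig M \<and> eval_tm (alg F) \<eta> (tt s) = s" by metis
    have x: "map (eval_tm (alg F) \<eta>) (map tt xs) = xs"
      unfolding map_map using tt by (intro map_idI) auto
    have "TOp \<sigma> (map tt xs) \<in> tms sig M" using tt * by auto
    from ev[OF this] have "ev (opn (alg F) (length xs) \<sigma> xs) = opn A (length xs) \<sigma>
      (map (eval_tm A (\<lambda>x. x)) (map tt xs))"
      using x by simp
    also have "map (eval_tm A (\<lambda>x. x)) (map tt xs) = map ev xs"
      unfolding map_map
    proof (rule map_cong[OF refl])
      fix s assume "s \<in> set xs"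
      then show "(eval_tm A (\<lambda>x. x) \<circ> tt) s = ev s" using ev[of "tt s"] tt by simp
    qed
    finally show "ev (opn (alg F) (length xs) \<sigma> xs) = opn A (length xs) \<sigma> (map ev xs)" .
  qed
  have ev_eta: "ev (\<eta> x) = x" if "x \<in> M" for x
    using ev[of "TVar x"] that by simp
  define N where "N = {(s, t). s \<in> hom K G F \<and> t \<in> hom K G F \<and> (ev s, ev t) \<in> ord A}"
  have N: "small U N"
    using small_subset[OF small_Times[OF universe small_hom[OF FO] small_hom[OF FO]], of N]
      unfolding N_def by blast
  have N': "\<forall>z\<in>N. fst z \<in> hom K G F" "\<forall>z\<in>N. snd z \<in> hom K G F" unfolding N_def by auto
  have diag: "\<forall>x\<in>M. \<exists>z\<in>N. fst z = \<eta> x \<and> snd z = \<eta> x"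
  proof
    fix x assume x: "x \<in> M"
    have "(ev (\<eta> x), ev (\<eta> x)) \<in> ord A"
      using preorder_refl[OF model_Preorder[OF A]] x ev_eta unfolding M_def by simp
    then have "(\<eta> x, \<eta> x) \<in> N" unfolding N_def using eh[OF x] by blast
    then show "\<exists>z\<in>N. fst z = \<eta> x \<and> snd z = \<eta> x" by force
  qed
  obtain L \<nu> u0 u1 where L: "tensor_arrow K (Id_on N) G L \<nu>" and u: "u0 \<in> hom K L F"
    "u1 \<in> hom K L F"
    "\<forall>z\<in>N. u0 \<cdot> \<nu> z = fst z" "\<forall>z\<in>N. u1 \<cdot> \<nu> z = snd z" and r: "reflexive_pair K u0 u1"
    using copower_pair[OF F N N' diag] .
  have LO: "L \<in> Obj K" using L unfolding tensor_arrow_def by blast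
  obtain q where q: "coinserter K u0 u1 q" using reflexive_coinserters r
    unfolding has_reflexive_coinserters_def by blast
  obtain Z X' X where "u0 \<in> hom K Z X'" "q \<in> hom K X' X" using coinserterE[OF q] by metis
  then have qh: "q \<in> hom K F X" using u(1) unfolding hom_def by auto
  have X: "X \<in> Obj K" using hom_objs[OF qh] by blast
  have pc: "poset_coinserter (hom_poset K G F) (hom_poset K G X)
          (inserted (\<lambda>z. u0 \<cdot> z) (\<lambda>z. u1 \<cdot> z) (hom K G L)) (\<lambda>x. q \<cdot> x)"
    using hom_preserves_coinserter[OF u(1,2) qh r q] .
  have ins: "(ev (u0 \<cdot> w), ev (u1 \<cdot> w)) \<in> ord A" if w: "w \<in> hom K G L" for w
  proof -
    obtain \<sigma> zs where *: "\<sigma> \<in> sig (length zs)" "set zs \<subseteq> N"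
      "w = opn (alg L) (length zs) \<sigma> (map \<nu> zs)"
      using copower_generated[OF N L] w unfolding generated_def by blast
    have nz: "set (map \<nu> zs) \<subseteq> carr (alg L)" using *(2) copower_hom[OF L] by auto
    have eval_cotuple: "ev (u \<cdot> w) = opn A (length zs) \<sigma> (map ev (map p zs))"
      if u: "u \<in> hom K L F" "\<forall>z\<in>N. u \<cdot> \<nu> z = p z" and p: "\<forall>z\<in>N. p z \<in> hom K G F" for u p
    proof -
      have eq: "map (\<lambda>x. u \<cdot> x) (map \<nu> zs) = map p zs" using *(2) u(2) by auto
      have "u \<cdot> w = opn (alg F) (length (map p zs)) \<sigma> (map p zs)"
        using oalg_hom_opn[OF alg_hom[OF u(1)], of \<sigma> "map \<nu> zs"] *(1) nz
        unfolding eq *(3) length_map by blast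
      moreover have "set (map p zs) \<subseteq> carr (alg F)" using p *(2) by auto
      ultimately show ?thesis using oalg_hom_opn[OF ev_hom, of \<sigma> "map p zs"] *(1) by simp
    qed
    have "list_all2 (\<lambda>x y. (x, y) \<in> ord A) (map ev (map fst zs)) (map ev (map snd zs))"
      unfolding list_all2_conv_all_nth using *(2) unfolding N_def by (auto simp: subset_iff)
    then show ?thesis
      using eval_cotuple[OF u(1,3) N'(1)] eval_cotuple[OF u(2,4) N'(2)]
        opn_mono[OF model_preordered[OF A], of \<sigma> "map ev (map fst zs)"] *(1) by simp
  qed
  have q_le: "(q \<cdot> s, q \<cdot> t) \<in> hom_poset K G X \<longleftrightarrow> (ev s, ev t) \<in> ord A"
    if s: "s \<in> hom K G F" and t: "t \<in> hom K G F" for s t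
  proof
    assume "(q \<cdot> s, q \<cdot> t) \<in> hom_poset K G X"
    then have st: "(s, t) \<in> (hom_poset K G F \<union> inserted (\<lambda>z. u0 \<cdot> z) (\<lambda>z. u1 \<cdot> z) (hom K G L))\<^sup>+"
      using pc s t unfolding poset_coinserter_def by simp
    have "mono_rel (hom_poset K G F) (ord A) ev" using ev_hom unfolding oalg_hom_def by simp
    then show "(ev s, ev t) \<in> ord A"
      by (rule mono_on_generated[OF _ _ model_Preorder[OF A] st]) (use ins in \<open>auto simp:
        inserted_def\<close>)
  next
    assume "(ev s, ev t) \<in> ord A"
    then have st: "(s, t) \<in> N" unfolding N_def using s t by blast
    note nu = copower_hom[OF L st]
    have "((q \<cdot> u0) \<cdot> \<nu> (s, t), (q \<cdot> u1) \<cdot> \<nu> (s, t)) \<in> Le K"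
      using comp_le_left[OF coinserter_le[OF q] nu comp_hom[OF u(1) qh] comp_hom[OF u(2) qh]] .
    then show "(q \<cdot> s, q \<cdot> t) \<in> hom_poset K G X"
      unfolding hom_poset_iff using comp_assoc[OF nu u(1) qh] comp_assoc[OF nu u(2) qh] u(3,4) st
        comp_hom[OF s qh] comp_hom[OF t qh] by auto
  qed
  have q_eq: "q \<cdot> s = q \<cdot> t" if "s \<in> hom K G F" "t \<in> hom K G F" "ev s = ev t" for s t
  proof -
    have "(ev s, ev s) \<in> ord A"
      using preorder_refl[OF model_Preorder[OF A]] oalg_hom_carr[OF ev_hom] that(1) by simp
    then have "(q \<cdot> s, q \<cdot> t) \<in> Le K" "(q \<cdot> t, q \<cdot> s) \<in> Le K"
      using q_le[OF that(1,2)] q_le[OF that(2,1)] that(3) unfolding hom_poset_iff by auto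
    then show ?thesis using le_antisym comp_hom[OF that(1) qh] comp_hom[OF that(2) qh] by blast
  qed
  have i_le: "(q \<cdot> \<eta> x, q \<cdot> \<eta> y) \<in> hom_poset K G X \<longleftrightarrow> (x, y) \<in> ord A" if "x \<in> M" "y \<in> M" for x y
    using q_le[OF eh[OF that(1)] eh[OF that(2)]] ev_eta that by simp
  have "oalg_hom sig A (alg X) (\<lambda>x. q \<cdot> \<eta> x)"
    unfolding oalg_hom_def
  proof (intro conjI allI impI)
    show "mono_rel (ord A) (ord (alg X)) (\<lambda>x. q \<cdot> \<eta> x)"
      unfolding mono_rel_def
    proof (intro allI impI)
      fix x y assume xy: "(x, y) \<in> ord A"
      then have "x \<in> M" "y \<in> M" unfolding M_def by (auto intro: FieldI1 FieldI2)
      then show "(q \<cdot> \<eta> x, q \<cdot> \<eta> y) \<in> ord (alg X)" using i_le xy by simp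
    qed
    fix \<sigma> xs assume *: "\<sigma> \<in> sig (length xs) \<and> set xs \<subseteq> carr A"
    have xs: "set (map \<eta> xs) \<subseteq> carr (alg F)" using * eh unfolding M_def by auto
    define s where "s = opn (alg F) (length xs) \<sigma> (map \<eta> xs)"
    have s: "s \<in> hom K G F"
      using opn_closed[OF alg_preordered[OF FO], of \<sigma> "map \<eta> xs"] xs * unfolding s_def by simp
    have "map ev (map \<eta> xs) = xs"
      unfolding map_map using ev_eta * unfolding M_def by (intro map_idI) auto
    then have "ev s = opn A (length xs) \<sigma> xs"
      using oalg_hom_opn[OF ev_hom, of \<sigma> "map \<eta> xs"] xs * unfolding s_def by simp
    moreover have a: "opn A (length xs) \<sigma> xs \<in> M"
      using opn_closed[OF model_preordered[OF A]] * unfolding M_def by blast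
    ultimately have "q \<cdot> \<eta> (opn A (length xs) \<sigma> xs) = q \<cdot> s"
      using q_eq[OF eh[OF a] s] ev_eta[OF a] by simp
    also have "\<dots> = opn (alg X) (length xs) \<sigma> (map (\<lambda>x. q \<cdot> \<eta> x) xs)"
      using oalg_hom_opn[OF alg_hom[OF qh], of \<sigma> "map \<eta> xs"] xs * unfolding s_def
        by (simp add: comp_def)
    finally show "q \<cdot> \<eta> (opn A (length xs) \<sigma> xs) = opn (alg X) (length xs) \<sigma> (map (\<lambda>x. q \<cdot> \<eta> x) xs)"
      .
  qed
  moreover have "(\<lambda>x. q \<cdot> \<eta> x) ` carr A = carr (alg X)"
  proof
    show "(\<lambda>x. q \<cdot> \<eta> x) ` carr A \<subseteq> carr (alg X)" using comp_hom[OF eh qh] unfolding M_def by auto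
    show "carr (alg X) \<subseteq> (\<lambda>x. q \<cdot> \<eta> x) ` carr A"
    proof
      fix y assume "y \<in> carr (alg X)"
      then have "y \<in> (\<lambda>s. q \<cdot> s) ` hom K G F" using pc unfolding poset_coinserter_def by simp
      then obtain s where s: "s \<in> hom K G F" "y = q \<cdot> s" by blast
      have a: "ev s \<in> M" using oalg_hom_carr[OF ev_hom] s(1) unfolding M_def by simp
      have "y = q \<cdot> \<eta> (ev s)" using q_eq[OF s(1) eh[OF a]] ev_eta[OF a] s(2) by simp
      then show "y \<in> (\<lambda>x. q \<cdot> \<eta> x) ` carr A" using a unfolding M_def by blast
    qed
  qed
  ultimately have "oalg_iso sig A (alg X) (\<lambda>x. q \<cdot> \<eta> x)"
    unfolding oalg_iso_def using i_le unfolding M_def by simp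
  then show ?thesis using X by blast
qed

lemma represented_by_points: "represented K U sig ineqs alg (\<lambda>h x. h \<cdot> x)"
proof unfold_locales
  fix X assume X: "X \<in> Obj K"
  show "alg X \<in> models U sig ineqs" using alg_model[OF X] .
  fix x assume "x \<in> carr (alg X)"
  then show "Idt K X \<cdot> x = x" using comp_id_left by simp
next
  fix h X Y assume "h \<in> hom K X Y"
  then show "oalg_hom sig (alg X) (alg Y) (\<lambda>x. h \<cdot> x)" by (rule alg_hom)
next
  fix h X Y k Z x assume "h \<in> hom K X Y" "k \<in> hom K Y Z" "x \<in> carr (alg X)"
  then show "(k \<cdot> h) \<cdot> x = k \<cdot> (h \<cdot> x)" using comp_assoc by simp
next
  fix h X Y h' assume h: "h \<in> hom K X Y" "h' \<in> hom K X Y"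
  show "(h, h') \<in> Le K \<longleftrightarrow> (\<forall>x\<in>carr (alg X). (h \<cdot> x, h' \<cdot> x) \<in> ord (alg Y))"
    using hom_le_if_points_le[OF h] comp_le_left[OF _ _ h] comp_hom[OF _ h(1)] comp_hom[OF _ h(2)]
    by (auto simp: hom_poset_iff)
next
  fix X Y f assume o: "X \<in> Obj K" "Y \<in> Obj K" and f: "oalg_hom sig (alg X) (alg Y) f"
  obtain h where "h \<in> hom K X Y" "\<forall>x\<in>hom K G X. h \<cdot> x = f x" using full[OF o f] .
  then show "\<exists>h\<in>hom K X Y. \<forall>x\<in>carr (alg X). h \<cdot> x = f x" by auto
next
  fix A :: "('u, 'u) oalg" assume "A \<in> models U sig ineqs"
  then show "\<exists>X\<in>Obj K. \<exists>i. oalg_iso sig A (alg X) i" by (rule essentially_surjective)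
qed

end

theorem variety_if_generator:
  fixes K :: "('o, 'a) poscat"
  assumes "universe TYPE('u)" "pos_category K" "has_reflexive_coinserters K"
    and "subregular_generator TYPE('u) K G" "abstractly_finite TYPE('u) K G"
      "subeffective_projective TYPE('u) K G"
  shows "\<exists>V :: (('u, 'u) oalg, ('u, 'u) oalg \<times> ('u, 'u) oalg \<times> ('u \<Rightarrow> 'u)) poscat. variety V
    \<and> equivalent K V"
proof -
  interpret generator K "TYPE('u)" G
    using assms unfolding generator_def generator_axioms_def by blast
  have ineqs: "inequations sig ineqs" unfolding ineqs_def by blast
  have "variety (model_cat TYPE('u) sig ineqs)" unfolding variety_iff using small_sig ineqs by blast
  moreover have "equivalent K (model_cat TYPE('u) sig ineqs)"
    using represented.equivalent_models[OF represented_by_points ineqs] .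
  ultimately show ?thesis by blast
qed

section \<open>The characterization\<close>

theorem theorem4p8:
  fixes K :: "('o, 'a) poscat"
  assumes "universe TYPE('u)"
    and "pos_category K"
    and "has_reflexive_coinserters K"
  shows "(\<exists>V :: (('u, 'u) oalg, ('u, 'u) oalg \<times> ('u, 'u) oalg \<times> ('u \<Rightarrow> 'u)) poscat.
            variety V \<and> equivalent K V) \<longleftrightarrow>
         (\<exists>G. subregular_generator TYPE('u) K G \<and> abstractly_finite TYPE('u) K G \<and>
              subeffective_projective TYPE('u) K G)"
  using generator_if_variety[OF assms(1,2)] variety_if_generator[OF assms] by blast

end
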